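(* Let $\{e^1(t),e^2(t),e^3(t)\}_{t\in[0,1]}$ be an admissible family of coframes on $\mathbb{T}^3$ with coefficients $a_1,b_2,b_3$ and $l=b_2^2+b_3^2$ (as defined in the context). Suppose that there exists a diffeomorphism $\rho$ of $\mathbb{T}^3$ such that $\rho^*\big(e^i(1)_{\rho(\underline{x})}\big)=e^i(0)_{\underline{x}}$ for $i=1,2,3$, and that $\big(\tfrac{1}{l(t)}\big)'\cdot\tfrac{1}{a_1}=\mathrm{const}\neq 0$. Then the mapping torus $\mathbb{T}^3_\rho$ of $\mathbb{T}^3$ by $\rho$ admits a split generalized Kähler structure and it is biholomorphic to an Inoue surface in the family $S_M$.
   Context: Mapping torus: $\mathbb{T}^3_\rho=\dfrac{\mathbb{T}^3\times[0,1]}{(\underline{x},0)\sim(\rho(\underline{x}),1)}$; equivalently the quotient of $\mathbb{T}^3\times\mathbb{R}$ by the $\mathbb{Z}$-action $n\cdot(\underline{x},t)=(\rho^n(\underline{x}),t+n)$. Generalized Kähler structure on a $2n$-dimensional manifold: a triple $(g,J_+,J_-)$, where $g$ is a Riemannian metric and $J_\pm$ are two (integrable) complex structures, each compatible with $g$, such that the fundamental forms $\omega_\pm$ of $(g,J_\pm)$ satisfy $d^c_+\omega_+=-d^c_-\omega_-=H$ with $H$ a closed $3$-form. Here $d^c_\pm=J_\pm^{-1}\,d\,J_\pm$ is the real Dolbeault operator of $J_\pm$. The structure is split if $[J_+,J_-]=0$ and non-split otherwise. Admissible family of coframes on $\mathbb{T}^3$: let $(x^1,x^2,x^3)$ be local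 coordinates on $\mathbb{T}^3$ regarded as the quotient manifold $\mathbb{Z}^3\backslash\mathbb{R}^3$. Let $a_1,b_2,b_3$ be real smooth functions of $t\in[0,1]$ such that for every fixed $t$ the vector fields $$e_1(t)=a_1(t)\tfrac{\partial}{\partial x^1},\quad e_2(t)=b_2(t)\tfrac{\partial}{\partial x^2}+b_3(t)\tfrac{\partial}{\partial x^3},\quad e_3(t)=-b_3(t)\tfrac{\partial}{\partial x^2}+b_2(t)\tfrac{\partial}{\partial x^3}$$ form a basis of vector fields on $\mathbb{T}^3$. Put $l=b_2^2+b_3^2>0$, $v=b_2b_2'+b_3b_3'=\tfrac12 l'$, $w=b_2b_3'-b_3b_2'$, and require $$\frac{v(1)}{l(1)}=\frac{v(0)}{l(0)},\qquad \frac{w(1)}{l(1)}=\frac{w(0)}{l(0)}.$$ The dual coframe is $$e^1(t)=\tfrac{1}{a_1(t)}dx^1,\quad e^2(t)=\tfrac{b_2(t)}{l(t)}dx^2+\tfrac{b_3(t)}{l(t)}dx^3,\quad e^3(t)=-\tfrac{b_3(t)}{l(t)}dx^2+\tfrac{b_2(t)}{l(t)}dx^3 .$$ The complex structures on $\mathbb{T}^3_\rho$: by the condition on $\rho$, the $e^i(t)$ and $e_i(t)$ descend to global $1$-forms $e^i$ and vector fields $e_i$ on $\mathbb{T}^3_\rho$. Let $\theta$ be the pullback of the volume form of $S^1$ (locally $\theta=dt$ up to rescaling) and $\frac{\partial}{\partial\theta}$ the vector field locally equal to $\frac{\partial}{\partial t}$. The generalized Kähler structure is given by $g=\sum_{i=1}^3(e^i)^2+\theta^2$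 and $J_\pm(e_1)=\frac{\partial}{\partial\theta}$, $J_\pm(e_2)=\pm e_3$, $J_\pm(e_3)=\mp e_2$; the biholomorphism refers to $(\mathbb{T}^3_\rho,J_\pm)$. Inoue surfaces in the family $S_M$: let $M\in SL(3,\mathbb{Z})$ have one real eigenvalue $\alpha>1$ and two non-real complex conjugate eigenvalues $\beta,\bar\beta$; let $(r_1,r_2,r_3)^t$ be a real eigenvector for $\alpha$ and $(s_1,s_2,s_3)^t$ an eigenvector for $\beta$. Then $S_M$ is the quotient of $\mathbb{H}\times\mathbb{C}$ ($\mathbb{H}$ the upper half plane) by the group generated by $(w,z)\mapsto(\alpha w,\beta z)$ and $(w,z)\mapsto(w+r_i,z+s_i)$, $i=1,2,3$.
   Formalization: The torus is taken with an arbitrary lattice; existence and both biholomorphisms are unconditional, but the explicit metric g with J± is claimed generalized Kähler only if the descended forms e^i are smooth, since the gluing conditions do not ensure this. *)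

theory Defs
  imports "HOL-Analysis.Analysis"
begin

section \<open>Smooth maps\<close>

text \<open>Used for open sets and for the closed interval \<open>{0..1}\<close>, where derivatives at the end
  points are one-sided. For both, the derivative within the set is unique.\<close>

primrec Ck_on :: "nat \<Rightarrow> 'a::real_normed_vector set \<Rightarrow> ('a \<Rightarrow> 'b::real_normed_vector) \<Rightarrow> bool" where
  "Ck_on 0 S f \<longleftrightarrow> continuous_on S f"
| "Ck_on (Suc k) S f \<longleftrightarrow>
     f differentiable_on S \<and> (\<forall>v. Ck_on k S (\<lambda>x. frechet_derivative f (at x within S) v))"

definition smooth_on :: "'a::real_normed_vector set \<Rightarrow> ('a \<Rightarrow> 'b::real_normed_vector) \<Rightarrow> bool" where
  "smooth_on S f \<longleftrightarrow> (\<forall>k. Ck_on k S f)"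


section \<open>Manifolds\<close>

text \<open>An atlas is a set of local parametrizations \<open>(V, \<phi>)\<close>, that is, of injective maps \<open>\<phi>\<close> from an
  open set \<open>V\<close> of the model space into the set of points; the charts are their inverses.\<close>

type_synonym ('e, 'm) param = "'e set \<times> ('e \<Rightarrow> 'm)"

definition coords :: "('e, 'm) param \<Rightarrow> 'm \<Rightarrow> 'e" where
  "coords c = the_inv_into (fst c) (snd c)"

definition local_map :: "('e, 'm) param \<Rightarrow> ('f, 'n) param \<Rightarrow> ('m \<Rightarrow> 'n) \<Rightarrow> 'e \<Rightarrow> 'f" where
  "local_map c d F = coords d \<circ> F \<circ> snd c"

definition differential ::
  "('e::real_normed_vector, 'm) param \<Rightarrow> ('f::real_normed_vector, 'n) param \<Rightarrow> ('m \<Rightarrow> 'n) \<Rightarrow> 'e \<Rightarrow> 'e \<Rightarrow> 'f"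
  where "differential c d F x = frechet_derivative (local_map c d F) (at x)"

definition local_dom :: "('e, 'm) param \<Rightarrow> ('f, 'n) param \<Rightarrow> ('m \<Rightarrow> 'n) \<Rightarrow> 'e set" where
  "local_dom c d F = {x \<in> fst c. F (snd c x) \<in> snd d ` fst d}"

definition manifold_open :: "'m set \<Rightarrow> ('e::topological_space, 'm) param set \<Rightarrow> 'm set \<Rightarrow> bool" where
  "manifold_open M A X \<longleftrightarrow> X \<subseteq> M \<and> (\<forall>c\<in>A. open {x \<in> fst c. snd c x \<in> X})"

lemma istopology_manifold_open:
  fixes A :: "('e::topological_space, 'm) param set"
  shows "istopology (manifold_open M A)"
proof -
  have "open {x \<in> fst c. snd c x \<in> S \<inter> T}"
    if "open {x \<in> fst c. snd c x \<in> S}" "open {x \<in> fst c. snd c x \<in> T}"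
    for c :: "('e, 'm) param" and S T
  proof -
    have "{x \<in> fst c. snd c x \<in> S \<inter> T} = {x \<in> fst c. snd c x \<in> S} \<inter> {x \<in> fst c. snd c x \<in> T}"
      by blast
    then show ?thesis using that by (simp add: open_Int)
  qed
  moreover have "open {x \<in> fst c. snd c x \<in> \<Union>K}"
    if "\<forall>S\<in>K. open {x \<in> fst c. snd c x \<in> S}" for c :: "('e, 'm) param" and K
  proof -
    have "{x \<in> fst c. snd c x \<in> \<Union>K} = (\<Union>S\<in>K. {x \<in> fst c. snd c x \<in> S})"
      by blast
    then show ?thesis using that by (simp add: open_UN)
  qed
  ultimately show ?thesis
    unfolding istopology_def manifold_open_def by (simp add: le_infI1 Sup_le_iff)
qed

definition manifold_topology :: "'m set \<Rightarrow> ('e::topological_space, 'm) param set \<Rightarrow> 'm topology" where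
  "manifold_topology M A = topology (manifold_open M A)"

definition smooth_manifold :: "'m set \<Rightarrow> ('e::euclidean_space, 'm) param set \<Rightarrow> bool" where
  "smooth_manifold M A \<longleftrightarrow>
     (\<forall>c\<in>A. open (fst c) \<and> inj_on (snd c) (fst c)) \<and>
     (\<Union>c\<in>A. snd c ` fst c) = M \<and>
     (\<forall>c\<in>A. \<forall>d\<in>A. open (local_dom c d id) \<and> smooth_on (local_dom c d id) (local_map c d id)) \<and>
     Hausdorff_space (manifold_topology M A) \<and>
     second_countable (manifold_topology M A)"

definition smooth_map ::
  "('e::euclidean_space, 'm) param set \<Rightarrow> ('f::euclidean_space, 'n) param set \<Rightarrow> ('m \<Rightarrow> 'n) \<Rightarrow> bool" where
  "smooth_map A B F \<longleftrightarrow>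
     (\<forall>c\<in>A. \<forall>x\<in>fst c. \<exists>d\<in>B. \<exists>X. open X \<and> x \<in> X \<and> X \<subseteq> local_dom c d F \<and> smooth_on X (local_map c d F))"

definition diffeomorphism ::
  "'m set \<Rightarrow> ('e::euclidean_space, 'm) param set \<Rightarrow> 'n set \<Rightarrow> ('f::euclidean_space, 'n) param set
    \<Rightarrow> ('m \<Rightarrow> 'n) \<Rightarrow> bool" where
  "diffeomorphism M A N B F \<longleftrightarrow>
     bij_betw F M N \<and> smooth_map A B F \<and> smooth_map B A (the_inv_into M F)"

text \<open>The atlas of a quotient of an open set \<open>U\<close> by a group acting freely and properly
  discontinuously by diffeomorphisms, with quotient map \<open>\<pi>\<close>: the inverse charts are the restrictions
  of \<open>\<pi>\<close> to the open sets on which it is injective.\<close>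

definition quotient_atlas :: "'e::topological_space set \<Rightarrow> ('e \<Rightarrow> 'm) \<Rightarrow> ('e, 'm) param set" where
  "quotient_atlas U \<pi> = {(V, \<pi>) | V. open V \<and> V \<subseteq> U \<and> inj_on \<pi> V}"


section \<open>Tensor fields\<close>

text \<open>A tensor field is given by its expression in every parametrization \<open>c\<close> at every coordinate
  point \<open>x \<in> fst c\<close>; the expressions must transform correctly under changes of coordinates.\<close>

type_synonym ('e, 'm, 't) field = "('e, 'm) param \<Rightarrow> 'e \<Rightarrow> 't"

definition one_form :: "('e::euclidean_space, 'm) param set \<Rightarrow> ('e, 'm, 'e \<Rightarrow> real) field \<Rightarrow> bool" where
  "one_form A \<eta> \<longleftrightarrow>
     (\<forall>c\<in>A. \<forall>x\<in>fst c. linear (\<eta> c x)) \<and>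
     (\<forall>c\<in>A. \<forall>d\<in>A. \<forall>x\<in>local_dom c d id. \<forall>u.
        \<eta> d (local_map c d id x) (differential c d id x u) = \<eta> c x u)"

definition smooth_one_form :: "('e::euclidean_space, 'm) param set \<Rightarrow> ('e, 'm, 'e \<Rightarrow> real) field \<Rightarrow> bool" where
  "smooth_one_form A \<eta> \<longleftrightarrow> one_form A \<eta> \<and> (\<forall>c\<in>A. \<forall>u. smooth_on (fst c) (\<lambda>x. \<eta> c x u))"

text \<open>\<open>F\<^sup>*\<eta> = \<zeta>\<close> for one-forms \<open>\<eta>\<close> on the target and \<open>\<zeta>\<close> on the source of \<open>F\<close>.\<close>

definition pullback_is ::
  "('e::euclidean_space, 'm) param set \<Rightarrow> ('f::euclidean_space, 'n) param set \<Rightarrow> ('m \<Rightarrow> 'n)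
    \<Rightarrow> ('f, 'n, 'f \<Rightarrow> real) field \<Rightarrow> ('e, 'm, 'e \<Rightarrow> real) field \<Rightarrow> bool" where
  "pullback_is A B F \<eta> \<zeta> \<longleftrightarrow>
     (\<forall>c\<in>A. \<forall>d\<in>B. \<forall>x\<in>local_dom c d F. \<forall>u.
        \<eta> d (local_map c d F x) (differential c d F x u) = \<zeta> c x u)"

definition vector_field :: "('e::euclidean_space, 'm) param set \<Rightarrow> ('e, 'm, 'e) field \<Rightarrow> bool" where
  "vector_field A X \<longleftrightarrow>
     (\<forall>c\<in>A. \<forall>d\<in>A. \<forall>x\<in>local_dom c d id.
        differential c d id x (X c x) = X d (local_map c d id x))"

definition riemannian_metric ::
  "('e::euclidean_space, 'm) param set \<Rightarrow> ('e, 'm, 'e \<Rightarrow> 'e \<Rightarrow> real) field \<Rightarrow> bool" where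
  "riemannian_metric A g \<longleftrightarrow>
     (\<forall>c\<in>A. \<forall>x\<in>fst c. bilinear (g c x) \<and> (\<forall>u v. g c x u v = g c x v u) \<and> (\<forall>u. u \<noteq> 0 \<longrightarrow> g c x u u > 0)) \<and>
     (\<forall>c\<in>A. \<forall>d\<in>A. \<forall>x\<in>local_dom c d id. \<forall>u v.
        g d (local_map c d id x) (differential c d id x u) (differential c d id x v) = g c x u v) \<and>
     (\<forall>c\<in>A. \<forall>u v. smooth_on (fst c) (\<lambda>x. g c x u v))"

definition lie_bracket :: "('e::real_normed_vector \<Rightarrow> 'e) \<Rightarrow> ('e \<Rightarrow> 'e) \<Rightarrow> 'e \<Rightarrow> 'e" where
  "lie_bracket X Y x = frechet_derivative Y (at x) (X x) - frechet_derivative X (at x) (Y x)"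

text \<open>The Nijenhuis tensor in coordinates, on the constant vector fields \<open>u\<close> and \<open>v\<close>
  (which suffices, as it is a tensor).\<close>

definition nijenhuis :: "('e::real_normed_vector \<Rightarrow> 'e \<Rightarrow> 'e) \<Rightarrow> 'e \<Rightarrow> 'e \<Rightarrow> 'e \<Rightarrow> 'e" where
  "nijenhuis J x u v =
     lie_bracket (\<lambda>_. u) (\<lambda>_. v) x
     + J x (lie_bracket (\<lambda>y. J y u) (\<lambda>_. v) x)
     + J x (lie_bracket (\<lambda>_. u) (\<lambda>y. J y v) x)
     - lie_bracket (\<lambda>y. J y u) (\<lambda>y. J y v) x"

definition complex_structure ::
  "('e::euclidean_space, 'm) param set \<Rightarrow> ('e, 'm, 'e \<Rightarrow> 'e) field \<Rightarrow> bool" where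
  "complex_structure A J \<longleftrightarrow>
     (\<forall>c\<in>A. \<forall>x\<in>fst c. linear (J c x) \<and> (\<forall>u. J c x (J c x u) = - u)) \<and>
     (\<forall>c\<in>A. \<forall>d\<in>A. \<forall>x\<in>local_dom c d id. \<forall>u.
        differential c d id x (J c x u) = J d (local_map c d id x) (differential c d id x u)) \<and>
     (\<forall>c\<in>A. \<forall>u. smooth_on (fst c) (\<lambda>x. J c x u)) \<and>
     (\<forall>c\<in>A. \<forall>x\<in>fst c. \<forall>u v. nijenhuis (J c) x u v = 0)"

text \<open>Differential forms on open subsets of the model space take the list of their arguments; a
  \<open>k\<close>-form is only meaningful on lists of length \<open>k\<close>. The exterior derivative is normalized by
  \<open>d\<eta>(v\<^sub>0,\<dots>,v\<^sub>k) = \<Sum>\<^sub>i (-1)\<^sup>i D\<eta>(v\<^sub>i)(v\<^sub>0,\<dots>,v\<^sub>k without v\<^sub>i)\<close>.\<close>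

definition ext_deriv :: "('e::real_normed_vector \<Rightarrow> 'e list \<Rightarrow> real) \<Rightarrow> 'e \<Rightarrow> 'e list \<Rightarrow> real" where
  "ext_deriv \<eta> x vs =
     (\<Sum>i<length vs. (-1) ^ i * frechet_derivative (\<lambda>y. \<eta> y (take i vs @ drop (Suc i) vs)) (at x) (vs ! i))"

text \<open>Conventions: \<open>\<omega>(u,v) = g(Ju,v)\<close>, and \<open>J\<close> acts on forms by \<open>(J\<eta>)(v\<^sub>1,\<dots>,v\<^sub>k) = \<eta>(Jv\<^sub>1,\<dots>,Jv\<^sub>k)\<close>.
  The opposite conventions only change the common sign of \<open>d\<^sup>c\<^sub>+\<omega>\<^sub>+\<close> and \<open>d\<^sup>c\<^sub>-\<omega>\<^sub>-\<close>.\<close>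

definition fundamental_form ::
  "('e \<Rightarrow> 'e \<Rightarrow> 'e \<Rightarrow> real) \<Rightarrow> ('e \<Rightarrow> 'e \<Rightarrow> 'e) \<Rightarrow> 'e \<Rightarrow> 'e list \<Rightarrow> real" where
  "fundamental_form g J x vs = g x (J x (vs ! 0)) (vs ! 1)"

definition d_c ::
  "('e::real_normed_vector \<Rightarrow> 'e \<Rightarrow> 'e) \<Rightarrow> ('e \<Rightarrow> 'e list \<Rightarrow> real) \<Rightarrow> 'e \<Rightarrow> 'e list \<Rightarrow> real" where
  "d_c J \<eta> x vs = ext_deriv (\<lambda>y us. \<eta> y (map (J y) us)) x (map (inv (J x)) vs)"

definition generalized_Kaehler ::
  "'m set \<Rightarrow> ('e::euclidean_space, 'm) param set \<Rightarrow> ('e, 'm, 'e \<Rightarrow> 'e \<Rightarrow> real) field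
    \<Rightarrow> ('e, 'm, 'e \<Rightarrow> 'e) field \<Rightarrow> ('e, 'm, 'e \<Rightarrow> 'e) field \<Rightarrow> bool" where
  "generalized_Kaehler M A g Jp Jm \<longleftrightarrow>
     smooth_manifold M A \<and> riemannian_metric A g \<and>
     complex_structure A Jp \<and> complex_structure A Jm \<and>
     (\<forall>c\<in>A. \<forall>x\<in>fst c. \<forall>u v. g c x (Jp c x u) (Jp c x v) = g c x u v \<and> g c x (Jm c x u) (Jm c x v) = g c x u v) \<and>
     (\<forall>c\<in>A. \<forall>x\<in>fst c.
        (\<forall>vs. length vs = 3 \<longrightarrow>
           d_c (Jp c) (fundamental_form (g c) (Jp c)) x vs = - d_c (Jm c) (fundamental_form (g c) (Jm c)) x vs) \<and>
        (\<forall>vs. length vs = 4 \<longrightarrow>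
           ext_deriv (d_c (Jp c) (fundamental_form (g c) (Jp c))) x vs = 0))"

definition split_generalized_Kaehler ::
  "'m set \<Rightarrow> ('e::euclidean_space, 'm) param set \<Rightarrow> ('e, 'm, 'e \<Rightarrow> 'e \<Rightarrow> real) field
    \<Rightarrow> ('e, 'm, 'e \<Rightarrow> 'e) field \<Rightarrow> ('e, 'm, 'e \<Rightarrow> 'e) field \<Rightarrow> bool" where
  "split_generalized_Kaehler M A g Jp Jm \<longleftrightarrow>
     generalized_Kaehler M A g Jp Jm \<and>
     (\<forall>c\<in>A. \<forall>x\<in>fst c. \<forall>u. Jp c x (Jm c x u) = Jm c x (Jp c x u))"

text \<open>Holomorphic means differentiable with complex linear differential; for this \<open>J\<close> and \<open>K\<close> need
  not be smooth.\<close>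

definition holomorphic_map ::
  "('e::euclidean_space, 'm) param set \<Rightarrow> ('e, 'm, 'e \<Rightarrow> 'e) field
    \<Rightarrow> ('f::euclidean_space, 'n) param set \<Rightarrow> ('f, 'n, 'f \<Rightarrow> 'f) field \<Rightarrow> ('m \<Rightarrow> 'n) \<Rightarrow> bool" where
  "holomorphic_map A J B K F \<longleftrightarrow>
     (\<forall>c\<in>A. \<forall>x\<in>fst c. \<exists>d\<in>B. x \<in> interior (local_dom c d F) \<and>
        local_map c d F differentiable at x \<and>
        (\<forall>u. differential c d F x (J c x u) = K d (local_map c d F x) (differential c d F x u)))"

definition biholomorphic ::
  "'m set \<Rightarrow> ('e::euclidean_space, 'm) param set \<Rightarrow> ('e, 'm, 'e \<Rightarrow> 'e) field
    \<Rightarrow> 'n set \<Rightarrow> ('f::euclidean_space, 'n) param set \<Rightarrow> ('f, 'n, 'f \<Rightarrow> 'f) field \<Rightarrow> bool" where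
  "biholomorphic M A J N B K \<longleftrightarrow>
     (\<exists>F. bij_betw F M N \<and> holomorphic_map A J B K F \<and> holomorphic_map B K A J (the_inv_into M F))"


section \<open>The torus and the mapping torus\<close>

text \<open>\<open>\<int>\<^sup>3\<close> acts on \<open>\<real>\<^sup>3\<close> by the translations of the lattice spanned by the columns of \<open>L\<close>, where
  \<open>(x\<^sup>1,x\<^sup>2,x\<^sup>3)\<close> are the standard coordinates of \<open>\<real>\<^sup>3\<close>. A general lattice is essential: for \<open>L = mat 1\<close>
  the monodromy would be an integer matrix respecting the splitting into the \<open>x\<^sup>1\<close>-axis and the
  \<open>x\<^sup>2x\<^sup>3\<close>-plane, which forces \<open>l 0 = l 1\<close>.\<close>

type_synonym torus_point = "(real^3) set"

definition torus_proj :: "real^3^3 \<Rightarrow> real^3 \<Rightarrow> torus_point" where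
  "torus_proj L x = {x + L *v (\<chi> i. of_int (k $ i)) | k :: int^3. True}"

definition torus :: "real^3^3 \<Rightarrow> torus_point set" where
  "torus L = range (torus_proj L)"

definition torus_atlas :: "real^3^3 \<Rightarrow> (real^3, torus_point) param set" where
  "torus_atlas L = quotient_atlas UNIV (torus_proj L)"

definition torus_iter :: "real^3^3 \<Rightarrow> (torus_point \<Rightarrow> torus_point) \<Rightarrow> int \<Rightarrow> torus_point \<Rightarrow> torus_point" where
  "torus_iter L \<rho> n =
     (if n \<ge> 0 then \<rho> ^^ nat n else the_inv_into (torus L) \<rho> ^^ nat (- n))"

text \<open>The quotient map \<open>\<real>\<^sup>3 \<times> \<real> \<rightarrow> \<T>\<^sup>3 \<times> \<real> \<rightarrow> (\<T>\<^sup>3 \<times> \<real>)/\<int>\<close> for the action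
  \<open>n \<cdot> (p, t) = (\<rho>\<^sup>n(p), t + n)\<close>; the points of the mapping torus are the orbits.\<close>

definition mapping_torus_proj ::
  "real^3^3 \<Rightarrow> (torus_point \<Rightarrow> torus_point) \<Rightarrow> (real^3) \<times> real \<Rightarrow> (torus_point \<times> real) set" where
  "mapping_torus_proj L \<rho> y =
     {(torus_iter L \<rho> n (torus_proj L (fst y)), snd y + of_int n) | n. True}"

definition mapping_torus ::
  "real^3^3 \<Rightarrow> (torus_point \<Rightarrow> torus_point) \<Rightarrow> (torus_point \<times> real) set set" where
  "mapping_torus L \<rho> = range (mapping_torus_proj L \<rho>)"

definition mapping_torus_atlas ::
  "real^3^3 \<Rightarrow> (torus_point \<Rightarrow> torus_point) \<Rightarrow> ((real^3) \<times> real, (torus_point \<times> real) set) param set" where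
  "mapping_torus_atlas L \<rho> = quotient_atlas UNIV (mapping_torus_proj L \<rho>)"


section \<open>Admissible families of coframes\<close>

definition frame ::
  "(real \<Rightarrow> real) \<Rightarrow> (real \<Rightarrow> real) \<Rightarrow> (real \<Rightarrow> real) \<Rightarrow> 3 \<Rightarrow> real \<Rightarrow> real^3" where
  "frame a1 b2 b3 i t =
     (if i = 1 then vector [a1 t, 0, 0]
      else if i = 2 then vector [0, b2 t, b3 t]
      else vector [0, - b3 t, b2 t])"

definition lfun :: "(real \<Rightarrow> real) \<Rightarrow> (real \<Rightarrow> real) \<Rightarrow> real \<Rightarrow> real" where
  "lfun b2 b3 t = (b2 t)\<^sup>2 + (b3 t)\<^sup>2"

definition deriv01 :: "(real \<Rightarrow> real) \<Rightarrow> real \<Rightarrow> real" where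
  "deriv01 f t = vector_derivative f (at t within {0..1})"

definition vfun :: "(real \<Rightarrow> real) \<Rightarrow> (real \<Rightarrow> real) \<Rightarrow> real \<Rightarrow> real" where
  "vfun b2 b3 t = b2 t * deriv01 b2 t + b3 t * deriv01 b3 t"

definition wfun :: "(real \<Rightarrow> real) \<Rightarrow> (real \<Rightarrow> real) \<Rightarrow> real \<Rightarrow> real" where
  "wfun b2 b3 t = b2 t * deriv01 b3 t - b3 t * deriv01 b2 t"

definition coframe ::
  "(real \<Rightarrow> real) \<Rightarrow> (real \<Rightarrow> real) \<Rightarrow> (real \<Rightarrow> real) \<Rightarrow> 3 \<Rightarrow> real \<Rightarrow> real^3 \<Rightarrow> real" where
  "coframe a1 b2 b3 i t u =
     (if i = 1 then 1 / a1 t * u$1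
      else if i = 2 then b2 t / lfun b2 b3 t * u$2 + b3 t / lfun b2 b3 t * u$3
      else - b3 t / lfun b2 b3 t * u$2 + b2 t / lfun b2 b3 t * u$3)"

definition admissible :: "(real \<Rightarrow> real) \<Rightarrow> (real \<Rightarrow> real) \<Rightarrow> (real \<Rightarrow> real) \<Rightarrow> bool" where
  "admissible a1 b2 b3 \<longleftrightarrow>
     smooth_on {0..1} a1 \<and> smooth_on {0..1} b2 \<and> smooth_on {0..1} b3 \<and>
     (\<forall>t\<in>{0..1}. inj (\<lambda>i. frame a1 b2 b3 i t) \<and> independent (range (\<lambda>i. frame a1 b2 b3 i t)) \<and>
        span (range (\<lambda>i. frame a1 b2 b3 i t)) = UNIV) \<and>
     vfun b2 b3 1 / lfun b2 b3 1 = vfun b2 b3 0 / lfun b2 b3 0 \<and>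
     wfun b2 b3 1 / lfun b2 b3 1 = wfun b2 b3 0 / lfun b2 b3 0"

text \<open>The forms \<open>e\<^sup>i\<close> and vector fields \<open>e\<^sub>i\<close> on the mapping torus induced by \<open>e\<^sup>i(t)\<close> and \<open>e\<^sub>i(t)\<close>:
  they are prescribed for \<open>t \<in> {0..1}\<close>, and the transformation rules determine the rest, because
  the slab \<open>\<real>\<^sup>3 \<times> {0..1}\<close> meets every orbit. No smoothness is required here: at the fibres
  \<open>t \<in> \<int>\<close> the pieces need not fit together smoothly.\<close>

definition induced_coframe where
  "induced_coframe L \<rho> a1 b2 b3 (e :: 3 \<Rightarrow> ((real^3) \<times> real, (torus_point \<times> real) set, (real^3) \<times> real \<Rightarrow> real) field) \<longleftrightarrow>
     (\<forall>i. one_form (mapping_torus_atlas L \<rho>) (e i) \<and>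
       (\<forall>c\<in>mapping_torus_atlas L \<rho>. \<forall>y\<in>fst c. snd y \<in> {0..1} \<longrightarrow>
          (\<forall>u. e i c y u = coframe a1 b2 b3 i (snd y) (fst u))))"

definition induced_frame where
  "induced_frame L \<rho> a1 b2 b3 (E :: 3 \<Rightarrow> ((real^3) \<times> real, (torus_point \<times> real) set, (real^3) \<times> real) field) \<longleftrightarrow>
     (\<forall>i. vector_field (mapping_torus_atlas L \<rho>) (E i) \<and>
       (\<forall>c\<in>mapping_torus_atlas L \<rho>. \<forall>y\<in>fst c. snd y \<in> {0..1} \<longrightarrow>
          E i c y = (frame a1 b2 b3 i (snd y), 0)))"

text \<open>\<open>g = \<Sum>\<^sub>i (e\<^sup>i)\<^sup>2 + \<theta>\<^sup>2\<close> with \<open>\<theta> = dt\<close>, and, for \<open>\<epsilon> = 1\<close> and \<open>\<epsilon> = -1\<close>, the endomorphism with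
  \<open>J(e\<^sub>1) = \<partial>/\<partial>\<theta>\<close>, \<open>J(e\<^sub>2) = \<epsilon> e\<^sub>3\<close>, \<open>J(e\<^sub>3) = -\<epsilon> e\<^sub>2\<close>, hence \<open>J(\<partial>/\<partial>\<theta>) = -e\<^sub>1\<close>.\<close>

definition mt_metric ::
  "(3 \<Rightarrow> ('a \<times> real, 'm, 'a \<times> real \<Rightarrow> real) field) \<Rightarrow> ('a \<times> real, 'm, 'a \<times> real \<Rightarrow> 'a \<times> real \<Rightarrow> real) field"
  where "mt_metric e c y u v = (\<Sum>i\<in>UNIV. e i c y u * e i c y v) + snd u * snd v"

definition mt_J ::
  "real \<Rightarrow> (3 \<Rightarrow> ('a::real_normed_vector \<times> real, 'm, 'a \<times> real \<Rightarrow> real) field)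
    \<Rightarrow> (3 \<Rightarrow> ('a \<times> real, 'm, 'a \<times> real) field) \<Rightarrow> ('a \<times> real, 'm, 'a \<times> real \<Rightarrow> 'a \<times> real) field" where
  "mt_J \<epsilon> e E c y u =
     e 1 c y u *\<^sub>R (0, 1) - snd u *\<^sub>R E 1 c y
     + \<epsilon> *\<^sub>R (e 2 c y u *\<^sub>R E 3 c y - e 3 c y u *\<^sub>R E 2 c y)"


section \<open>Inoue surfaces in the family \<open>S\<^sub>M\<close>\<close>

text \<open>As \<open>T\<close> is a real \<open>3 \<times> 3\<close> matrix, its eigenvalues are then \<open>\<alpha>\<close>, \<open>\<beta>\<close> and the conjugate of \<open>\<beta>\<close>.\<close>

definition inoue_data :: "int^3^3 \<Rightarrow> real \<Rightarrow> complex \<Rightarrow> real^3 \<Rightarrow> complex^3 \<Rightarrow> bool" where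
  "inoue_data T \<alpha> \<beta> r s \<longleftrightarrow>
     det T = 1 \<and> \<alpha> > 1 \<and> Im \<beta> \<noteq> 0 \<and>
     r \<noteq> 0 \<and> (\<chi> i j. of_int (T $ i $ j)) *v r = \<alpha> *s r \<and>
     s \<noteq> 0 \<and> (\<chi> i j. of_int (T $ i $ j)) *v s = \<beta> *s s"

text \<open>The group generated by \<open>S\<close>, for a set \<open>S\<close> of bijections.\<close>

inductive_set generated_group :: "('a \<Rightarrow> 'a) set \<Rightarrow> ('a \<Rightarrow> 'a) set" for S where
  one: "id \<in> generated_group S"
| mult: "g \<in> S \<Longrightarrow> h \<in> generated_group S \<Longrightarrow> g \<circ> h \<in> generated_group S"
| inv_mult: "g \<in> S \<Longrightarrow> h \<in> generated_group S \<Longrightarrow> inv g \<circ> h \<in> generated_group S"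

text \<open>The generators are bijections of \<open>\<complex> \<times> \<complex>\<close> preserving \<open>\<H> \<times> \<complex>\<close>.\<close>

definition inoue_group ::
  "real \<Rightarrow> complex \<Rightarrow> real^3 \<Rightarrow> complex^3 \<Rightarrow> (complex \<times> complex \<Rightarrow> complex \<times> complex) set" where
  "inoue_group \<alpha> \<beta> r s = generated_group
     (insert (\<lambda>(w, z). (of_real \<alpha> * w, \<beta> * z))
       (range (\<lambda>i (w, z). (w + of_real (r $ i), z + s $ i))))"

definition half_space :: "(complex \<times> complex) set" where
  "half_space = {(w, z). Im w > 0}"

definition inoue_proj ::
  "real \<Rightarrow> complex \<Rightarrow> real^3 \<Rightarrow> complex^3 \<Rightarrow> complex \<times> complex \<Rightarrow> (complex \<times> complex) set" where
  "inoue_proj \<alpha> \<beta> r s p = {h p | h. h \<in> inoue_group \<alpha> \<beta> r s}"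

definition std_J :: "(complex \<times> complex, 'm, complex \<times> complex \<Rightarrow> complex \<times> complex) field" where
  "std_J c x u = (\<i> * fst u, \<i> * snd u)"

definition biholomorphic_to_Inoue_SM ::
  "'m set \<Rightarrow> ('e::euclidean_space, 'm) param set \<Rightarrow> ('e, 'm, 'e \<Rightarrow> 'e) field \<Rightarrow> bool" where
  "biholomorphic_to_Inoue_SM X A J \<longleftrightarrow>
     (\<exists>T \<alpha> \<beta> r s. inoue_data T \<alpha> \<beta> r s \<and>
        biholomorphic X A J
          (inoue_proj \<alpha> \<beta> r s ` half_space) (quotient_atlas half_space (inoue_proj \<alpha> \<beta> r s)) std_J)"

end

theory Submission
  imports Defs
begin

text \<open>Write \<open>z = x\<^sup>2 + \<i> x\<^sup>3\<close> and \<open>b = b\<^sub>2 + \<i> b\<^sub>3\<close>. The hypothesis on \<open>\<rho>\<close> makes its differential constant, so \<open>\<rho>\<close> lifts to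
  the affine map \<open>(x\<^sup>1, z) \<mapsto> (\<alpha> x\<^sup>1, \<beta> z)\<close> plus a translation, with \<open>\<alpha> = a\<^sub>1(1) / a\<^sub>1(0) > 0\<close> and
  \<open>\<beta> = b(1) / b(0)\<close>. As it preserves the lattice, \<open>\<alpha> \<bar>\<beta>\<bar>\<^sup>2 = 1\<close>, that is, \<open>m = 1/l\<close> satisfies \<open>m(1) = \<alpha> m(0)\<close>;
  since \<open>m' = k a\<^sub>1\<close> does not vanish, \<open>\<alpha> \<noteq> 1\<close>, the translation can be removed by moving the origin to
  the fixed point \<open>p\<close>, and integrality of the characteristic polynomial excludes a real \<open>\<beta>\<close>. Extend
  \<open>a\<^sub>1\<close>, \<open>b\<close> and \<open>m\<close> to \<open>\<real>\<close> by their multipliers; then \<open>m\<close> is a \<open>C\<^sup>1\<close> bijection onto the positive reals. The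
  functions \<open>k(x\<^sup>1 - p\<^sup>1) + \<i> m(t)\<close> and \<open>z - z(p)\<close> (conjugated for \<open>J\<^sub>-\<close>) are holomorphic, identify the
  universal cover with \<open>\<H> \<times> \<complex>\<close>, and turn the deck group into that of an Inoue surface, with \<open>\<alpha>\<close>
  replaced by its inverse if \<open>\<alpha> < 1\<close>.

  Since \<open>\<omega>\<^sub>\<plusminus> = e\<^sup>1 \<and> \<theta> \<plusminus> m dx\<^sup>2 \<and> dx\<^sup>3\<close>, the generalized Kaehler condition reduces to \<open>m' / a\<^sub>1 = k\<close> being constant.
  The extended coefficients may fail to be smooth at integral \<open>t\<close>; for an everywhere smooth structure the
  same computation is applied with \<open>a(t) = m(t) = \<alpha>\<^sup>t\<close> and \<open>k = ln \<alpha>\<close>.\<close>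

section \<open>Calculus of smooth maps\<close>

lemma Ck_on_Suc_imp: "Ck_on (Suc k) S f \<Longrightarrow> Ck_on k S f"
proof (induction k arbitrary: f)
  case 0
  then show ?case by (simp add: differentiable_imp_continuous_on)
next
  case (Suc k)
  then show ?case by (metis Ck_on.simps(2))
qed

text \<open>\<open>frechet_derivative\<close> chooses among all derivatives, so it is enough that
  both functions have the same ones; this also covers points where the derivative within
  \<open>S\<close> is not unique.\<close>

lemma frechet_derivative_cong_on:
  assumes "x \<in> S" "\<And>y. y \<in> S \<Longrightarrow> f y = g y"
  shows "frechet_derivative f (at x within S) = frechet_derivative g (at x within S)"
proof -
  have "(f has_derivative D) (at x within S) \<longleftrightarrow> (g has_derivative D) (at x within S)" for D
    by (rule iffI; rule has_derivative_transform[OF assms(1)]) (use assms in auto)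
  then show ?thesis unfolding frechet_derivative_def by simp
qed

lemma Ck_on_cong:
  assumes "\<And>y. y \<in> S \<Longrightarrow> f y = g y"
  shows "Ck_on k S f \<longleftrightarrow> Ck_on k S g"
  using assms
proof (induction k arbitrary: f g)
  case 0
  then show ?case by (simp cong: continuous_on_cong)
next
  case (Suc k)
  have "f differentiable_on S \<longleftrightarrow> g differentiable_on S"
    unfolding differentiable_on_def differentiable_def
    by (intro ball_cong refl ex_cong1 iffI; rule has_derivative_transform) (use Suc.prems in auto)
  moreover have "Ck_on k S (\<lambda>x. frechet_derivative f (at x within S) v)
      \<longleftrightarrow> Ck_on k S (\<lambda>x. frechet_derivative g (at x within S) v)" for v
    by (intro Suc.IH) (simp add: frechet_derivative_cong_on[OF _ Suc.prems])
  ultimately show ?case by simp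
qed

lemma frechet_derivative_eqI: "(f has_derivative D) (at x) \<Longrightarrow> frechet_derivative f (at x) = D"
  by (rule frechet_derivative_at[symmetric])

lemma Ck_on_Suc_open:
  assumes "open S"
  shows "Ck_on (Suc k) S f \<longleftrightarrow> (\<forall>x\<in>S. f differentiable (at x)) \<and>
           (\<forall>v. Ck_on k S (\<lambda>x. frechet_derivative f (at x) v))"
proof -
  have "f differentiable_on S \<longleftrightarrow> (\<forall>x\<in>S. f differentiable (at x))"
    using assms by (simp add: differentiable_on_def at_within_open[of _ S])
  moreover have "Ck_on k S (\<lambda>x. frechet_derivative f (at x within S) v)
      \<longleftrightarrow> Ck_on k S (\<lambda>x. frechet_derivative f (at x) v)" for v
    using assms by (intro Ck_on_cong) (simp add: at_within_open[of _ S])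
  ultimately show ?thesis by simp
qed

text \<open>Admits an explicit derivative in place of the chosen one, so that inductions on
  \<open>k\<close> can use the usual differentiation rules.\<close>

lemma Ck_on_SucI:
  assumes "open S" "\<And>x. x \<in> S \<Longrightarrow> (f has_derivative f' x) (at x)"
    and "\<And>v. Ck_on k S (\<lambda>x. f' x v)"
  shows "Ck_on (Suc k) S f"
proof -
  have "Ck_on k S (\<lambda>x. frechet_derivative f (at x) v)" for v
    using assms(3)[of v] assms(2) by (subst Ck_on_cong) (auto simp: frechet_derivative_eqI[OF assms(2)])
  then show ?thesis
    using assms(1,2) by (auto simp: Ck_on_Suc_open differentiable_def simp del: Ck_on.simps)
qed

lemma Ck_on_SucD:
  assumes "open S" "Ck_on (Suc k) S f"
  shows "\<And>x. x \<in> S \<Longrightarrow> (f has_derivative frechet_derivative f (at x)) (at x)"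
    and "Ck_on k S (\<lambda>x. frechet_derivative f (at x) v)"
  using assms by (auto simp: Ck_on_Suc_open frechet_derivative_works[symmetric] simp del: Ck_on.simps)

text \<open>Smoothness is local. This serves for transition maps, which agree with a deck
  transformation only near each point, the transformation depending on the point.\<close>

lemma Ck_on_local:
  assumes "open S"
    and "\<And>x. x \<in> S \<Longrightarrow> \<exists>X g. open X \<and> x \<in> X \<and> X \<subseteq> S \<and> Ck_on k X g \<and> (\<forall>y\<in>X. f y = g y)"
  shows "Ck_on k S f"
  using assms(2)
proof (induction k arbitrary: f)
  case 0
  have "isCont f x" if "x \<in> S" for x
  proof -
    from 0 that obtain X g where X: "open X" "x \<in> X" "continuous_on X g" "\<forall>y\<in>X. f y = g y"
      by (metis Ck_on.simps(1))
    then have "continuous_on X f" by (metis continuous_on_eq)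
    then show ?thesis using X(1,2) continuous_on_eq_continuous_at by blast
  qed
  then show ?case by (simp add: continuous_at_imp_continuous_on)
next
  case (Suc k)
  have *: "\<exists>X g. open X \<and> x \<in> X \<and> X \<subseteq> S \<and> Ck_on (Suc k) X g \<and>
      (\<forall>y\<in>X. (f has_derivative frechet_derivative g (at y)) (at y))" if "x \<in> S" for x
  proof -
    from Suc.prems[OF that] obtain X g where X: "open X" "x \<in> X" "X \<subseteq> S" "Ck_on (Suc k) X g"
      "\<forall>y\<in>X. f y = g y" by blast
    have "(f has_derivative frechet_derivative g (at y)) (at y)" if "y \<in> X" for y
      using has_derivative_transform_within_open[OF Ck_on_SucD(1)[OF X(1,4) that] X(1) that] X(5) by simp
    then show ?thesis using X by blast
  qed
  have "Ck_on k S (\<lambda>x. frechet_derivative f (at x) v)" for v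
  proof (rule Suc.IH)
    fix x assume "x \<in> S"
    from *[OF this] obtain X g where X: "open X" "x \<in> X" "X \<subseteq> S" "Ck_on (Suc k) X g"
      "\<forall>y\<in>X. (f has_derivative frechet_derivative g (at y)) (at y)" by blast
    then show "\<exists>X g. open X \<and> x \<in> X \<and> X \<subseteq> S \<and> Ck_on k X g \<and>
        (\<forall>y\<in>X. frechet_derivative f (at y) v = g y)"
      by (intro exI[of _ X] exI[of _ "\<lambda>x. frechet_derivative g (at x) v"])
        (auto simp: Ck_on_SucD(2) frechet_derivative_eqI)
  qed
  moreover have "f differentiable (at x)" if "x \<in> S" for x
    using *[OF that] by (auto simp: differentiable_def)
  ultimately show ?case using assms(1) by (simp add: Ck_on_Suc_open del: Ck_on.simps)
qed

section \<open>Closure properties of smooth functions on open sets\<close>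

lemma Ck_on_const:
  assumes "open S"
  shows "Ck_on k S (\<lambda>x. c)"
proof (induction k arbitrary: c)
  case (Suc k)
  then show ?case by (intro Ck_on_SucI[OF assms, of _ "\<lambda>_ _. 0"]) auto
qed simp

lemma Ck_on_linear_image:
  assumes "bounded_linear h" "open S" "Ck_on k S f"
  shows "Ck_on k S (\<lambda>x. h (f x))"
  using assms(3)
proof (induction k arbitrary: f)
  case 0
  then show ?case using assms(1) by (auto intro: bounded_linear.continuous_on)
next
  case (Suc k)
  show ?case
    by (rule Ck_on_SucI[OF assms(2), of _ "\<lambda>x v. h (frechet_derivative f (at x) v)"])
      (use Ck_on_SucD[OF assms(2) Suc.prems] Suc.IH in
        \<open>auto intro!: bounded_linear.has_derivative[OF assms(1)]\<close>)
qed

text \<open>Since \<open>D\<close> does not depend on the point, all directional derivatives are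
  constant on \<open>S\<close>.\<close>

lemma Ck_on_affine:
  assumes "open S" "\<And>x. x \<in> S \<Longrightarrow> (f has_derivative D) (at x)"
  shows "Ck_on k S f"
proof (cases k)
  case 0
  then show ?thesis using assms
    by (auto intro!: continuous_at_imp_continuous_on dest: has_derivative_continuous)
next
  case (Suc j)
  then show ?thesis
    using Ck_on_SucI[OF assms(1), of f "\<lambda>_. D" j] assms by (simp add: Ck_on_const del: Ck_on.simps)
qed

lemma Ck_on_add:
  assumes "open S" "Ck_on k S f" "Ck_on k S g"
  shows "Ck_on k S (\<lambda>x. f x + g x)"
  using assms(2,3)
proof (induction k arbitrary: f g)
  case 0
  then show ?case by (auto intro: continuous_on_add)
next
  case (Suc k)
  show ?case
    by (rule Ck_on_SucI[OF assms(1), of _ "\<lambda>x v. frechet_derivative f (at x) v + frechet_derivative g (at x) v"])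
      (use Ck_on_SucD[OF assms(1) Suc.prems(1)] Ck_on_SucD[OF assms(1) Suc.prems(2)] Suc.IH in
        \<open>auto intro!: derivative_intros\<close>)
qed

lemma Ck_on_mult:
  fixes f g :: "'a::real_normed_vector \<Rightarrow> real"
  assumes "open S" "Ck_on k S f" "Ck_on k S g"
  shows "Ck_on k S (\<lambda>x. f x * g x)"
  using assms(2,3)
proof (induction k arbitrary: f g)
  case 0
  then show ?case by (auto intro: continuous_on_mult)
next
  case (Suc k)
  show ?case
  proof (rule Ck_on_SucI[OF assms(1), of _
        "\<lambda>x v. f x * frechet_derivative g (at x) v + frechet_derivative f (at x) v * g x"])
    show "((\<lambda>x. f x * g x) has_derivative
        (\<lambda>v. f x * frechet_derivative g (at x) v + frechet_derivative f (at x) v * g x)) (at x)"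
      if "x \<in> S" for x
      using Ck_on_SucD(1)[OF assms(1) Suc.prems(1) that] Ck_on_SucD(1)[OF assms(1) Suc.prems(2) that]
      by (rule has_derivative_mult)
    show "Ck_on k S (\<lambda>x. f x * frechet_derivative g (at x) v + frechet_derivative f (at x) v * g x)" for v
      using Suc.prems Ck_on_Suc_imp[OF Suc.prems(1)] Ck_on_Suc_imp[OF Suc.prems(2)]
      by (intro Ck_on_add[OF assms(1)] Suc.IH Ck_on_SucD(2)[OF assms(1)])
  qed
qed

lemma smooth_on_const: "open S \<Longrightarrow> smooth_on S (\<lambda>x. c)"
  by (simp add: smooth_on_def Ck_on_const)

lemma smooth_on_add: "open S \<Longrightarrow> smooth_on S f \<Longrightarrow> smooth_on S g \<Longrightarrow> smooth_on S (\<lambda>x. f x + g x)"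
  by (simp add: smooth_on_def Ck_on_add)

lemma smooth_on_mult:
  fixes f g :: "'a::real_normed_vector \<Rightarrow> real"
  shows "open S \<Longrightarrow> smooth_on S f \<Longrightarrow> smooth_on S g \<Longrightarrow> smooth_on S (\<lambda>x. f x * g x)"
  by (simp add: smooth_on_def Ck_on_mult)

lemma smooth_on_cmult:
  fixes f :: "'a::real_normed_vector \<Rightarrow> real"
  shows "open S \<Longrightarrow> smooth_on S f \<Longrightarrow> smooth_on S (\<lambda>x. c * f x)"
  by (simp add: smooth_on_mult smooth_on_const)

lemma smooth_on_linear_image: "bounded_linear h \<Longrightarrow> open S \<Longrightarrow> smooth_on S f \<Longrightarrow> smooth_on S (\<lambda>x. h (f x))"
  by (simp add: smooth_on_def Ck_on_linear_image)

lemma smooth_on_directional_derivative: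
  "open S \<Longrightarrow> smooth_on S f \<Longrightarrow> smooth_on S (\<lambda>x. frechet_derivative f (at x) v)"
  unfolding smooth_on_def by (blast intro: Ck_on_SucD(2))

lemma smooth_on_imp_differentiable: "open S \<Longrightarrow> smooth_on S f \<Longrightarrow> x \<in> S \<Longrightarrow> f differentiable (at x)"
  unfolding smooth_on_def by (meson Ck_on_SucD(1) differentiable_def)

lemma smooth_on_exp_snd:
  assumes "open S"
  shows "smooth_on S (\<lambda>y. exp (c * snd y) :: real)"
proof -
  \<comment> \<open>The factor \<open>r\<close> absorbs the constants produced by differentiation,
    which keeps the induction within one family of functions.\<close>
  have "Ck_on k S (\<lambda>y. r * exp (c * snd y) :: real)" for k r
  proof (induction k arbitrary: r)
    case 0
    then show ?case by (auto intro!: continuous_intros)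
  next
    case (Suc k)
    show ?case
      by (rule Ck_on_SucI[OF assms, of _ "\<lambda>y v. (r * c * snd v) * exp (c * snd y)"])
        (use Suc in \<open>auto intro!: derivative_eq_intros ext\<close>)
  qed
  from this[of _ 1] show ?thesis by (simp add: smooth_on_def)
qed

section \<open>Quotients by affine deck transformations\<close>

lemma coords_param: "inj_on \<phi> V \<Longrightarrow> x \<in> V \<Longrightarrow> coords (V, \<phi>) (\<phi> x) = x"
  by (simp add: coords_def the_inv_into_f_f)

lemma openin_manifold_topology: "openin (manifold_topology M A) X \<longleftrightarrow> manifold_open M A X"
  by (simp add: manifold_topology_def topology_inverse' istopology_manifold_open)

text \<open>\<open>D \<gamma>\<close> carries no base point, which says that the deck
  transformations are affine. The last two assumptions supply the charts and the Hausdorff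
  property.\<close>

locale affine_quotient =
  fixes \<pi> :: "'e::euclidean_space \<Rightarrow> 'm" and \<Gamma> :: "('e \<Rightarrow> 'e) set" and D :: "('e \<Rightarrow> 'e) \<Rightarrow> 'e \<Rightarrow> 'e"
  assumes has_derivative_deck: "\<gamma> \<in> \<Gamma> \<Longrightarrow> (\<gamma> has_derivative D \<gamma>) (at x)"
    and proj_eq_iff: "\<pi> x = \<pi> y \<longleftrightarrow> (\<exists>\<gamma>\<in>\<Gamma>. y = \<gamma> x)"
    and locally_injective: "\<exists>V. open V \<and> x \<in> V \<and> inj_on \<pi> V"
    and closed_equiv: "closed {z. \<pi> (fst z) = \<pi> (snd z)}"
begin

lemma continuous_deck: "\<gamma> \<in> \<Gamma> \<Longrightarrow> continuous_on S \<gamma>"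
  using has_derivative_continuous[OF has_derivative_deck] continuous_at_imp_continuous_on by blast

lemma quotient_atlas_cover: "\<exists>c\<in>quotient_atlas UNIV \<pi>. x \<in> fst c"
  using locally_injective[of x] unfolding quotient_atlas_def by fastforce

text \<open>Two preimages of one point differ by some \<open>\<gamma>\<close>, and
  \<open>\<pi>\<close> is invariant under it. On the part of the first chart that
  \<open>\<gamma>\<close> maps into the second, injectivity of \<open>\<pi>\<close> there forces the
  transition map to be \<open>\<gamma>\<close>.\<close>

lemma transition:
  assumes "c \<in> quotient_atlas UNIV \<pi>" "d \<in> quotient_atlas UNIV \<pi>" "x \<in> local_dom c d id"
  obtains \<gamma> X where "\<gamma> \<in> \<Gamma>" "open X" "x \<in> X" "X \<subseteq> local_dom c d id"
    "\<forall>y\<in>X. local_map c d id y = \<gamma> y"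
proof -
  obtain V W where c: "c = (V, \<pi>)" "open V" and d: "d = (W, \<pi>)" "open W" "inj_on \<pi> W"
    using assms(1,2) unfolding quotient_atlas_def by blast
  from assms(3) c d obtain w where w: "x \<in> V" "w \<in> W" "\<pi> x = \<pi> w"
    by (auto simp: local_dom_def)
  then obtain \<gamma> where g: "\<gamma> \<in> \<Gamma>" "w = \<gamma> x" using proj_eq_iff by blast
  have "open (V \<inter> \<gamma> -` W)"
    using c(2) d(2) continuous_deck[OF g(1), of UNIV] by (intro open_Int open_vimage)
  moreover have p: "\<pi> y = \<pi> (\<gamma> y)" for y using g(1) proj_eq_iff by blast
  moreover have "local_map c d id y = \<gamma> y" if "\<gamma> y \<in> W" for y
    using coords_param[OF d(3) that] p[of y] c(1) d(1) by (simp add: local_map_def)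
  ultimately show ?thesis
    using g w c d by (intro that[of \<gamma> "V \<inter> \<gamma> -` W"]) (auto simp: local_dom_def)
qed

lemma transition_differential:
  assumes "c \<in> quotient_atlas UNIV \<pi>" "d \<in> quotient_atlas UNIV \<pi>" "x \<in> local_dom c d id"
  obtains \<gamma> where "\<gamma> \<in> \<Gamma>" "local_map c d id x = \<gamma> x" "differential c d id x = D \<gamma>"
proof -
  from assms obtain \<gamma> X where g: "\<gamma> \<in> \<Gamma>" "open X" "x \<in> X" "X \<subseteq> local_dom c d id"
    "\<forall>y\<in>X. local_map c d id y = \<gamma> y" by (rule transition)
  then have "(local_map c d id has_derivative D \<gamma>) (at x)"
    using has_derivative_transform_within_open[OF has_derivative_deck[OF g(1)] g(2,3)] by simp
  then show ?thesis using g that by (simp add: differential_def frechet_derivative_eqI)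
qed

lemma manifold_open_iff:
  "manifold_open (range \<pi>) (quotient_atlas UNIV \<pi>) X \<longleftrightarrow> X \<subseteq> range \<pi> \<and> open (\<pi> -` X)"
proof -
  have "open (\<pi> -` X)" if "\<forall>c\<in>quotient_atlas UNIV \<pi>. open {x \<in> fst c. snd c x \<in> X}"
    unfolding open_subopen[of "\<pi> -` X"]
  proof
    fix x assume x: "x \<in> \<pi> -` X"
    obtain V where V: "open V" "x \<in> V" "inj_on \<pi> V" using locally_injective by blast
    then have "(V, \<pi>) \<in> quotient_atlas UNIV \<pi>" by (auto simp: quotient_atlas_def)
    with that have "open {y \<in> V. \<pi> y \<in> X}" by fastforce
    then show "\<exists>T. open T \<and> x \<in> T \<and> T \<subseteq> \<pi> -` X"
      using x V by (intro exI[of _ "{y \<in> V. \<pi> y \<in> X}"]) auto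
  qed
  moreover have "open {x \<in> fst c. snd c x \<in> X}"
    if "open (\<pi> -` X)" "c \<in> quotient_atlas UNIV \<pi>" for c
  proof -
    have "{x \<in> fst c. snd c x \<in> X} = fst c \<inter> \<pi> -` X"
      using that by (auto simp: quotient_atlas_def)
    then show ?thesis using that by (auto simp: quotient_atlas_def)
  qed
  ultimately show ?thesis unfolding manifold_open_def by blast
qed

text \<open>The saturation of \<open>U\<close> is the union of its preimages under the deck
  transformations; hence \<open>\<pi>\<close> is an open map.\<close>

lemma open_vimage_image: "open U \<Longrightarrow> open (\<pi> -` (\<pi> ` U))"
proof -
  assume U: "open U"
  have "\<pi> -` (\<pi> ` U) = (\<Union>\<gamma>\<in>\<Gamma>. \<gamma> -` U)" 
    unfolding vimage_def image_def by (auto simp: proj_eq_iff)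
  then show ?thesis using U continuous_deck by (auto intro!: open_UN open_vimage)
qed

text \<open>A pair of points in distinct fibres has a product neighbourhood avoiding the closed
  equivalence relation; the images of its factors are disjoint, and open because
  \<open>\<pi>\<close> is an open map.\<close>

lemma Hausdorff_quotient: "Hausdorff_space (manifold_topology (range \<pi>) (quotient_atlas UNIV \<pi>))"
  (is "Hausdorff_space ?T")
proof -
  have "\<exists>U V. openin ?T U \<and> openin ?T V \<and> \<pi> x \<in> U \<and> \<pi> y \<in> V \<and> disjnt U V" if "\<pi> x \<noteq> \<pi> y" for x y
  proof -
    have "open (- {z. \<pi> (fst z) = \<pi> (snd z)})" using closed_equiv by blast
    moreover have "(x, y) \<in> - {z. \<pi> (fst z) = \<pi> (snd z)}" using that by simp
    ultimately obtain A B where AB: "open A" "open B" "(x, y) \<in> A \<times> B"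
      "A \<times> B \<subseteq> - {z. \<pi> (fst z) = \<pi> (snd z)}"
      by (rule open_prod_elim)
    show ?thesis
      using AB by (intro exI[of _ "\<pi> ` A"] exI[of _ "\<pi> ` B"])
        (auto simp: openin_manifold_topology manifold_open_iff open_vimage_image disjnt_def)
  qed
  note separate = this
  have "topspace ?T \<subseteq> range \<pi>"
    using openin_topspace[of ?T] unfolding openin_manifold_topology manifold_open_iff by (rule conjunct1)
  then show ?thesis
    unfolding Hausdorff_space_def
  proof (intro allI impI)
    fix p q assume "p \<in> topspace ?T \<and> q \<in> topspace ?T \<and> p \<noteq> q"
    moreover from this obtain x y where "p = \<pi> x" "q = \<pi> y"
      using \<open>topspace ?T \<subseteq> range \<pi>\<close> by (meson imageE subsetD)
    ultimately show "\<exists>U V. openin ?T U \<and> openin ?T V \<and> p \<in> U \<and> q \<in> V \<and> disjnt U V"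
      using separate[of x y] by simp
  qed
qed

lemma second_countable_quotient: "second_countable (manifold_topology (range \<pi>) (quotient_atlas UNIV \<pi>))"
  (is "second_countable ?T")
proof -
  obtain B :: "'e set set" where B: "countable B" "topological_basis B"
    using ex_countable_basis by blast
  have "openin ?T (\<pi> ` b)" if "b \<in> B" for b
    using that B topological_basis_open
    by (auto simp: openin_manifold_topology manifold_open_iff intro: open_vimage_image)
  moreover have "\<exists>V\<in>(`) \<pi> ` B. p \<in> V \<and> V \<subseteq> U" if "openin ?T U" "p \<in> U" for U p
  proof -
    from that obtain x where x: "p = \<pi> x" "open (\<pi> -` U)" "x \<in> \<pi> -` U"
      by (auto simp: openin_manifold_topology manifold_open_iff)
    then obtain b where "b \<in> B" "x \<in> b" "b \<subseteq> \<pi> -` U"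
      using B(2) topological_basisE by metis
    then show ?thesis using x by blast
  qed
  ultimately show ?thesis unfolding second_countable_def
    using B(1) by (intro exI[of _ "(`) \<pi> ` B"]) auto
qed

lemma smooth_manifold_quotient: "smooth_manifold (range \<pi>) (quotient_atlas UNIV \<pi>)"
  unfolding smooth_manifold_def
proof (intro conjI ballI)
  show "(\<Union>c\<in>quotient_atlas UNIV \<pi>. snd c ` fst c) = range \<pi>"
    using quotient_atlas_cover by (fastforce simp: quotient_atlas_def)
  fix c assume c: "c \<in> quotient_atlas UNIV \<pi>"
  then show "open (fst c)" "inj_on (snd c) (fst c)" by (auto simp: quotient_atlas_def)
  fix d assume d: "d \<in> quotient_atlas UNIV \<pi>"
  show op: "open (local_dom c d id)"
    unfolding open_subopen[of "local_dom c d id"]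
  proof
    fix x assume "x \<in> local_dom c d id"
    then show "\<exists>T. open T \<and> x \<in> T \<and> T \<subseteq> local_dom c d id"
      by (rule transition[OF c d]) blast
  qed
  show "smooth_on (local_dom c d id) (local_map c d id)"
    unfolding smooth_on_def
  proof
    fix k
    show "Ck_on k (local_dom c d id) (local_map c d id)"
    proof (rule Ck_on_local[OF op])
      fix x assume "x \<in> local_dom c d id"
      from c d this obtain \<gamma> X where g: "\<gamma> \<in> \<Gamma>" "open X" "x \<in> X"
        "X \<subseteq> local_dom c d id" "\<forall>y\<in>X. local_map c d id y = \<gamma> y" by (rule transition)
      then show "\<exists>X g. open X \<and> x \<in> X \<and> X \<subseteq> local_dom c d id \<and> Ck_on k X g \<and>
          (\<forall>y\<in>X. local_map c d id y = g y)"
        using Ck_on_affine[OF g(2) has_derivative_deck[OF g(1)], of k]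
        by (intro exI[of _ X] exI[of _ \<gamma>] conjI) auto
    qed
  qed
qed (use Hausdorff_quotient second_countable_quotient in auto)

end

text \<open>\<open>G\<close> is the inverse of \<open>F\<close>; the chart \<open>(V, \<pi>)\<close> of the source is matched with the chart
  \<open>(F ` V, \<pi>')\<close> of the target, in which the induced map is \<open>F\<close>.\<close>

lemma holomorphic_map_quotient:
  fixes F :: "'e::euclidean_space \<Rightarrow> 'f::euclidean_space"
  assumes U: "open U" "open U'"
    and FG: "\<And>x. x \<in> U \<Longrightarrow> F x \<in> U' \<and> G (F x) = x" "\<And>x. x \<in> U' \<Longrightarrow> G x \<in> U \<and> F (G x) = x"
    and contG: "continuous_on U' G"
    and der: "\<And>x. x \<in> U \<Longrightarrow> (F has_derivative F' x) (at x)"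
    and hol: "\<And>x u. x \<in> U \<Longrightarrow> F' x (J x u) = K (F x) (F' x u)"
    and eq: "\<And>x y. x \<in> U \<Longrightarrow> y \<in> U \<Longrightarrow> \<pi> x = \<pi> y \<longleftrightarrow> \<pi>' (F x) = \<pi>' (F y)"
    and \<Phi>: "\<And>x. x \<in> U \<Longrightarrow> \<Phi> (\<pi> x) = \<pi>' (F x)"
  shows "holomorphic_map (quotient_atlas U \<pi>) (\<lambda>c. J) (quotient_atlas U' \<pi>') (\<lambda>c. K) \<Phi>"
  unfolding holomorphic_map_def
proof (intro ballI)
  fix c x assume c: "c \<in> quotient_atlas U \<pi>" and x: "x \<in> fst c"
  then obtain V where V: "c = (V, \<pi>)" "open V" "V \<subseteq> U" "inj_on \<pi> V" "x \<in> V"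
    by (auto simp: quotient_atlas_def)
  have "F ` V = U' \<inter> G -` V" using FG V(3) by (force simp: image_iff)
  then have oW: "open (F ` V)" using continuous_open_preimage[OF contG U(2) V(2)] by simp
  have iW: "inj_on \<pi>' (F ` V)"
  proof (rule inj_onI, clarify)
    fix y y' assume "y \<in> V" "y' \<in> V" "\<pi>' (F y) = \<pi>' (F y')"
    then show "F y = F y'" using V(3,4) eq[of y y'] by (auto dest: inj_onD)
  qed
  define d where "d = (F ` V, \<pi>')"
  have d: "d \<in> quotient_atlas U' \<pi>'" using oW iW FG(1) V(3) by (auto simp: d_def quotient_atlas_def)
  have lm: "local_map c d \<Phi> y = F y" if "y \<in> V" for y
    using that V \<Phi> by (auto simp: local_map_def d_def subset_iff coords_param[OF iW])
  have "V \<subseteq> local_dom c d \<Phi>" using V \<Phi> by (auto simp: local_dom_def d_def)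
  then have int: "x \<in> interior (local_dom c d \<Phi>)" using V by (meson interiorI)
  have hd: "(local_map c d \<Phi> has_derivative F' x) (at x)"
    using has_derivative_transform_within_open[OF der V(2,5)] lm V by auto
  show "\<exists>d\<in>quotient_atlas U' \<pi>'. x \<in> interior (local_dom c d \<Phi>) \<and>
      local_map c d \<Phi> differentiable at x \<and>
      (\<forall>u. differential c d \<Phi> x (J x u) = K (local_map c d \<Phi> x) (differential c d \<Phi> x u))"
    using d int hd lm[OF V(5)] hol V(3,5)
    by (intro bexI[OF _ d]) (auto simp: differential_def frechet_derivative_eqI[OF hd] differentiable_def)
qed

text \<open>A bijection of the covers that matches the two orbit relations descends to the
  quotients, and complex linearity has to be checked for \<open>F\<close> only.\<close>

lemma biholomorphic_quotient:
  fixes F :: "'e::euclidean_space \<Rightarrow> 'f::euclidean_space"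
  assumes U: "open U" "open U'"
    and FG: "\<And>x. x \<in> U \<Longrightarrow> F x \<in> U' \<and> G (F x) = x" "\<And>x. x \<in> U' \<Longrightarrow> G x \<in> U \<and> F (G x) = x"
    and derF: "\<And>x. x \<in> U \<Longrightarrow> (F has_derivative F' x) (at x)"
    and derG: "\<And>x. x \<in> U' \<Longrightarrow> G differentiable (at x)"
    and hol: "\<And>x u. x \<in> U \<Longrightarrow> F' x (J x u) = K (F x) (F' x u)"
    and eq: "\<And>x y. x \<in> U \<Longrightarrow> y \<in> U \<Longrightarrow> \<pi> x = \<pi> y \<longleftrightarrow> \<pi>' (F x) = \<pi>' (F y)"
  shows "biholomorphic (\<pi> ` U) (quotient_atlas U \<pi>) (\<lambda>c. J) (\<pi>' ` U') (quotient_atlas U' \<pi>') (\<lambda>c. K)"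
proof -
  \<comment> \<open>The value is computed at a chosen representative; \<open>eq\<close> makes it
    independent of the choice.\<close>
  define \<Phi> where "\<Phi> p = \<pi>' (F (SOME x. x \<in> U \<and> \<pi> x = p))" for p
  have \<Phi>: "\<Phi> (\<pi> x) = \<pi>' (F x)" if "x \<in> U" for x
  proof -
    have "(SOME y. y \<in> U \<and> \<pi> y = \<pi> x) \<in> U \<and> \<pi> (SOME y. y \<in> U \<and> \<pi> y = \<pi> x) = \<pi> x"
      by (rule someI[of "\<lambda>y. y \<in> U \<and> \<pi> y = \<pi> x" x]) (use that in auto)
    then show ?thesis using eq that unfolding \<Phi>_def by blast
  qed
  have inj: "inj_on \<Phi> (\<pi> ` U)" using \<Phi> eq by (auto simp: inj_on_def)
  have "\<Phi> ` (\<pi> ` U) = \<pi>' ` U'" using \<Phi> FG by (force simp: image_iff)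
  with inj have bij: "bij_betw \<Phi> (\<pi> ` U) (\<pi>' ` U')" by (simp add: bij_betw_def)
  have inv: "the_inv_into (\<pi> ` U) \<Phi> (\<pi>' x) = \<pi> (G x)" if "x \<in> U'" for x
    using the_inv_into_f_f[OF inj, of "\<pi> (G x)"] \<Phi>[of "G x"] FG(2)[OF that] by auto
  have contF: "continuous_on U F" using derF
    by (meson continuous_at_imp_continuous_on has_derivative_continuous)
  have contG: "continuous_on U' G" using derG
    by (meson continuous_at_imp_continuous_on differentiable_imp_continuous_within)
  let ?G' = "\<lambda>x. frechet_derivative G (at x)"
  have dG: "(G has_derivative ?G' x) (at x)" if "x \<in> U'" for x
    using derG[OF that] by (simp add: frechet_derivative_works)
  \<comment> \<open>Differentiating \<open>F (G y) = y\<close> and \<open>G (F y) = y\<close> shows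
    that the two derivatives are mutually inverse, so complex linearity passes from
    \<open>F'\<close> to \<open>?G'\<close>.\<close>
  have holG: "?G' x (K x u) = J (G x) (?G' x u)" if x: "x \<in> U'" for x u
  proof -
    have gx: "G x \<in> U" "F (G x) = x" using FG(2)[OF x] by auto
    have "((\<lambda>y. F (G y)) has_derivative (\<lambda>v. F' (G x) (?G' x v))) (at x)"
      using diff_chain_at[OF dG[OF x] derF[OF gx(1)]] by (simp add: o_def)
    moreover have "((\<lambda>y. F (G y)) has_derivative (\<lambda>v. v)) (at x)"
      by (rule has_derivative_transform_within_open[OF has_derivative_ident U(2) x]) (use FG in auto)
    ultimately have 1: "F' (G x) (?G' x v) = v" for v
      by (metis has_derivative_unique)
    have "((\<lambda>y. G (F y)) has_derivative (\<lambda>v. ?G' x (F' (G x) v))) (at (G x))"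
      using diff_chain_at[OF derF[OF gx(1)], of G "?G' x"] dG[OF x] gx by (simp add: o_def)
    moreover have "((\<lambda>y. G (F y)) has_derivative (\<lambda>v. v)) (at (G x))"
      by (rule has_derivative_transform_within_open[OF has_derivative_ident U(1) gx(1)]) (use FG in auto)
    ultimately have 2: "?G' x (F' (G x) v) = v" for v
      by (metis has_derivative_unique)
    show ?thesis using hol[OF gx(1), of "?G' x u"] 1 2 gx(2) by metis
  qed
  have "holomorphic_map (quotient_atlas U \<pi>) (\<lambda>c. J) (quotient_atlas U' \<pi>') (\<lambda>c. K) \<Phi>"
    by (rule holomorphic_map_quotient[where G = G and F = F and F' = F'])
      (use U FG contG derF hol eq \<Phi> in \<open>blast+\<close>)
  moreover have "holomorphic_map (quotient_atlas U' \<pi>') (\<lambda>c. K) (quotient_atlas U \<pi>) (\<lambda>c. J)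
      (the_inv_into (\<pi> ` U) \<Phi>)"
  proof (rule holomorphic_map_quotient[where G = F and F = G and F' = ?G', OF U(2,1) FG(2,1) contF dG holG])
    show "\<pi>' x = \<pi>' y \<longleftrightarrow> \<pi> (G x) = \<pi> (G y)" if "x \<in> U'" "y \<in> U'" for x y
      using eq[of "G x" "G y"] FG(2) that by metis
  qed (use inv in auto)
  ultimately show ?thesis unfolding biholomorphic_def using bij by blast
qed

section \<open>The mapping torus as a quotient\<close>

definition zc :: "real^3 \<Rightarrow> complex" where
  "zc x = Complex (x$2) (x$3)"

lemma Re_zc [simp]: "Re (zc x) = x$2" and Im_zc [simp]: "Im (zc x) = x$3"
  by (simp_all add: zc_def)

lemma vec3_eq_iff: "x = y \<longleftrightarrow> x$1 = y$1 \<and> zc x = zc y" for x y :: "real^3"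
  by (auto simp: vec_eq_iff forall_3 complex_eq_iff)

lemma zc_add [simp]: "zc (x + y) = zc x + zc y"
  and zc_diff [simp]: "zc (x - y) = zc x - zc y"
  and zc_minus [simp]: "zc (- x) = - zc x"
  and zc_scaleR [simp]: "zc (c *\<^sub>R x) = c *\<^sub>R zc x"
  and zc_zero [simp]: "zc 0 = 0"
  by (simp_all add: complex_eq_iff)

lemma bounded_linear_zc: "bounded_linear zc"
  by (simp add: linear_conv_bounded_linear[symmetric] linear_iff)

text \<open>These are the linear maps that preserve the splitting into the first axis and the plane
  and act on the plane by a complex multiplication; the linear part of the monodromy is of this
  kind.\<close>

definition dil :: "real \<Rightarrow> complex \<Rightarrow> real^3 \<Rightarrow> real^3" where
  "dil \<alpha> \<beta> x = vector [\<alpha> * x$1, Re (\<beta> * zc x), Im (\<beta> * zc x)]"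

lemma dil_nth1 [simp]: "dil \<alpha> \<beta> x $ 1 = \<alpha> * x$1" and zc_dil [simp]: "zc (dil \<alpha> \<beta> x) = \<beta> * zc x"
  by (simp_all add: dil_def complex_eq_iff del: Re_complex_of_real)

lemma dil_dil [simp]: "dil \<alpha> \<beta> (dil \<alpha>' \<beta>' x) = dil (\<alpha> * \<alpha>') (\<beta> * \<beta>') x"
  and dil_1 [simp]: "dil 1 1 x = x"
  and dil_zero [simp]: "dil \<alpha> \<beta> 0 = 0"
  and dil_add: "dil \<alpha> \<beta> (x + y) = dil \<alpha> \<beta> x + dil \<alpha> \<beta> y"
  and dil_diff: "dil \<alpha> \<beta> (x - y) = dil \<alpha> \<beta> x - dil \<alpha> \<beta> y"
  by (simp_all add: vec3_eq_iff algebra_simps)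

lemma linear_dil: "linear (dil \<alpha> \<beta>)"
  by (simp add: linear_iff vec3_eq_iff algebra_simps)

lemma bounded_linear_dil: "bounded_linear (dil \<alpha> \<beta>)"
  using linear_dil by (simp add: linear_conv_bounded_linear)

definition dil_matrix :: "real \<Rightarrow> complex \<Rightarrow> real^3^3" where
  "dil_matrix A B = vector [vector [A, 0, 0], vector [0, Re B, - Im B], vector [0, Im B, Re B]]"

lemma dil_matrix_mult: "dil_matrix A B *v x = dil A B x"
  by (simp add: dil_matrix_def dil_def vec_eq_iff forall_3 matrix_vector_mult_def sum_3)

lemma det_dil_matrix: "det (dil_matrix A B) = A * (cmod B)\<^sup>2"
  by (simp add: dil_matrix_def det_3 cmod_power2) (simp add: algebra_simps power2_eq_square)

section \<open>Lattices and the torus projection\<close>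

definition lattice :: "real^3^3 \<Rightarrow> (real^3) set" where
  "lattice L = range (\<lambda>k :: int^3. L *v (\<chi> i. of_int (k $ i)))"

lemma latticeI: "L *v (\<chi> i. of_int (k $ i)) \<in> lattice L" for k :: "int^3"
  by (simp add: lattice_def)

lemma column_nth: "column i L $ j = L $ j $ i"
  by (simp add: column_def)

lemma column_in_lattice: "column i L \<in> lattice L"
proof -
  have "(\<chi> j. of_int (axis i 1 $ j)) = (axis i 1 :: real^3)"
    by (auto simp: vec_eq_iff axis_def)
  then show ?thesis using latticeI[of L "axis i 1"] by (simp add: matrix_vector_mult_basis)
qed

lemma zero_in_lattice [simp]: "0 \<in> lattice L"
proof -
  have "(\<chi> i. of_int ((0::int^3) $ i)) = (0::real^3)" by (simp add: vec_eq_iff)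
  then show ?thesis using latticeI[of L 0] by simp
qed

lemma lattice_diff: "x \<in> lattice L \<Longrightarrow> y \<in> lattice L \<Longrightarrow> x - y \<in> lattice L"
proof -
  assume "x \<in> lattice L" "y \<in> lattice L"
  then obtain k j :: "int^3" where "x = L *v (\<chi> i. of_int (k $ i))" "y = L *v (\<chi> i. of_int (j $ i))"
    by (auto simp: lattice_def)
  then have "x - y = L *v ((\<chi> i. of_int (k $ i)) - (\<chi> i. of_int (j $ i)))"
    by (simp add: matrix_vector_mult_diff_distrib)
  also have "(\<chi> i. of_int (k $ i)) - (\<chi> i. of_int (j $ i)) = ((\<chi> i. of_int ((k - j) $ i)) :: real^3)"
    by (simp add: vec_eq_iff)
  finally show ?thesis using latticeI by metis
qed

lemma lattice_minus: "x \<in> lattice L \<Longrightarrow> - x \<in> lattice L"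
  using lattice_diff[of 0 L x] by simp

lemma lattice_add: "x \<in> lattice L \<Longrightarrow> y \<in> lattice L \<Longrightarrow> x + y \<in> lattice L"
  using lattice_diff[of x L "- y"] lattice_minus by simp

lemma torus_proj_eq: "torus_proj L x = (+) x ` lattice L"
  by (auto simp: torus_proj_def lattice_def)

lemma torus_proj_eq_iff: "torus_proj L x = torus_proj L y \<longleftrightarrow> y - x \<in> lattice L"
proof
  assume "torus_proj L x = torus_proj L y"
  moreover have "y + 0 \<in> torus_proj L y" unfolding torus_proj_eq by (intro imageI zero_in_lattice)
  ultimately have "y \<in> (+) x ` lattice L" by (simp add: torus_proj_eq)
  then show "y - x \<in> lattice L" by auto
next
  assume a: "y - x \<in> lattice L"
  have "torus_proj L u \<subseteq> torus_proj L v" if "u - v \<in> lattice L" for u v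
  proof
    fix w assume "w \<in> torus_proj L u"
    then obtain l where l: "l \<in> lattice L" "w = u + l" by (auto simp: torus_proj_eq)
    then have "w = v + ((u - v) + l)" by simp
    then show "w \<in> torus_proj L v" using lattice_add[OF that l(1)] unfolding torus_proj_eq by blast
  qed
  from this[OF a] this[of x y] lattice_minus[OF a] show "torus_proj L x = torus_proj L y" by auto
qed

lemma torus_proj_add_lattice: "l \<in> lattice L \<Longrightarrow> torus_proj L (x + l) = torus_proj L x"
  using torus_proj_eq_iff[of L x "x + l"] by simp

lemma invertible_matrix_inv: "invertible A \<Longrightarrow> A ** matrix_inv A = mat 1 \<and> matrix_inv A ** A = mat 1"
  unfolding invertible_def matrix_inv_def by (rule someI_ex)

text \<open>The inverse of \<open>L\<close> gives the coordinates in the basis of columns.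
  Integrality of these coordinates is a closed condition and keeps lattice points apart, which leads
  to the Hausdorff property and to the charts.\<close>

lemma lattice_iff:
  assumes "invertible L"
  shows "x \<in> lattice L \<longleftrightarrow> (\<forall>i. (matrix_inv L *v x) $ i \<in> \<int>)"
proof
  assume "x \<in> lattice L"
  then obtain k :: "int^3" where "x = L *v (\<chi> i. of_int (k $ i))" by (auto simp: lattice_def)
  then have "matrix_inv L *v x = (\<chi> i. of_int (k $ i))"
    using invertible_matrix_inv[OF assms] by (simp add: matrix_vector_mul_assoc)
  then show "\<forall>i. (matrix_inv L *v x) $ i \<in> \<int>" by simp
next
  assume "\<forall>i. (matrix_inv L *v x) $ i \<in> \<int>"
  then have "matrix_inv L *v x = (\<chi> i. of_int ((\<chi> i. \<lfloor>(matrix_inv L *v x) $ i\<rfloor>) $ i))"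
    by (simp add: vec_eq_iff)
  then have "L *v (matrix_inv L *v x) \<in> lattice L" by (metis latticeI)
  then show "x \<in> lattice L"
    using invertible_matrix_inv[OF assms] by (simp add: matrix_vector_mul_assoc)
qed

lemma lattice_small_eq_0:
  assumes "invertible L" "l \<in> lattice L" "\<And>i. \<bar>(matrix_inv L *v l) $ i\<bar> < 1"
  shows "l = 0"
proof -
  have "(matrix_inv L *v l) $ i = 0" for i
    using assms lattice_iff Ints_nonzero_abs_less1 by blast
  then have "matrix_inv L *v l = 0" by (simp add: vec_eq_iff)
  then have "L *v (matrix_inv L *v l) = 0" by simp
  then show ?thesis using invertible_matrix_inv[OF assms(1)] by (simp add: matrix_vector_mul_assoc)
qed

text \<open>The map \<open>\<rho>\<close> is induced by the affine map with fixed point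
  \<open>p\<close> and linear part \<open>dil \<alpha> \<beta>\<close>; \<open>lattice_image\<close>
  lets this map and its inverse descend to the torus.\<close>

locale torus_bundle =
  fixes L :: "real^3^3" and \<alpha> :: real and \<beta> :: complex and p :: "real^3"
    and \<rho> :: "torus_point \<Rightarrow> torus_point"
  assumes invertible: "invertible L" and \<alpha>_pos: "\<alpha> > 0" and \<beta>_nonzero: "\<beta> \<noteq> 0"
    and lattice_image: "dil \<alpha> \<beta> ` lattice L = lattice L"
    and monodromy: "\<rho> (torus_proj L x) = torus_proj L (dil \<alpha> \<beta> (x - p) + p)"
begin

abbreviation dilp :: "int \<Rightarrow> real^3 \<Rightarrow> real^3" where
  "dilp n \<equiv> dil (\<alpha> powi n) (\<beta> powi n)"

definition iter :: "int \<Rightarrow> real^3 \<Rightarrow> real^3" where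
  "iter n x = dilp n (x - p) + p"

text \<open>A power of the lifted monodromy followed by a lattice translation. The linear parts
  preserve the lattice, so these maps form a semidirect product.\<close>

definition deck :: "int \<Rightarrow> real^3 \<Rightarrow> (real^3) \<times> real \<Rightarrow> (real^3) \<times> real" where
  "deck n l y = (iter n (fst y) + l, snd y + of_int n)"

definition deck_group :: "((real^3) \<times> real \<Rightarrow> (real^3) \<times> real) set" where
  "deck_group = {deck n l | n l. l \<in> lattice L}"

lemma dilp_dilp: "dilp m (dilp n x) = dilp (m + n) x"
  using \<alpha>_pos \<beta>_nonzero by (simp add: power_int_add)

text \<open>The downward step needs that the dilation maps the lattice onto itself and not merely
  into itself, whence the equality in \<open>lattice_image\<close>.\<close>

lemma dilp_in_lattice: "l \<in> lattice L \<Longrightarrow> dilp n l \<in> lattice L"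
proof (induction n rule: int_induct[of _ 0])
  case base
  then show ?case by simp
next
  case (step1 n)
  then have "dilp 1 (dilp n l) \<in> lattice L" using lattice_image by (auto simp del: dil_dil)
  then show ?case by (simp only: dilp_dilp add.commute)
next
  case (step2 n)
  then obtain l' where l': "l' \<in> lattice L" "dilp n l = dilp 1 l'" using lattice_image by auto
  then have "dilp (n - 1) l = dilp (-1) (dilp 1 l')" by (metis dilp_dilp uminus_add_conv_diff)
  also have "\<dots> = l'" by (simp only: dilp_dilp) simp
  finally show ?case using l' by simp
qed

lemma dilp_in_lattice_iff: "dilp n l \<in> lattice L \<longleftrightarrow> l \<in> lattice L"
proof -
  have "dilp (- n) (dilp n l) = l" by (simp only: dilp_dilp) simp
  then show ?thesis using dilp_in_lattice by metis
qed

lemma iter_0 [simp]: "iter 0 x = x"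
  by (simp add: iter_def)

lemma iter_iter: "iter m (iter n x) = iter (m + n) x"
  by (simp add: iter_def dilp_dilp del: dil_dil)

lemma iter_add: "iter n (x + l) = iter n x + dilp n l"
  by (simp add: iter_def dil_add dil_diff)

lemma iter_diff: "iter n x - iter n y = dilp n (x - y)"
  by (simp add: iter_def dil_diff)

lemma \<rho>_proj: "\<rho> (torus_proj L x) = torus_proj L (iter 1 x)"
  by (simp add: monodromy iter_def)

lemma inj_\<rho>: "inj_on \<rho> (torus L)"
proof (rule inj_onI)
  fix P Q assume PQ: "P \<in> torus L" "Q \<in> torus L" "\<rho> P = \<rho> Q"
  then obtain x y where xy: "P = torus_proj L x" "Q = torus_proj L y" by (auto simp: torus_def)
  with PQ(3) have "iter 1 y - iter 1 x \<in> lattice L" by (simp add: \<rho>_proj torus_proj_eq_iff)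
  then show "P = Q" by (simp only: xy torus_proj_eq_iff iter_diff dilp_in_lattice_iff)
qed

lemma torus_iter_proj: "torus_iter L \<rho> n (torus_proj L x) = torus_proj L (iter n x)"
proof -
  have pos: "(\<rho> ^^ k) (torus_proj L x) = torus_proj L (iter (int k) x)" for k x
    by (induction k) (simp_all add: \<rho>_proj iter_iter)
  have inv: "the_inv_into (torus L) \<rho> (torus_proj L x) = torus_proj L (iter (- 1) x)" for x
    by (rule the_inv_into_f_eq[OF inj_\<rho>]) (auto simp: \<rho>_proj iter_iter torus_def)
  have neg: "(the_inv_into (torus L) \<rho> ^^ k) (torus_proj L x) = torus_proj L (iter (- int k) x)" for k x
    by (induction k) (simp_all add: inv iter_iter)
  show ?thesis using pos[of "nat n"] neg[of "nat (- n)"] by (simp add: torus_iter_def)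
qed

lemma mapping_torus_proj_eq:
  "mapping_torus_proj L \<rho> y = {(torus_proj L (iter n (fst y)), snd y + of_int n) | n. True}"
  by (simp add: mapping_torus_proj_def torus_iter_proj)

text \<open>An orbit on the torus times the line lifts to an orbit of \<open>deck_group\<close>;
  conversely, applying \<open>deck n l\<close> to a representative only shifts the index of the
  orbit by \<open>n\<close>.\<close>

lemma mapping_torus_proj_eq_iff:
  "mapping_torus_proj L \<rho> y = mapping_torus_proj L \<rho> y' \<longleftrightarrow> (\<exists>\<gamma>\<in>deck_group. y' = \<gamma> y)"
proof
  assume eq: "mapping_torus_proj L \<rho> y = mapping_torus_proj L \<rho> y'"
  have "(torus_proj L (fst y'), snd y') \<in> mapping_torus_proj L \<rho> y'"
    unfolding mapping_torus_proj_eq by (auto intro: exI[of _ 0])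
  then obtain n where n: "torus_proj L (iter n (fst y)) = torus_proj L (fst y')" "snd y' = snd y + of_int n"
    unfolding eq[symmetric] unfolding mapping_torus_proj_eq by blast
  then have "fst y' - iter n (fst y) \<in> lattice L" by (simp add: torus_proj_eq_iff)
  moreover have "y' = deck n (fst y' - iter n (fst y)) y" using n(2) by (simp add: deck_def prod_eq_iff)
  ultimately show "\<exists>\<gamma>\<in>deck_group. y' = \<gamma> y" unfolding deck_group_def by blast
next
  assume "\<exists>\<gamma>\<in>deck_group. y' = \<gamma> y"
  then obtain n l where l: "l \<in> lattice L" and y': "y' = deck n l y" by (auto simp: deck_group_def)
  have *: "torus_proj L (iter m (fst y')) = torus_proj L (iter (m + n) (fst y))" for m
    using l by (simp add: y' deck_def iter_add iter_iter torus_proj_add_lattice dilp_in_lattice)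
  show "mapping_torus_proj L \<rho> y = mapping_torus_proj L \<rho> y'"
  proof (intro equalityI subsetI)
    fix q assume "q \<in> mapping_torus_proj L \<rho> y"
    then obtain m where "q = (torus_proj L (iter m (fst y)), snd y + of_int m)"
      by (auto simp: mapping_torus_proj_eq)
    then have "q = (torus_proj L (iter (m - n) (fst y')), snd y' + of_int (m - n))"
      by (simp only: *) (simp add: y' deck_def)
    then show "q \<in> mapping_torus_proj L \<rho> y'" unfolding mapping_torus_proj_eq by blast
  next
    fix q assume "q \<in> mapping_torus_proj L \<rho> y'"
    then obtain m where "q = (torus_proj L (iter m (fst y')), snd y' + of_int m)"
      by (auto simp: mapping_torus_proj_eq)
    then have "q = (torus_proj L (iter (m + n) (fst y)), snd y + of_int (m + n))"
      by (simp only: *) (simp add: y' deck_def)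
    then show "q \<in> mapping_torus_proj L \<rho> y" unfolding mapping_torus_proj_eq by blast
  qed
qed

lemma continuous_on_iter [continuous_intros]:
  "continuous_on S f \<Longrightarrow> continuous_on S (\<lambda>x. iter n (f x))"
  unfolding iter_def by (intro continuous_intros bounded_linear.continuous_on[OF bounded_linear_dil])

lemma deck_has_derivative: "(deck n l has_derivative (\<lambda>u. (dilp n (fst u), snd u))) (at y)"
  unfolding deck_def[abs_def] iter_def
  by (rule derivative_eq_intros bounded_linear.has_derivative[OF bounded_linear_dil] refl)+ auto

lemma deck_linear_part: "(\<lambda>u. deck n l u - deck n l 0) = (\<lambda>u. (dilp n (fst u), snd u))"
  by (auto simp: deck_def iter_diff fun_eq_iff)

lemma locally_injective_proj: "\<exists>V. open V \<and> y \<in> V \<and> inj_on (mapping_torus_proj L \<rho>) V"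
proof -
  \<comment> \<open>Two points of this box differ by less than 1 in time and in each lattice
    coordinate, so only the identity deck transformation can relate them.\<close>
  define V where "V = {y'. \<bar>snd y' - snd y\<bar> < 1/2 \<and> (\<forall>i. \<bar>(matrix_inv L *v (fst y' - fst y)) $ i\<bar> < 1/2)}"
  have "open V" unfolding V_def
    unfolding forall_3 by (intro open_Collect_conj open_Collect_less continuous_intros
          bounded_linear.continuous_on[OF matrix_vector_mul_bounded_linear])
  moreover have "y \<in> V" by (simp add: V_def)
  moreover have "inj_on (mapping_torus_proj L \<rho>) V"
  proof (rule inj_onI)
    fix u v assume uv: "u \<in> V" "v \<in> V" "mapping_torus_proj L \<rho> u = mapping_torus_proj L \<rho> v"
    then obtain n l where l: "l \<in> lattice L" and v: "v = deck n l u"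
      by (auto simp: mapping_torus_proj_eq_iff deck_group_def)
    have "\<bar>snd v - snd u\<bar> < 1" using uv(1,2) unfolding V_def by (simp add: abs_if split: if_splits)
    then have n: "n = 0" by (simp add: v deck_def)
    have "l = 0"
    proof (rule lattice_small_eq_0[OF invertible l])
      fix i
      have "matrix_inv L *v l = matrix_inv L *v (fst v - fst y) - matrix_inv L *v (fst u - fst y)"
        by (simp add: v deck_def n matrix_vector_mult_diff_distrib matrix_vector_right_distrib)
      moreover have "\<bar>(matrix_inv L *v (fst v - fst y)) $ i\<bar> < 1/2" "\<bar>(matrix_inv L *v (fst u - fst y)) $ i\<bar> < 1/2"
        using uv(1,2) unfolding V_def by auto
      ultimately show "\<bar>(matrix_inv L *v l) $ i\<bar> < 1" by simp
    qed
    then show "u = v" by (simp add: v deck_def n prod_eq_iff)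
  qed
  ultimately show ?thesis by blast
qed

text \<open>The relation is an infinite union of closed sets, one for each time difference. Along a
  convergent sequence these differences are convergent integers, hence eventually constant, so the
  limit stays in a single piece.\<close>

lemma closed_proj_equiv: "closed {z. mapping_torus_proj L \<rho> (fst z) = mapping_torus_proj L \<rho> (snd z)}"
proof -
  define C where "C n = {z :: ((real^3) \<times> real) \<times> ((real^3) \<times> real). snd (snd z) - snd (fst z) = of_int n \<and>
      (\<forall>i. (matrix_inv L *v (fst (snd z) - iter n (fst (fst z)))) $ i \<in> \<int>)}" for n
  have *: "{z. mapping_torus_proj L \<rho> (fst z) = mapping_torus_proj L \<rho> (snd z)} = (\<Union>n. C n)"
  proof (intro equalityI subsetI)
    fix z assume "z \<in> {z. mapping_torus_proj L \<rho> (fst z) = mapping_torus_proj L \<rho> (snd z)}"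
    then obtain n l where "l \<in> lattice L" "snd z = deck n l (fst z)"
      by (auto simp: mapping_torus_proj_eq_iff deck_group_def)
    then have "z \<in> C n" using lattice_iff[OF invertible] by (simp add: C_def deck_def)
    then show "z \<in> (\<Union>n. C n)" by blast
  next
    fix z assume "z \<in> (\<Union>n. C n)"
    then obtain n where n: "z \<in> C n" by blast
    then have "fst (snd z) - iter n (fst (fst z)) \<in> lattice L" using lattice_iff[OF invertible] by (simp add: C_def)
    moreover have "snd z = deck n (fst (snd z) - iter n (fst (fst z))) (fst z)"
      using n by (simp add: C_def deck_def prod_eq_iff)
    ultimately show "z \<in> {z. mapping_torus_proj L \<rho> (fst z) = mapping_torus_proj L \<rho> (snd z)}"
      by (auto simp: mapping_torus_proj_eq_iff deck_group_def)
  qed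
  have closedC: "closed (C n)" for n
  proof -
    have "closed ((\<lambda>z. (matrix_inv L *v (fst (snd z) - iter n (fst (fst z)))) $ i) -` \<int>)" for i
      by (intro closed_vimage closed_Ints continuous_intros
          bounded_linear.continuous_on[OF matrix_vector_mul_bounded_linear])
    then show ?thesis unfolding C_def
      by (intro closed_Collect_conj closed_Collect_all closed_Collect_eq continuous_intros) (simp add: vimage_def)
  qed
  show ?thesis unfolding * closed_sequential_limits
  proof (intro allI impI, elim conjE)
    fix f l assume f: "\<forall>j. f j \<in> (\<Union>n. C n)" and lim: "f \<longlonglongrightarrow> l"
    then have "\<forall>j. \<exists>n. f j \<in> C n" by blast
    then obtain n where n: "\<And>j. f j \<in> C (n j)" by (metis (lifting))
    let ?c = "\<lambda>z :: ((real^3) \<times> real) \<times> ((real^3) \<times> real). snd (snd z) - snd (fst z)"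
    have "(\<lambda>j. ?c (f j)) \<longlonglongrightarrow> ?c l" by (intro tendsto_intros lim)
    then have "\<forall>\<^sub>F j in sequentially. dist (?c (f j)) (?c l) < 1/2" by (rule tendstoD) simp
    then obtain N where N: "\<And>j. j \<ge> N \<Longrightarrow> dist (?c (f j)) (?c l) < 1/2" by (auto simp: eventually_sequentially)
    have "n j = n N" if "j \<ge> N" for j
    proof -
      have c: "?c (f i) = of_int (n i)" for i using n[of i] by (simp add: C_def)
      have "\<bar>of_int (n j) - ?c l\<bar> < 1/2" "\<bar>of_int (n N) - ?c l\<bar> < 1/2"
        using N[OF that] N[OF order_refl] unfolding c dist_real_def by auto
      then show ?thesis by linarith
    qed
    then have "\<forall>\<^sub>F j in sequentially. f j \<in> C (n N)"
      unfolding eventually_sequentially using n by (intro exI[of _ N] allI impI) (metis)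
    then have "l \<in> C (n N)" using Lim_in_closed_set[OF closedC _ _ lim] by simp
    then show "l \<in> (\<Union>n. C n)" by blast
  qed
qed

text \<open>The expression \<open>\<gamma> u - \<gamma> 0\<close> extracts the linear part of an
  affine map without reference to its parameters.\<close>

sublocale affine_quotient "mapping_torus_proj L \<rho>" deck_group "\<lambda>\<gamma> u. \<gamma> u - \<gamma> 0"
proof
  show "(\<gamma> has_derivative (\<lambda>u. \<gamma> u - \<gamma> 0)) (at x)" if "\<gamma> \<in> deck_group" for \<gamma> x
  proof -
    from that obtain n l where "\<gamma> = deck n l" by (auto simp: deck_group_def)
    then show ?thesis using deck_has_derivative[of n l x] by (simp only: deck_linear_part)
  qed
qed (use mapping_torus_proj_eq_iff locally_injective_proj closed_proj_equiv in auto)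

text \<open>Turns every compatibility condition for a tensor field into equivariance under the maps
  \<open>deck n l\<close>.\<close>

lemma mapping_torus_transition:
  assumes "c \<in> mapping_torus_atlas L \<rho>" "d \<in> mapping_torus_atlas L \<rho>" "x \<in> local_dom c d id"
  obtains n l where "l \<in> lattice L" "local_map c d id x = deck n l x"
    "differential c d id x = (\<lambda>u. (dilp n (fst u), snd u))"
proof -
  from assms obtain \<gamma> where g: "\<gamma> \<in> deck_group" "local_map c d id x = \<gamma> x"
    "differential c d id x = (\<lambda>u. \<gamma> u - \<gamma> 0)"
    unfolding mapping_torus_atlas_def by (rule transition_differential)
  then obtain n l where l: "l \<in> lattice L" "\<gamma> = deck n l" by (auto simp: deck_group_def)
  then show ?thesis using g l that by (simp only: deck_linear_part)
qed

end

section \<open>The generalized Kaehler structure in coordinates\<close>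

text \<open>Here \<open>a\<close> and \<open>m\<close> play the role of \<open>a\<^sub>1\<close> and \<open>1/l\<close> on the universal cover; \<open>b\<^sub>2\<close> and \<open>b\<^sub>3\<close> only
  enter through \<open>l\<close>, because the plane of \<open>e\<^sub>2, e\<^sub>3\<close> is rotated conformally.\<close>

definition warped_metric ::
  "(real \<Rightarrow> real) \<Rightarrow> (real \<Rightarrow> real) \<Rightarrow> (real^3) \<times> real \<Rightarrow> (real^3) \<times> real \<Rightarrow> (real^3) \<times> real \<Rightarrow> real" where
  "warped_metric a m y u v =
     1 / a (snd y) * (1 / a (snd y)) * (fst u $ 1 * fst v $ 1) + snd u * snd v
     + m (snd y) * (fst u $ 2 * fst v $ 2 + fst u $ 3 * fst v $ 3)"

definition warped_J :: "real \<Rightarrow> (real \<Rightarrow> real) \<Rightarrow> (real^3) \<times> real \<Rightarrow> (real^3) \<times> real \<Rightarrow> (real^3) \<times> real" where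
  "warped_J \<epsilon> a y u =
     (vector [- a (snd y) * snd u, - \<epsilon> * fst u $ 3, \<epsilon> * fst u $ 2], 1 / a (snd y) * fst u $ 1)"

lemma warped_J_components [simp]:
  "fst (warped_J \<epsilon> a y u) $ 1 = - a (snd y) * snd u"
  "fst (warped_J \<epsilon> a y u) $ 2 = - \<epsilon> * fst u $ 3"
  "fst (warped_J \<epsilon> a y u) $ 3 = \<epsilon> * fst u $ 2"
  "snd (warped_J \<epsilon> a y u) = 1 / a (snd y) * fst u $ 1"
  by (simp_all add: warped_J_def)

lemma R31_eq_iff: "u = v \<longleftrightarrow> fst u $ 1 = fst v $ 1 \<and> fst u $ 2 = fst v $ 2 \<and> fst u $ 3 = fst v $ 3 \<and> snd u = snd v"
  for u v :: "(real^3) \<times> real"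
  by (auto simp: prod_eq_iff vec_eq_iff forall_3)

lemma linear_warped_J: "linear (warped_J \<epsilon> a y)"
  by (simp add: linear_iff R31_eq_iff algebra_simps)

lemma warped_J_warped_J:
  "\<epsilon> * \<epsilon> = 1 \<Longrightarrow> a (snd y) \<noteq> 0 \<Longrightarrow> warped_J \<epsilon> a y (warped_J \<epsilon> a y u) = - u"
  by (simp add: R31_eq_iff flip: mult.assoc)

text \<open>Confines the dependence on time to the scalar coefficients \<open>a\<close> and
  \<open>1 / a\<close>, so that derivatives and smoothness of the endomorphism reduce to those of
  two functions.\<close>

lemma warped_J_decomp: "warped_J \<epsilon> a y u =
    a (snd y) *\<^sub>R (vector [- snd u, 0, 0], 0) + (1 / a (snd y)) *\<^sub>R (0, fst u $ 1)
    + (vector [0, - \<epsilon> * fst u $ 3, \<epsilon> * fst u $ 2], 0)"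
  by (simp add: R31_eq_iff)

lemma ext_deriv_3:
  "ext_deriv \<eta> x [u, v, w] = frechet_derivative (\<lambda>y. \<eta> y [v, w]) (at x) u
     - frechet_derivative (\<lambda>y. \<eta> y [u, w]) (at x) v + frechet_derivative (\<lambda>y. \<eta> y [u, v]) (at x) w"
  by (simp add: ext_deriv_def)

lemma has_derivative_snd_comp:
  assumes "(f has_real_derivative f') (at (snd y))"
  shows "((\<lambda>y. f (snd y)) has_derivative (\<lambda>h. f' * snd h)) (at y)"
  using has_derivative_compose[OF has_derivative_snd[OF has_derivative_ident], of f "\<lambda>h. f' * h" y UNIV]
    assms by (simp add: has_field_derivative_def)

text \<open>\<open>m_deriv\<close> is the hypothesis on \<open>1 / l\<close>, carried over to the
  whole line. Differentiability of \<open>a\<close> is left to the next locale, since the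
  biholomorphism must also cover coefficients with corners at integral times.\<close>

locale warped_functions =
  fixes a m :: "real \<Rightarrow> real" and k :: real
  assumes a_nonzero: "a t \<noteq> 0" and m_pos: "m t > 0" and k_nonzero: "k \<noteq> 0"
    and m_deriv: "(m has_real_derivative k * a t) (at t)"

locale differentiable_warped_functions = warped_functions +
  assumes a_differentiable: "a differentiable (at t)"
begin

definition a' :: "real \<Rightarrow> real" where "a' t = deriv a t"

lemma a_deriv: "(a has_real_derivative a' t) (at t)"
  using a_differentiable by (simp add: a'_def DERIV_deriv_iff_real_differentiable)

lemma inv_a_deriv: "((\<lambda>t. 1 / a t) has_real_derivative - a' t / (a t)\<^sup>2) (at t)"
  using a_nonzero by (auto intro!: derivative_eq_intros a_deriv simp: power2_eq_square)

lemma warped_J_has_derivative: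
  "((\<lambda>y. warped_J \<epsilon> a y u) has_derivative
     (\<lambda>h. snd h *\<^sub>R (vector [- a' (snd y) * snd u, 0, 0], - a' (snd y) / (a (snd y))\<^sup>2 * fst u $ 1))) (at y)"
  unfolding warped_J_decomp
  by (rule derivative_eq_intros has_derivative_snd_comp a_deriv inv_a_deriv refl)+
    (simp add: fun_eq_iff R31_eq_iff)

lemma nijenhuis_warped_J:
  assumes "\<epsilon> * \<epsilon> = 1"
  shows "nijenhuis (warped_J \<epsilon> a) y u v = 0"
  unfolding nijenhuis_def lie_bracket_def frechet_derivative_eqI[OF warped_J_has_derivative]
  using a_nonzero[of "snd y"] by (simp add: R31_eq_iff field_simps power2_eq_square)

text \<open>\<open>d_c\<close> first applies the complex structure to the form. Compatibility with
  the metric makes the fundamental form invariant, so the result is the form itself.\<close>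

lemma warped_form:
  assumes "\<epsilon> * \<epsilon> = 1"
  shows "fundamental_form (warped_metric a m) (warped_J \<epsilon> a) y (map (warped_J \<epsilon> a y) [u, v]) =
    1 / a (snd y) * (fst u $ 1 * snd v - snd u * fst v $ 1)
    + m (snd y) * (\<epsilon> * (fst u $ 2 * fst v $ 3 - fst u $ 3 * fst v $ 2))"
proof -
  have "\<epsilon> * (\<epsilon> * r) = r" for r using assms by (simp flip: mult.assoc)
  then show ?thesis using a_nonzero[of "snd y"]
    by (simp add: fundamental_form_def warped_metric_def warped_J_warped_J[OF assms] field_simps power2_eq_square)
qed

lemma warped_form_derivative:
  assumes "\<epsilon> * \<epsilon> = 1"
  shows "frechet_derivative (\<lambda>y. fundamental_form (warped_metric a m) (warped_J \<epsilon> a) y (map (warped_J \<epsilon> a y) [u, v])) (at y)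
    = (\<lambda>h. snd h * (- a' (snd y) / (a (snd y))\<^sup>2 * (fst u $ 1 * snd v - snd u * fst v $ 1)
        + k * a (snd y) * (\<epsilon> * (fst u $ 2 * fst v $ 3 - fst u $ 3 * fst v $ 2))))"
  unfolding warped_form[OF assms]
  by (rule frechet_derivative_eqI,
      rule has_derivative_eq_rhs[OF has_derivative_add[OF
        has_derivative_mult_left[OF has_derivative_snd_comp[OF inv_a_deriv]]
        has_derivative_mult_left[OF has_derivative_snd_comp[OF m_deriv]]]])
    (simp add: fun_eq_iff algebra_simps diff_divide_distrib)

lemma inv_warped_J:
  assumes "\<epsilon> * \<epsilon> = 1"
  shows "inv (warped_J \<epsilon> a y) = (\<lambda>u. - warped_J \<epsilon> a y u)"
proof (rule inv_equality)
  show "- warped_J \<epsilon> a y (warped_J \<epsilon> a y u) = u" for u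
    using warped_J_warped_J[OF assms a_nonzero] by simp
  show "warped_J \<epsilon> a y (- warped_J \<epsilon> a y u) = u" for u
    using warped_J_warped_J[OF assms a_nonzero] by (simp add: linear_neg[OF linear_warped_J])
qed

text \<open>\<open>d\<^sup>c\<omega>\<^sub>\<plusminus> = \<mp>k dx\<^sup>1 \<and> dx\<^sup>2 \<and> dx\<^sup>3\<close>, which has constant coefficients.\<close>

lemma d_c_warped:
  assumes "\<epsilon> * \<epsilon> = 1"
  shows "d_c (warped_J \<epsilon> a) (fundamental_form (warped_metric a m) (warped_J \<epsilon> a)) y [u, v, w] =
    - (\<epsilon> * k) * (fst u $ 1 * (fst v $ 2 * fst w $ 3 - fst v $ 3 * fst w $ 2)
      - fst v $ 1 * (fst u $ 2 * fst w $ 3 - fst u $ 3 * fst w $ 2)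
      + fst w $ 1 * (fst u $ 2 * fst v $ 3 - fst u $ 3 * fst v $ 2))"
proof -
  have Ai: "a (snd y) * (1 / a (snd y)) = 1" using a_nonzero[of "snd y"] by simp
  \<comment> \<open>Here \<open>i\<close> stands for \<open>1 / a\<close> and \<open>q\<close> for
    its derivative. The terms with \<open>q\<close> cancel because the wedge product of the first
    coframe element with theta is closed, and \<open>A * i = 1\<close> removes \<open>a\<close> from
    the rest.\<close>
  have "(- (i * u1)) * (q * ((A * vt) * (- (i * w1)) - (- (i * v1)) * (A * wt))
        + k * A * (\<epsilon> * ((\<epsilon> * v3) * (- (\<epsilon> * w2)) - (- (\<epsilon> * v2)) * (\<epsilon> * w3))))
      - (- (i * v1)) * (q * ((A * ut) * (- (i * w1)) - (- (i * u1)) * (A * wt))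
        + k * A * (\<epsilon> * ((\<epsilon> * u3) * (- (\<epsilon> * w2)) - (- (\<epsilon> * u2)) * (\<epsilon> * w3))))
      + (- (i * w1)) * (q * ((A * ut) * (- (i * v1)) - (- (i * u1)) * (A * vt))
        + k * A * (\<epsilon> * ((\<epsilon> * u3) * (- (\<epsilon> * v2)) - (- (\<epsilon> * u2)) * (\<epsilon> * v3))))
      = - (\<epsilon> * k) * (u1 * (v2 * w3 - v3 * w2) - v1 * (u2 * w3 - u3 * w2) + w1 * (u2 * v3 - u3 * v2))"
    if "A * i = 1" for A i q u1 u2 u3 ut v1 v2 v3 vt w1 w2 w3 wt :: real
    using that assms by algebra
  from this[OF Ai]
  show ?thesis
    unfolding d_c_def list.map(2) list.map(1) ext_deriv_3
    unfolding warped_form_derivative[OF assms, simplified list.map] inv_warped_J[OF assms]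
    by (simp only: warped_J_components fst_uminus snd_uminus vector_uminus_component mult_minus_left minus_minus)
qed

end

lemma R31_eq_iff_zc: "u = v \<longleftrightarrow> fst u $ 1 = fst v $ 1 \<and> zc (fst u) = zc (fst v) \<and> snd u = snd v"
  for u v :: "(real^3) \<times> real"
  by (auto simp: prod_eq_iff vec3_eq_iff)

lemma zc_warped_J [simp]: "zc (fst (warped_J \<epsilon> a y u)) = of_real \<epsilon> * \<i> * zc (fst u)"
  by (simp add: complex_eq_iff)

lemma warped_metric_zc: "warped_metric a m y u v =
     1 / a (snd y) * (1 / a (snd y)) * (fst u $ 1 * fst v $ 1) + snd u * snd v
     + m (snd y) * Re (zc (fst u) * cnj (zc (fst v)))"
  by (simp add: warped_metric_def)

lemma quasiperiodic_int:
  fixes f :: "real \<Rightarrow> 'a::field"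
  assumes "\<And>t. f (t + 1) = c * f t" "c \<noteq> 0"
  shows "f (t + of_int n) = c powi n * f t"
proof (induction n rule: int_induct[of _ 0])
  case (step1 n)
  then show ?case using assms(1)[of "t + of_int n"] assms(2) by (simp add: power_int_add add.assoc)
next
  case (step2 n)
  then show ?case using assms(1)[of "t + of_int (n - 1)"] assms(2) by (simp add: power_int_diff field_simps)
qed simp

lemma power_int_volume:
  fixes \<beta> :: complex
  assumes "\<alpha> * (cmod \<beta>)\<^sup>2 = 1"
  shows "\<alpha> powi n * (cmod (\<beta> powi n))\<^sup>2 = 1"
proof -
  have "\<alpha> powi n * (cmod (\<beta> powi n))\<^sup>2 = (\<alpha> * (cmod \<beta>)\<^sup>2) powi n"
    by (simp add: norm_power_int power_int_mult_distrib power2_eq_square)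
  then show ?thesis by (simp add: assms)
qed

text \<open>The multipliers are matched so that the deck transformations preserve metric and complex
  structures: the dilation of the first coordinate is offset by \<open>a\<close>, and the scaling of
  the plane by \<open>m\<close> together with \<open>volume\<close>.\<close>

locale equivariant_warped = torus_bundle + warped_functions +
  assumes volume: "\<alpha> * (cmod \<beta>)\<^sup>2 = 1"
    and a_shift: "a (t + 1) = \<alpha> * a t" and m_shift: "m (t + 1) = \<alpha> * m t"
begin

lemma shift_int:
  fixes f :: "real \<Rightarrow> real"
  assumes "\<And>t. f (t + 1) = \<alpha> * f t"
  shows "f (t + of_int n) = \<alpha> powi n * f t"
  using quasiperiodic_int[of f \<alpha>, OF assms] \<alpha>_pos by simp

lemmas volume_int = power_int_volume[OF volume]

lemma warped_J_deck:
  "warped_J \<epsilon> a (deck n l y) (dilp n (fst u), snd u) =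
    (dilp n (fst (warped_J \<epsilon> a y u)), snd (warped_J \<epsilon> a y u))"
  using \<alpha>_pos by (simp add: R31_eq_iff_zc deck_def shift_int[of a, OF a_shift])

lemma warped_metric_deck:
  "warped_metric a m (deck n l y) (dilp n (fst u), snd u) (dilp n (fst v), snd v) = warped_metric a m y u v"
proof -
  let ?A = "\<alpha> powi n" and ?B = "\<beta> powi n"
  have A: "?A \<noteq> 0" using \<alpha>_pos by simp
  have "?B * z * cnj (?B * w) = of_real ((cmod ?B)\<^sup>2) * (z * cnj w)" for z w
    unfolding complex_norm_square by (simp add: mult_ac)
  moreover have "Re (of_real r * w) = r * Re w" for r w by simp
  ultimately have B: "Re (?B * z * cnj (?B * w)) = (cmod ?B)\<^sup>2 * Re (z * cnj w)" for z w
    by metis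
  have "?A * m (snd y) * ((cmod ?B)\<^sup>2 * r) = m (snd y) * r" for r
    using volume_int[of n] by (simp add: mult.assoc mult.left_commute)
  then show ?thesis
    using A \<alpha>_pos a_nonzero[of "snd y"] by (simp add: warped_metric_zc deck_def shift_int[of a, OF a_shift] shift_int[of m, OF m_shift] B
        del: complex_cnj_mult times_complex.sel)
qed

lemma split_generalized_Kaehler_warped:
  assumes smooth_inv_a: "\<And>c. c \<in> mapping_torus_atlas L \<rho> \<Longrightarrow> smooth_on (fst c) (\<lambda>y. 1 / a (snd y))"
    and smooth_m: "\<And>c. c \<in> mapping_torus_atlas L \<rho> \<Longrightarrow> smooth_on (fst c) (\<lambda>y. m (snd y))"
  shows "split_generalized_Kaehler (mapping_torus L \<rho>) (mapping_torus_atlas L \<rho>)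
    (\<lambda>c. warped_metric a m) (\<lambda>c. warped_J 1 a) (\<lambda>c. warped_J (-1) a)"
proof -
  let ?A = "mapping_torus_atlas L \<rho>"
  have op: "open (fst c)" if "c \<in> ?A" for c
    using that by (auto simp: mapping_torus_atlas_def quotient_atlas_def)
  have smooth_a: "smooth_on (fst c) (\<lambda>y. a (snd y))" if c: "c \<in> ?A" for c
  proof -
    \<comment> \<open>As the time derivative of \<open>m\<close> is \<open>k * a\<close> with
      \<open>k\<close> nonzero, smoothness of \<open>m\<close> yields that of
      \<open>a\<close>.\<close>
    have "frechet_derivative (\<lambda>y. m (snd y)) (at y) (0, 1) = k * a (snd y)" for y :: "(real^3) \<times> real"
      using frechet_derivative_eqI[OF has_derivative_snd_comp[OF m_deriv, of y]] by simp
    then have "smooth_on (fst c) (\<lambda>y. k * a (snd y))"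
      using smooth_on_directional_derivative[OF op[OF c] smooth_m[OF c], of "(0, 1)"] by simp
    from smooth_on_cmult[OF op[OF c] this, of "1 / k"] show ?thesis using k_nonzero by simp
  qed
  interpret differentiable_warped_functions a m k
  proof
    fix t
    obtain c where c: "c \<in> ?A" "(0, t) \<in> fst c"
      using quotient_atlas_cover unfolding mapping_torus_atlas_def by blast
    then have "(\<lambda>y. a (snd y)) differentiable (at ((0, t) :: (real^3) \<times> real))"
      using smooth_on_imp_differentiable[OF op smooth_a] by blast
    then have "((\<lambda>y. a (snd y)) \<circ> (\<lambda>s. (0 :: real^3, s))) differentiable (at t)"
      by (intro differentiable_chain_at) (auto intro!: derivative_intros simp: differentiable_def)
    then show "a differentiable (at t)" by (simp add: o_def)
  qed
  have J: "complex_structure ?A (\<lambda>c. warped_J \<epsilon> a)" if "\<epsilon> * \<epsilon> = 1" for \<epsilon>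
    unfolding complex_structure_def
  proof (intro conjI ballI allI)
    fix c assume c: "c \<in> ?A"
    show "smooth_on (fst c) (\<lambda>x. warped_J \<epsilon> a x u)" for u
      unfolding warped_J_decomp
      by (intro smooth_on_add smooth_on_const op c smooth_a smooth_inv_a
          smooth_on_linear_image[OF bounded_linear_scaleR_left])
    fix d x u assume "d \<in> ?A" "x \<in> local_dom c d id"
    with c obtain n l where "l \<in> lattice L" "local_map c d id x = deck n l x"
      "differential c d id x = (\<lambda>u. (dilp n (fst u), snd u))"
      by (rule mapping_torus_transition)
    then show "differential c d id x (warped_J \<epsilon> a x u) = warped_J \<epsilon> a (local_map c d id x) (differential c d id x u)"
      by (simp add: warped_J_deck)
  qed (use that in \<open>simp_all add: linear_warped_J warped_J_warped_J a_nonzero nijenhuis_warped_J\<close>)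
  have g: "riemannian_metric ?A (\<lambda>c. warped_metric a m)"
    unfolding riemannian_metric_def
  proof (intro conjI ballI allI impI)
    fix c x and u v :: "(real^3) \<times> real" assume c: "c \<in> ?A"
    show "bilinear (warped_metric a m x)"
      by (simp add: bilinear_def linear_iff warped_metric_def algebra_simps add_divide_distrib)
    show "warped_metric a m x u v = warped_metric a m x v u"
      by (simp add: warped_metric_def algebra_simps)
    show "warped_metric a m x u u > 0" if "u \<noteq> 0"
    proof -
      let ?p = "1 / a (snd x) * (1 / a (snd x))"
      have p: "?p > 0" using a_nonzero[of "snd x"] by (auto simp: zero_less_mult_iff linorder_neq_iff)
      have nonneg: "?p * (fst u $ 1 * fst u $ 1) \<ge> 0" "snd u * snd u \<ge> 0"
        "m (snd x) * (fst u $ 2 * fst u $ 2 + fst u $ 3 * fst u $ 3) \<ge> 0"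
        using p m_pos[of "snd x"] by (auto intro!: mult_nonneg_nonneg add_nonneg_nonneg)
      have "fst u $ 1 \<noteq> 0 \<or> fst u $ 2 \<noteq> 0 \<or> fst u $ 3 \<noteq> 0 \<or> snd u \<noteq> 0"
        using that by (auto simp: R31_eq_iff)
      moreover have "fst u $ 2 * fst u $ 2 + fst u $ 3 * fst u $ 3 > 0" if "fst u $ 2 \<noteq> 0 \<or> fst u $ 3 \<noteq> 0"
        using that sum_power2_gt_zero_iff[of "fst u $ 2" "fst u $ 3"] by (simp add: power2_eq_square)
      moreover have "r * r > 0" if "r \<noteq> 0" for r :: real
        using that by (auto simp: zero_less_mult_iff linorder_neq_iff)
      ultimately have "?p * (fst u $ 1 * fst u $ 1) > 0 \<or> snd u * snd u > 0
          \<or> m (snd x) * (fst u $ 2 * fst u $ 2 + fst u $ 3 * fst u $ 3) > 0"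
        using p m_pos[of "snd x"] by (meson mult_pos_pos)
      then show ?thesis unfolding warped_metric_def using nonneg by linarith
    qed
    show "smooth_on (fst c) (\<lambda>x. warped_metric a m x u v)"
      unfolding warped_metric_def
      by (intro smooth_on_add smooth_on_mult smooth_on_const op c smooth_m smooth_inv_a)
    fix d assume "d \<in> ?A" "x \<in> local_dom c d id"
    with c obtain n l where "l \<in> lattice L" "local_map c d id x = deck n l x"
      "differential c d id x = (\<lambda>u. (dilp n (fst u), snd u))"
      by (rule mapping_torus_transition)
    then show "warped_metric a m (local_map c d id x) (differential c d id x u) (differential c d id x v)
        = warped_metric a m x u v"
      by (simp add: warped_metric_deck)
  qed
  have compatible: "warped_metric a m x (warped_J \<epsilon> a x u) (warped_J \<epsilon> a x v) = warped_metric a m x u v"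
    if "\<epsilon> * \<epsilon> = 1" for \<epsilon> x u v
  proof -
    have "i * i * ((- A * ut) * (- A * vt)) + (i * u1) * (i * v1)
        + M * ((- \<epsilon> * u3) * (- \<epsilon> * v3) + (\<epsilon> * u2) * (\<epsilon> * v2)) = i * i * (u1 * v1) + ut * vt + M * (u2 * v2 + u3 * v3)"
      if "A * i = 1" for A i M u1 u2 u3 ut v1 v2 v3 vt :: real
      using that \<open>\<epsilon> * \<epsilon> = 1\<close> by algebra
    moreover have "a (snd x) * (1 / a (snd x)) = 1" using a_nonzero[of "snd x"] by simp
    ultimately show ?thesis unfolding warped_metric_def warped_J_components by blast
  qed
  have "d_c (warped_J 1 a) (fundamental_form (warped_metric a m) (warped_J 1 a)) x vs =
      - d_c (warped_J (-1) a) (fundamental_form (warped_metric a m) (warped_J (-1) a)) x vs"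
    if "length vs = 3" for x vs
  proof -
    obtain u v w where "vs = [u, v, w]"
      using \<open>length vs = 3\<close> by (auto simp: length_Suc_conv eval_nat_numeral)
    then show ?thesis by (simp add: d_c_warped)
  qed
  moreover have "ext_deriv (d_c (warped_J 1 a) (fundamental_form (warped_metric a m) (warped_J 1 a))) x vs = 0"
    if "length vs = 4" for x vs
  proof -
    have "frechet_derivative (\<lambda>y. d_c (warped_J 1 a) (fundamental_form (warped_metric a m) (warped_J 1 a)) y
        (take i vs @ drop (Suc i) vs)) (at x) h = 0" if "i < 4" for i h
    proof -
      have "length (take i vs @ drop (Suc i) vs) = 3" using that \<open>length vs = 4\<close> by simp
      then obtain u v w where "take i vs @ drop (Suc i) vs = [u, v, w]"
        by (auto simp: length_Suc_conv eval_nat_numeral simp del: length_append)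
      then show ?thesis by (simp add: d_c_warped)
    qed
    then show ?thesis unfolding ext_deriv_def using \<open>length vs = 4\<close> by (simp del: mult_eq_0_iff)
  qed
  moreover have "warped_J 1 a x (warped_J (-1) a x u) = warped_J (-1) a x (warped_J 1 a x u)" for x u
    by (simp add: R31_eq_iff_zc)
  ultimately show ?thesis
    unfolding split_generalized_Kaehler_def generalized_Kaehler_def
    using smooth_manifold_quotient g J compatible
    by (simp add: mapping_torus_def mapping_torus_atlas_def)
qed

end

section \<open>Biholomorphism with an Inoue surface\<close>

lemma ex_power_int_greater:
  fixes x y :: real
  assumes "x > 0" "x \<noteq> 1"
  shows "\<exists>n::int. y < x powi n"
proof (cases "x > 1")
  case True
  then obtain n where "y < x ^ n" using real_arch_pow by blast
  then show ?thesis by (intro exI[of _ "int n"]) simp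
next
  case False
  then have "1 < inverse x" using assms by (simp add: one_less_inverse_iff)
  then obtain n where "y < inverse x ^ n" using real_arch_pow by blast
  then show ?thesis by (intro exI[of _ "- int n"]) (simp add: power_int_minus power_inverse)
qed

text \<open>For \<open>\<epsilon> = 1\<close> the identity and for \<open>\<epsilon> = -1\<close> complex conjugation, which treats \<open>J\<^sub>+\<close> and \<open>J\<^sub>-\<close> together.\<close>

definition cj :: "real \<Rightarrow> complex \<Rightarrow> complex" where
  "cj \<epsilon> z = Complex (Re z) (\<epsilon> * Im z)"

lemma cj_simps [simp]: "Re (cj \<epsilon> z) = Re z" "Im (cj \<epsilon> z) = \<epsilon> * Im z"
  by (simp_all add: cj_def)

lemma cj_add: "cj \<epsilon> (z + w) = cj \<epsilon> z + cj \<epsilon> w"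
  by (simp add: complex_eq_iff algebra_simps)

lemma cj_scaleR: "cj \<epsilon> (r *\<^sub>R z) = r *\<^sub>R cj \<epsilon> z"
  by (simp add: complex_eq_iff)

lemma bounded_linear_cj: "bounded_linear (cj \<epsilon>)"
  by (simp add: linear_conv_bounded_linear[symmetric] linear_iff cj_add cj_scaleR)

lemma cj_cj: "\<epsilon> * \<epsilon> = 1 \<Longrightarrow> cj \<epsilon> (cj \<epsilon> z) = z"
  by (simp add: complex_eq_iff flip: mult.assoc)

lemma cj_mult:
  assumes "\<epsilon> * \<epsilon> = 1"
  shows "cj \<epsilon> (z * w) = cj \<epsilon> z * cj \<epsilon> w"
proof -
  have "\<epsilon> * Im z * (\<epsilon> * Im w) = Im z * Im w" using assms by algebra
  then show ?thesis by (simp only: complex_eq_iff cj_simps times_complex.sel) (simp add: algebra_simps)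
qed

lemma cj_power_int:
  assumes "\<epsilon> * \<epsilon> = 1"
  shows "cj \<epsilon> (z powi n) = cj \<epsilon> z powi n"
proof -
  from assms consider "\<epsilon> = 1" | "\<epsilon> = - 1" by (auto simp: square_eq_1_iff)
  then show ?thesis
  proof cases
    case 1
    then have "cj \<epsilon> = (\<lambda>z. z)" by (simp add: fun_eq_iff complex_eq_iff)
    then show ?thesis by simp
  next
    case 2
    then have "cj \<epsilon> = cnj" by (simp add: fun_eq_iff complex_eq_iff)
    then show ?thesis by simp
  qed
qed

text \<open>The inductive definition adds one generator at a time on the left. Here \<open>f\<close>
  lists the integer powers of the generator \<open>f 1\<close>, any of which can thus be added at
  once.\<close>

lemma generated_group_iterate:
  assumes S: "f 1 \<in> S" and f: "f 0 = id" "\<And>j. f (j + 1) = f 1 \<circ> f j" "\<And>j. f (j - 1) = inv (f 1) \<circ> f j"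
    and g: "g \<in> generated_group S"
  shows "f (j::int) \<circ> g \<in> generated_group S"
proof (induction j rule: int_induct[of _ 0])
  case base
  then show ?case using f(1) g by simp
next
  case (step1 j)
  then show ?case using generated_group.mult[OF S step1(2)] by (simp only: f(2)[of j] comp_assoc)
next
  case (step2 j)
  then show ?case using generated_group.inv_mult[OF S step2(2)] by (simp only: f(3)[of j] comp_assoc)
qed

locale inoue_warped = equivariant_warped +
  assumes \<alpha>_neq_1: "\<alpha> \<noteq> 1" and \<beta>_nonreal: "Im \<beta> \<noteq> 0"
begin

text \<open>By the mean value theorem a coincidence of values would produce a zero of
  \<open>k * a\<close>.\<close>

lemma inj_m: "inj m"
proof (rule linorder_injI)
  fix s t :: real assume "s < t"
  then obtain z where "m t - m s = (t - s) * (k * a z)"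
    using MVT2[of s t m "\<lambda>t. k * a t"] m_deriv by blast
  then show "m s \<noteq> m t" using \<open>s < t\<close> a_nonzero[of z] k_nonzero by auto
qed

text \<open>At the integers \<open>m\<close> takes the values \<open>\<alpha> powi n * m 0\<close>,
  which are arbitrarily large and arbitrarily close to 0 because \<open>\<alpha> \<noteq> 1\<close>;
  connectedness fills the gaps.\<close>

lemma range_m: "range m = {0<..}"
proof
  show "{0<..} \<subseteq> range m"
  proof
    fix s :: real assume "s \<in> {0<..}"
    then have s: "s > 0" by simp
    have m: "m (of_int n) = \<alpha> powi n * m 0" for n using shift_int[of m, OF m_shift, of 0] by simp
    obtain n where n: "s / m 0 < \<alpha> powi n" using ex_power_int_greater \<alpha>_pos \<alpha>_neq_1 by blast
    obtain n' where n': "m 0 / s < \<alpha> powi n'" using ex_power_int_greater \<alpha>_pos \<alpha>_neq_1 by blast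
    have "s \<le> m (of_int n)" using n m_pos[of 0] by (simp add: m field_simps)
    moreover have "m (of_int (- n')) \<le> s"
      using n' s \<alpha>_pos by (simp only: m power_int_minus) (simp add: field_simps)
    moreover have "connected (range m)"
      using m_deriv DERIV_isCont by (intro connected_continuous_image continuous_at_imp_continuous_on) auto
    ultimately show "s \<in> range m" using connectedD_interval by blast
  qed
qed (use m_pos in auto)

lemma m_inv: "m (inv m t) = t" if "t > 0"
  using that range_m by (intro f_inv_into_f) auto

lemma inv_m_differentiable: "inv m differentiable (at t)" if "t > 0"
proof -
  define s where "s = inv m t"
  \<comment> \<open>This form of the inverse function theorem asks for continuity of
    \<open>m\<close> and for its derivative at \<open>s\<close> only, which suits an
    \<open>a\<close> without regularity assumptions.\<close>
  have "((inv m) has_derivative (\<lambda>h. h / (k * a s))) (at (m s))"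
  proof (rule has_derivative_inverse_strong[where f = m and S = UNIV and x = s])
    show "continuous_on UNIV m"
      using m_deriv DERIV_isCont continuous_at_imp_continuous_on by blast
    show "(m has_derivative (*) (k * a s)) (at s)" using m_deriv by (simp add: has_field_derivative_def)
    show "(*) (k * a s) \<circ> (\<lambda>h. h / (k * a s)) = id" using a_nonzero k_nonzero by (auto simp: fun_eq_iff)
  qed (simp_all add: inv_f_f[OF inj_m])
  then show ?thesis using m_inv[OF that] unfolding s_def differentiable_def by auto
qed

section \<open>The identification of the universal cover with the half space\<close>

definition to_half_space :: "real \<Rightarrow> (real^3) \<times> real \<Rightarrow> complex \<times> complex" where
  "to_half_space \<epsilon> y = (of_real (k * (fst y - p) $ 1) + \<i> * of_real (m (snd y)), cj \<epsilon> (zc (fst y - p)))"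

definition from_half_space :: "real \<Rightarrow> complex \<times> complex \<Rightarrow> (real^3) \<times> real" where
  "from_half_space \<epsilon> q =
     (p + vector [Re (fst q) / k, Re (cj \<epsilon> (snd q)), Im (cj \<epsilon> (snd q))], inv m (Im (fst q)))"

lemma from_to_half_space:
  assumes "\<epsilon> * \<epsilon> = 1"
  shows "from_half_space \<epsilon> (to_half_space \<epsilon> y) = y"
  using k_nonzero
  by (simp add: from_half_space_def to_half_space_def cj_cj[OF assms] R31_eq_iff inv_f_f[OF inj_m] assms
      flip: mult.assoc)

lemma to_from_half_space:
  assumes "\<epsilon> * \<epsilon> = 1" "q \<in> half_space"
  shows "to_half_space \<epsilon> (from_half_space \<epsilon> q) = q"
proof -
  have "Im (fst q) > 0" using assms(2) by (auto simp: half_space_def)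
  moreover have "zc (vector [r, Re z, Im z]) = z" for r z by (simp add: complex_eq_iff)
  ultimately show ?thesis using k_nonzero
    by (simp add: from_half_space_def to_half_space_def m_inv cj_cj[OF assms(1)] prod_eq_iff complex_eq_iff
        del: cj_simps) (simp add: complex_eq_iff assms(1) flip: mult.assoc)
qed

lemma to_half_space_in: "to_half_space \<epsilon> y \<in> half_space"
  using m_pos by (simp add: to_half_space_def half_space_def)

lemma to_half_space_has_derivative:
  "(to_half_space \<epsilon> has_derivative
     (\<lambda>u. (of_real (k * fst u $ 1) + \<i> * of_real (k * a (snd y) * snd u), cj \<epsilon> (zc (fst u))))) (at y)"
proof -
  have "((\<lambda>y. k * (fst y - p) $ 1) has_derivative (\<lambda>u. k * fst u $ 1)) (at y)"
    by (auto intro!: derivative_eq_intros bounded_linear.has_derivative[OF bounded_linear_vec_nth])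
  moreover have "((\<lambda>y. m (snd y)) has_derivative (\<lambda>u. k * a (snd y) * snd u)) (at y)"
    by (rule has_derivative_snd_comp[OF m_deriv])
  moreover have "((\<lambda>y. cj \<epsilon> (zc (fst y - p))) has_derivative (\<lambda>u. cj \<epsilon> (zc (fst u)))) (at y)"
    by (auto intro!: derivative_eq_intros bounded_linear.has_derivative[OF bounded_linear_cj]
        bounded_linear.has_derivative[OF bounded_linear_zc] simp del: zc_diff)
  ultimately show ?thesis unfolding to_half_space_def
    by (rule has_derivative_Pair[OF has_derivative_add[OF
          bounded_linear.has_derivative[OF bounded_linear_of_real]
          has_derivative_mult_right[OF bounded_linear.has_derivative[OF bounded_linear_of_real]]]])
qed

text \<open>The first component has differential \<open>k (dx^1 + i a dt)\<close>, and precomposing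
  it with the complex structure multiplies it by \<open>i\<close>. On the plane, \<open>cj\<close>
  converts multiplication by \<open>\<epsilon> * \<i>\<close> into multiplication by
  \<open>\<i>\<close>.\<close>

lemma to_half_space_holomorphic:
  assumes "\<epsilon> * \<epsilon> = 1"
  shows "(of_real (k * fst (warped_J \<epsilon> a y u) $ 1) + \<i> * of_real (k * a (snd y) * snd (warped_J \<epsilon> a y u)),
      cj \<epsilon> (zc (fst (warped_J \<epsilon> a y u))))
    = (\<i> * (of_real (k * fst u $ 1) + \<i> * of_real (k * a (snd y) * snd u)), \<i> * cj \<epsilon> (zc (fst u)))"
  using a_nonzero[of "snd y"] by (simp add: complex_eq_iff assms flip: mult.assoc)

lemma from_half_space_differentiable: "from_half_space \<epsilon> differentiable (at q)" if "q \<in> half_space"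
proof -
  have im: "Im (fst q) > 0" using that by (auto simp: half_space_def)
  define h where "h q = (vector [Re (fst q) / k, Re (cj \<epsilon> (snd q)), Im (cj \<epsilon> (snd q))] :: real^3)" for q
  have "linear h"
    by (simp add: h_def linear_iff vec_eq_iff forall_3 add_divide_distrib algebra_simps)
  then have "h differentiable (at q)" by (rule linear_imp_differentiable)
  moreover have "(\<lambda>q :: complex \<times> complex. Im (fst q)) differentiable (at q)"
    by (rule linear_imp_differentiable) (simp add: linear_iff)
  then have "(inv m \<circ> (\<lambda>q :: complex \<times> complex. Im (fst q))) differentiable (at q)"
    using inv_m_differentiable[OF im] by (intro differentiable_chain_at)
  ultimately obtain A B where "(h has_derivative A) (at q)"
    "((\<lambda>q :: complex \<times> complex. inv m (Im (fst q))) has_derivative B) (at q)"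
    by (auto simp: differentiable_def o_def)
  then have "((\<lambda>q. (p + h q, inv m (Im (fst q)))) has_derivative (\<lambda>u. (0 + A u, B u))) (at q)"
    by (intro has_derivative_Pair has_derivative_add has_derivative_const)
  then show ?thesis unfolding from_half_space_def[abs_def] h_def differentiable_def by blast
qed

lemma open_half_space: "open half_space"
proof -
  have "half_space = {q. 0 < Im (fst q)}" by (auto simp: half_space_def)
  then show ?thesis by (rule ssubst) (intro open_Collect_less continuous_intros)
qed

section \<open>The deck group acting on the half space\<close>

definition affine_deck :: "real \<Rightarrow> int \<Rightarrow> real^3 \<Rightarrow> complex \<times> complex \<Rightarrow> complex \<times> complex" where
  "affine_deck \<epsilon> n l = (\<lambda>(w, z). (of_real (\<alpha> powi n) * w + of_real (k * l $ 1), cj \<epsilon> \<beta> powi n * z + cj \<epsilon> (zc l)))"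

text \<open>Measuring from \<open>p\<close> removes the translation part of the monodromy. The first
  coordinate and \<open>m\<close> have the same multiplier, so together they give a complex
  coordinate multiplied by a real number.\<close>

lemma to_half_space_deck:
  assumes "\<epsilon> * \<epsilon> = 1"
  shows "to_half_space \<epsilon> (deck n l y) = affine_deck \<epsilon> n l (to_half_space \<epsilon> y)"
proof -
  have "(fst (deck n l y) - p) $ 1 = \<alpha> powi n * (fst y - p) $ 1 + l $ 1"
    "zc (fst (deck n l y) - p) = \<beta> powi n * zc (fst y - p) + zc l"
    "m (snd (deck n l y)) = \<alpha> powi n * m (snd y)"
    by (simp_all add: deck_def iter_def shift_int[of m, OF m_shift])
  then show ?thesis
    unfolding to_half_space_def affine_deck_def
    by (simp add: cj_add cj_mult cj_power_int assms ring_distribs mult_ac del: zc_diff vector_minus_component)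
qed

lemma affine_deck_comp:
  assumes "\<epsilon> * \<epsilon> = 1"
  shows "affine_deck \<epsilon> n l \<circ> affine_deck \<epsilon> n' l' = affine_deck \<epsilon> (n + n') (dilp n l' + l)"
  using \<alpha>_pos \<beta>_nonzero assms
  by (auto simp: affine_deck_def fun_eq_iff power_int_add cj_add cj_mult cj_power_int[symmetric] algebra_simps)

lemma affine_deck_0: "affine_deck \<epsilon> 0 0 = id"
  by (auto simp: affine_deck_def complex_eq_iff)

lemma inv_affine_deck:
  assumes "\<epsilon> * \<epsilon> = 1"
  shows "inv (affine_deck \<epsilon> n l) = affine_deck \<epsilon> (- n) (- dilp (- n) l)"
proof (rule inv_equality)
  have z: "- dilp n v = dilp n (- v)" for n v using dil_diff[of _ _ 0] by simp
  show "affine_deck \<epsilon> (- n) (- dilp (- n) l) (affine_deck \<epsilon> n l q) = q" for q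
    using fun_cong[OF affine_deck_comp[OF assms, of "- n" "- dilp (- n) l" n l], of q]
    by (simp add: affine_deck_0)
  show "affine_deck \<epsilon> n l (affine_deck \<epsilon> (- n) (- dilp (- n) l) q) = q" for q
    using fun_cong[OF affine_deck_comp[OF assms, of n l "- n" "- dilp (- n) l"], of q]
    by (simp only: z dilp_dilp o_apply) (simp add: affine_deck_0)
qed

text \<open>A zero row of \<open>L\<close> would make a diagonal entry of
  \<open>L ** matrix_inv L\<close> vanish. This shows that the eigenvectors in the Inoue data are
  nonzero.\<close>

lemma row_nonzero: "\<exists>i. column i L $ j \<noteq> 0"
proof (rule ccontr)
  assume "\<nexists>i. column i L $ j \<noteq> 0"
  then have "(L ** matrix_inv L) $ j $ j = 0"
    by (simp add: column_nth matrix_matrix_mult_def)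
  then show False using invertible_matrix_inv[OF invertible] by (simp add: mat_def)
qed

text \<open>With \<open>inoue_s\<close>, the translations of the half space coordinates by the
  lattice basis; the factor \<open>k\<close> is that of \<open>to_half_space\<close>.\<close>

definition inoue_r :: "real^3" where "inoue_r = (\<chi> i. k * column i L $ 1)"

definition inoue_s :: "real \<Rightarrow> complex^3" where "inoue_s \<epsilon> = (\<chi> i. cj \<epsilon> (zc (column i L)))"

text \<open>Expanding the dilated basis vectors in the lattice basis yields an integer matrix
  \<open>T\<close>. Its first-coordinate and \<open>zc\<close> components are the two eigenvector
  equations.\<close>

lemma inoue_data_exists:
  assumes \<epsilon>: "\<epsilon> * \<epsilon> = 1" and e: "e = 1 \<or> e = -1" and gt: "\<alpha> powi e > 1"
  shows "\<exists>T. inoue_data T (\<alpha> powi e) (cj \<epsilon> \<beta> powi e) inoue_r (inoue_s \<epsilon>)"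
proof -
  have "\<exists>N::int^3. dilp e (column i L) = L *v (\<chi> j. of_int (N $ j))" for i
    using dilp_in_lattice[OF column_in_lattice] by (auto simp: lattice_def)
  then obtain N :: "3 \<Rightarrow> int^3" where N: "\<And>i. dilp e (column i L) = L *v (\<chi> j. of_int (N i $ j))"
    by metis
  define T where "T = (\<chi> i. N i)"
  have T: "dilp e (column i L) = (\<Sum>j\<in>UNIV. of_int (T $ i $ j) *\<^sub>R column j L)" for i
    unfolding N matrix_mult_sum T_def by (simp add: scalar_mult_eq_scaleR)
  have T1: "\<alpha> powi e * column i L $ 1 = (\<Sum>j\<in>UNIV. of_int (T $ i $ j) * column j L $ 1)" for i
    using arg_cong[OF T[of i], of "\<lambda>x. x $ 1"] by (simp add: sum_component)
  have zc_sum: "zc (\<Sum>j\<in>UNIV. f j) = (\<Sum>j\<in>UNIV. zc (f j))" for f :: "3 \<Rightarrow> real^3"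
    by (simp add: sum_3)
  have Tz: "\<beta> powi e * zc (column i L) = (\<Sum>j\<in>UNIV. of_int (T $ i $ j) * zc (column j L))" for i
    using arg_cong[OF T[of i], of zc]
    unfolding zc_sum zc_scaleR zc_dil unfolding scaleR_conv_of_real
    by simp
  define TR :: "real^3^3" where "TR = (\<chi> i j. of_int (T $ i $ j))"
  define A B where "A = \<alpha> powi e" and "B = \<beta> powi e"
  define MA where "MA = dil_matrix A B"
  \<comment> \<open>\<open>L\<close> conjugates the transpose of \<open>T\<close> to the matrix of
    the dilation, whose determinant is 1 by the volume relation.\<close>
  have "(L ** transpose TR) $ q $ i = (MA ** L) $ q $ i" for q i
  proof -
    have "(MA ** L) $ q $ i = (MA *v column i L) $ q"
      by (simp add: matrix_matrix_mult_def matrix_vector_mult_def column_def)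
    also have "\<dots> = (L ** transpose TR) $ q $ i"
      unfolding MA_def dil_matrix_mult unfolding A_def B_def N
      by (simp add: matrix_matrix_mult_def matrix_vector_mult_def transpose_def TR_def T_def)
    finally show ?thesis by simp
  qed
  then have "L ** transpose TR = MA ** L" by (simp add: vec_eq_iff)
  then have "det L * det TR = det MA * det L" by (metis det_mul det_transpose)
  moreover have "det MA = 1"
    using volume_int[of e] by (simp add: MA_def det_dil_matrix A_def B_def)
  moreover have "det L \<noteq> 0" using invertible invertible_det_nz by blast
  ultimately have "det TR = 1" by simp
  moreover have "det TR = of_int (det T)" by (simp add: TR_def det_3)
  ultimately have "det T = 1" by simp
  moreover have "Im (cj \<epsilon> \<beta> powi e) \<noteq> 0"
    using e \<beta>_nonreal \<epsilon> by (auto simp: complex_inverse power_int_minus complex_neq_0[symmetric])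
  moreover have "inoue_r \<noteq> 0"
    using row_nonzero[of 1] k_nonzero by (auto simp: inoue_r_def vec_eq_iff)
  moreover have "inoue_s \<epsilon> \<noteq> 0"
    using row_nonzero[of 2] by (auto simp: inoue_s_def vec_eq_iff complex_eq_iff)
  moreover have "(\<chi> i j. of_int (T $ i $ j)) *v inoue_r = \<alpha> powi e *s inoue_r"
    using T1 by (simp add: inoue_r_def vec_eq_iff matrix_vector_mult_def mult.left_commute[of _ k]
        flip: sum_distrib_left)
  moreover have "(\<chi> i j. of_int (T $ i $ j)) *v inoue_s \<epsilon> = cj \<epsilon> \<beta> powi e *s inoue_s \<epsilon>"
  proof -
    have "cj \<epsilon> \<beta> powi e * cj \<epsilon> (zc (column i L)) = (\<Sum>j\<in>UNIV. of_int (T $ i $ j) * cj \<epsilon> (zc (column j L)))" for i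
    proof -
      have cj_int: "cj \<epsilon> (of_int n * z) = of_int n * cj \<epsilon> z" for n z
        using cj_scaleR[of \<epsilon> "of_int n" z] unfolding scaleR_conv_of_real by simp
      have cj_sum: "cj \<epsilon> (\<Sum>j\<in>UNIV. f j) = (\<Sum>j\<in>UNIV. cj \<epsilon> (f j))" for f :: "3 \<Rightarrow> complex"
        by (simp add: sum_3 cj_add)
      show ?thesis
        using arg_cong[OF Tz[of i], of "cj \<epsilon>"]
        unfolding cj_sum cj_int cj_mult[OF \<epsilon>, of "\<beta> powi e"] cj_power_int[OF \<epsilon>] .
    qed
    then show ?thesis by (simp add: inoue_s_def vec_eq_iff matrix_vector_mult_def)
  qed
  ultimately show ?thesis using gt unfolding inoue_data_def by blast
qed

text \<open>The right-hand side contains the generators and is closed under composition and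
  inverses. Conversely, each of its elements is a product of basis translations applied after a
  power of the first generator.\<close>

lemma inoue_group_eq:
  assumes \<epsilon>: "\<epsilon> * \<epsilon> = 1" and e: "e = 1 \<or> e = -1"
  shows "inoue_group (\<alpha> powi e) (cj \<epsilon> \<beta> powi e) inoue_r (inoue_s \<epsilon>) = {affine_deck \<epsilon> n l | n l. l \<in> lattice L}"
proof -
  let ?S = "insert (affine_deck \<epsilon> e 0) (range (\<lambda>i. affine_deck \<epsilon> 0 (column i L)))"
  have "(\<lambda>(w, z). (of_real (\<alpha> powi e) * w, cj \<epsilon> \<beta> powi e * z)) = affine_deck \<epsilon> e 0"
    by (auto simp: affine_deck_def fun_eq_iff complex_eq_iff)
  moreover have "(\<lambda>(w, z). (w + of_real (inoue_r $ i), z + inoue_s \<epsilon> $ i)) = affine_deck \<epsilon> 0 (column i L)" for i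
    by (auto simp: affine_deck_def fun_eq_iff inoue_r_def inoue_s_def)
  ultimately have gg: "inoue_group (\<alpha> powi e) (cj \<epsilon> \<beta> powi e) inoue_r (inoue_s \<epsilon>) = generated_group ?S"
    unfolding inoue_group_def by simp
  let ?H = "{affine_deck \<epsilon> n l | n l. l \<in> lattice L}"
  have compH: "g \<circ> h \<in> ?H" if "g \<in> ?H" "h \<in> ?H" for g h
  proof -
    from that obtain n l n' l' where *: "g = affine_deck \<epsilon> n l" "h = affine_deck \<epsilon> n' l'" "l \<in> lattice L" "l' \<in> lattice L"
      by blast
    then have "dilp n l' + l \<in> lattice L" by (intro lattice_add dilp_in_lattice)
    then show ?thesis using * affine_deck_comp[OF \<epsilon>] by blast
  qed
  have invH: "inv g \<in> ?H" if "g \<in> ?H" for g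
  proof -
    from that obtain n l where *: "g = affine_deck \<epsilon> n l" "l \<in> lattice L" by blast
    then have "- dilp (- n) l \<in> lattice L" by (intro lattice_minus dilp_in_lattice)
    then show ?thesis using * inv_affine_deck[OF \<epsilon>] by blast
  qed
  have S: "?S \<subseteq> ?H" using column_in_lattice zero_in_lattice by blast
  have "h \<in> ?H" if "h \<in> generated_group ?S" for h
    using that
  proof induction
    case one
    have "affine_deck \<epsilon> 0 0 \<in> ?H" using zero_in_lattice by blast
    then show ?case by (simp only: affine_deck_0)
  next
    case (mult g h)
    then show ?case using compH[OF subsetD[OF S mult(1)] mult(3)] by blast
  next
    case (inv_mult g h)
    then show ?case using compH[OF invH[OF subsetD[OF S inv_mult(1)]] inv_mult(3)] by blast
  qed
  moreover have "affine_deck \<epsilon> n l \<in> generated_group ?S" if l: "l \<in> lattice L" for n l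
  proof -
    have rot: "affine_deck \<epsilon> n 0 \<in> generated_group ?S"
    proof -
      \<comment> \<open>The first generator has exponent \<open>e\<close>. As
        \<open>e * e = 1\<close>, exponent \<open>n\<close> is reached by its power
        \<open>e * n\<close>.\<close>
      have "affine_deck \<epsilon> (e * (e * n)) 0 \<circ> id \<in> generated_group ?S"
        by (rule generated_group_iterate[where f = "\<lambda>j. affine_deck \<epsilon> (e * j) 0"])
          (auto simp: affine_deck_comp[OF \<epsilon>] inv_affine_deck[OF \<epsilon>] affine_deck_0 algebra_simps
            intro: generated_group.one)
      moreover have "e * (e * n) = n" using e by auto
      ultimately show ?thesis by simp
    qed
    have trans: "affine_deck \<epsilon> 0 (of_int j *\<^sub>R column i L) \<circ> g \<in> generated_group ?S"
      if "g \<in> generated_group ?S" for i j g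
      by (rule generated_group_iterate[where f = "\<lambda>j. affine_deck \<epsilon> 0 (of_int j *\<^sub>R column i L)"])
        (use that in \<open>auto simp: affine_deck_comp[OF \<epsilon>] inv_affine_deck[OF \<epsilon>] affine_deck_0 algebra_simps\<close>)
    obtain j :: "int^3" where j: "l = (\<Sum>i\<in>UNIV. of_int (j $ i) *\<^sub>R column i L)"
      using l by (auto simp: lattice_def matrix_mult_sum scalar_mult_eq_scaleR)
    have "affine_deck \<epsilon> n l = affine_deck \<epsilon> 0 (of_int (j $ 1) *\<^sub>R column 1 L) \<circ>
        (affine_deck \<epsilon> 0 (of_int (j $ 2) *\<^sub>R column 2 L) \<circ>
        (affine_deck \<epsilon> 0 (of_int (j $ 3) *\<^sub>R column 3 L) \<circ> affine_deck \<epsilon> n 0))"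
      by (simp add: affine_deck_comp[OF \<epsilon>] j sum_3 algebra_simps)
    then show ?thesis using trans rot by simp
  qed
  ultimately show ?thesis unfolding gg by blast
qed

theorem biholomorphic_to_Inoue_warped:
  assumes \<epsilon>: "\<epsilon> * \<epsilon> = 1"
  shows "biholomorphic_to_Inoue_SM (mapping_torus L \<rho>) (mapping_torus_atlas L \<rho>) (\<lambda>c. warped_J \<epsilon> a)"
proof -
  \<comment> \<open>An Inoue surface requires a multiplier greater than 1, so for \<open>\<alpha> < 1\<close> the inverse of the
     monodromy is used as generator.\<close>
  define e :: int where "e = (if \<alpha> > 1 then 1 else - 1)"
  have e: "e = 1 \<or> e = -1" by (simp add: e_def)
  have "\<alpha> powi e > 1"
    using \<alpha>_pos \<alpha>_neq_1 by (auto simp: e_def power_int_minus one_less_inverse_iff)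
  from inoue_data_exists[OF \<epsilon> e this] obtain T
    where T: "inoue_data T (\<alpha> powi e) (cj \<epsilon> \<beta> powi e) inoue_r (inoue_s \<epsilon>)" by blast
  let ?\<pi> = "mapping_torus_proj L \<rho>"
  let ?\<pi>' = "inoue_proj (\<alpha> powi e) (cj \<epsilon> \<beta> powi e) inoue_r (inoue_s \<epsilon>)"
  \<comment> \<open>Inoue orbits are the images of deck orbits under an injective map, so equality
    of the former is equality of the latter.\<close>
  have orbit: "?\<pi>' (to_half_space \<epsilon> y) = to_half_space \<epsilon> ` {y'. ?\<pi> y = ?\<pi> y'}" for y
  proof -
    have "?\<pi>' (to_half_space \<epsilon> y) = {affine_deck \<epsilon> n l (to_half_space \<epsilon> y) | n l. l \<in> lattice L}"
      unfolding inoue_proj_def inoue_group_eq[OF \<epsilon> e] by blast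
    also have "\<dots> = {to_half_space \<epsilon> (deck n l y) | n l. l \<in> lattice L}"
      by (simp only: to_half_space_deck[OF \<epsilon>])
    also have "\<dots> = to_half_space \<epsilon> ` {y'. ?\<pi> y = ?\<pi> y'}"
      unfolding mapping_torus_proj_eq_iff deck_group_def by blast
    finally show ?thesis .
  qed
  have inj: "inj (to_half_space \<epsilon>)"
    using from_to_half_space[OF \<epsilon>] by (metis injI)
  have "biholomorphic (?\<pi> ` UNIV) (quotient_atlas UNIV ?\<pi>) (\<lambda>c. warped_J \<epsilon> a)
      (?\<pi>' ` half_space) (quotient_atlas half_space ?\<pi>') (\<lambda>c x u. (\<i> * fst u, \<i> * snd u))"
  proof (rule biholomorphic_quotient[where F = "to_half_space \<epsilon>" and G = "from_half_space \<epsilon>",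
        OF open_UNIV open_half_space _ _ to_half_space_has_derivative])
    show "?\<pi> x = ?\<pi> y \<longleftrightarrow> ?\<pi>' (to_half_space \<epsilon> x) = ?\<pi>' (to_half_space \<epsilon> y)" for x y
      unfolding orbit inj_image_eq_iff[OF inj] by blast
  qed (use from_to_half_space[OF \<epsilon>] to_from_half_space[OF \<epsilon>] to_half_space_in
      from_half_space_differentiable to_half_space_holomorphic[OF \<epsilon>] in auto)
  then have "biholomorphic (mapping_torus L \<rho>) (mapping_torus_atlas L \<rho>) (\<lambda>c. warped_J \<epsilon> a)
      (?\<pi>' ` half_space) (quotient_atlas half_space ?\<pi>') std_J"
    by (simp add: mapping_torus_def mapping_torus_atlas_def std_J_def[abs_def])
  then show ?thesis unfolding biholomorphic_to_Inoue_SM_def using T by blast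
qed

end

section \<open>The lift of the monodromy\<close>

lemma trace_dil_matrix: "trace (dil_matrix A B) = A + 2 * Re B"
  by (simp add: dil_matrix_def trace_def sum_3)

text \<open>In the lattice basis the map has an integer matrix, and determinant and trace do not
  depend on the basis.\<close>

lemma dil_matrix_integral:
  assumes L: "invertible L" and sub: "dil A B ` lattice L \<subseteq> lattice L"
  shows "det (dil_matrix A B) \<in> \<int>" "trace (dil_matrix A B) \<in> \<int>"
proof -
  let ?N = "matrix_inv L ** dil_matrix A B ** L"
  have "?N $ i $ j \<in> \<int>" for i j
  proof -
    have "column j ?N = matrix_inv L *v dil A B (column j L)"
      by (metis dil_matrix_mult matrix_vector_mul_assoc matrix_vector_mult_basis)
    moreover have "dil A B (column j L) \<in> lattice L" using sub column_in_lattice by blast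
    ultimately have "column j ?N $ i \<in> \<int>" using lattice_iff[OF L] by metis
    then show ?thesis by (simp add: column_nth)
  qed
  then have "det ?N \<in> \<int>" "trace ?N \<in> \<int>" by (auto simp: det_3 trace_def sum_3)
  moreover have "det ?N = det (dil_matrix A B)"
  proof -
    have "det (matrix_inv L) * det L = 1"
      using invertible_matrix_inv[OF L] by (metis det_mul det_I)
    then show ?thesis by (simp add: det_mul mult.assoc mult.left_commute)
  qed
  moreover have "trace ?N = trace (dil_matrix A B)"
    using trace_mul_sym[of "matrix_inv L ** dil_matrix A B" L] invertible_matrix_inv[OF L]
    by (simp add: matrix_mul_assoc)
  ultimately show "det (dil_matrix A B) \<in> \<int>" "trace (dil_matrix A B) \<in> \<int>" by simp_all
qed

text \<open>The rational root theorem for a monic integral cubic with constant term -1: numerator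
  and denominator are coprime, yet each divides the cube of the other, so both are units.\<close>

lemma rational_unit_root:
  assumes "r \<in> \<rat>" "\<tau> \<in> \<int>" "\<sigma> \<in> \<int>" "r * (r\<^sup>2 - \<tau> * r + \<sigma>) = (1::real)"
  shows "r\<^sup>2 = 1"
proof -
  obtain P Q :: int where PQ: "Q > 0" "coprime P Q" "r = of_int P / of_int Q"
    using assms(1) by (rule Rats_cases')
  obtain t s :: int where ts: "\<tau> = of_int t" "\<sigma> = of_int s" using assms(2,3) by (auto elim!: Ints_cases)
  have "of_int P * ((of_int P)\<^sup>2 - of_int t * of_int P * of_int Q + of_int s * (of_int Q)\<^sup>2) = (of_int Q :: real)^3"
    using assms(4) PQ(1) unfolding PQ(3) ts by (simp add: field_simps power2_eq_square power3_eq_cube)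
  then have "of_int (P * (P\<^sup>2 - t * P * Q + s * Q\<^sup>2)) = (of_int (Q ^ 3) :: real)" by simp
  then have eq: "P * (P\<^sup>2 - t * P * Q + s * Q\<^sup>2) = Q ^ 3" by (simp only: of_int_eq_iff)
  then have "P dvd Q ^ 3" by (metis dvd_triv_left)
  moreover have "coprime P (Q ^ 3)" using PQ(2) by simp
  ultimately have "P dvd 1" by (metis coprime_absorb_left)
  have "P ^ 3 = Q * (Q\<^sup>2 + t * P\<^sup>2 - s * P * Q)"
    using eq by (simp add: algebra_simps power2_eq_square power3_eq_cube)
  then have "Q dvd P ^ 3" by (metis dvd_triv_left)
  moreover have "coprime Q (P ^ 3)" using PQ(2) by (simp add: coprime_commute)
  ultimately have "Q dvd 1" by (metis coprime_absorb_left)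
  then have "Q = 1" using PQ(1) by simp
  moreover have "P = 1 \<or> P = -1" using \<open>P dvd 1\<close> by auto
  ultimately show ?thesis using PQ(3) by auto
qed

text \<open>The inverse map preserves the lattice as well, so the determinant and its inverse are
  both positive integers.\<close>

lemma dil_lattice_volume:
  assumes L: "invertible L" and img: "dil \<alpha> \<beta> ` lattice L = lattice L" and "\<alpha> > 0" "\<beta> \<noteq> 0"
  shows "\<alpha> * (cmod \<beta>)\<^sup>2 = 1"
    and "dil (inverse \<alpha>) (inverse \<beta>) ` lattice L \<subseteq> lattice L"
proof -
  have inv_dil: "dil (inverse \<alpha>) (inverse \<beta>) (dil \<alpha> \<beta> x) = x" for x using assms(3,4) by simp
  show inv: "dil (inverse \<alpha>) (inverse \<beta>) ` lattice L \<subseteq> lattice L"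
  proof (rule image_subsetI)
    fix x assume "x \<in> lattice L"
    then obtain y where "y \<in> lattice L" "x = dil \<alpha> \<beta> y" using img by blast
    then show "dil (inverse \<alpha>) (inverse \<beta>) x \<in> lattice L" by (simp only: inv_dil)
  qed
  define d where "d = \<alpha> * (cmod \<beta>)\<^sup>2"
  have "d > 0" using assms(3,4) by (simp add: d_def)
  have "d \<in> \<int>" "inverse d \<in> \<int>"
    using dil_matrix_integral(1)[OF L, of \<alpha> \<beta>] dil_matrix_integral(1)[OF L inv] img
    by (simp_all add: d_def det_dil_matrix norm_inverse power_inverse)
  have ge: "x \<ge> 1" if "x \<in> \<int>" "x > 0" for x :: real
    using that by (auto elim!: Ints_cases)
  have "d \<ge> 1" "inverse d \<ge> 1" using \<open>d \<in> \<int>\<close> \<open>inverse d \<in> \<int>\<close> \<open>d > 0\<close> by (auto intro!: ge)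
  then have "d = 1" using \<open>d > 0\<close> by (simp add: one_le_inverse_iff)
  then show "\<alpha> * (cmod \<beta>)\<^sup>2 = 1" by (simp add: d_def)
qed

text \<open>A real \<open>\<beta>\<close> would be a double root of the integral characteristic polynomial
  \<open>x\<^sup>3 - \<tau>x\<^sup>2 + \<sigma>x - 1\<close>, hence rational, hence \<open>\<plusminus>1\<close>.\<close>

lemma dil_lattice_nonreal:
  assumes L: "invertible L" and img: "dil \<alpha> \<beta> ` lattice L = lattice L" and pos: "\<alpha> > 0" "\<beta> \<noteq> 0"
    and "\<alpha> \<noteq> 1"
  shows "Im \<beta> \<noteq> 0"
proof
  assume im: "Im \<beta> = 0"
  define r where "r = Re \<beta>"
  have \<beta>: "\<beta> = of_real r" using im by (simp add: r_def complex_eq_iff)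
  have r0: "r \<noteq> 0" using pos(2) \<beta> by auto
  have vol: "\<alpha> * r\<^sup>2 = 1" using dil_lattice_volume(1)[OF L img pos] by (simp add: \<beta>)
  define \<tau> \<sigma> where "\<tau> = \<alpha> + 2 * r" and "\<sigma> = r\<^sup>2 + 2 * \<alpha> * r"
  have "\<tau> \<in> \<int>" using dil_matrix_integral(2)[OF L, of \<alpha> \<beta>] img by (simp add: trace_dil_matrix \<tau>_def r_def)
  have "inverse \<alpha> = r\<^sup>2" "inverse r = \<alpha> * r"
    using vol pos(1) r0 by (simp_all add: field_simps power2_eq_square)
  \<comment> \<open>By the volume relation \<open>\<sigma>\<close> is the trace of the inverse map,
    to which the integrality of traces applies too.\<close>
  then have "\<sigma> = inverse \<alpha> + 2 * Re (inverse \<beta>)" by (simp add: \<sigma>_def \<beta> flip: of_real_inverse)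
  then have "\<sigma> \<in> \<int>"
    using dil_matrix_integral(2)[OF L dil_lattice_volume(2)[OF L img pos]] by (simp add: trace_dil_matrix)
  have "\<alpha> \<noteq> r"
  proof
    assume "\<alpha> = r"
    then have "\<alpha> ^ 3 = 1" using vol by (simp add: power3_eq_cube power2_eq_square)
    then have "\<alpha> = 1" using pos(1) power_eq_imp_eq_base[of \<alpha> 3 1] by simp
    then show False using assms(5) by simp
  qed
  \<comment> \<open>These two identities express the double root \<open>r\<close> as a rational
    function of \<open>\<tau>\<close> and \<open>\<sigma>\<close>; the denominator is nonzero
    because \<open>\<alpha>\<close> differs from \<open>r\<close>.\<close>
  moreover have "\<tau>\<^sup>2 - 3 * \<sigma> = (\<alpha> - r)\<^sup>2" by (simp add: \<tau>_def \<sigma>_def power2_eq_square algebra_simps)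
  moreover have "\<tau> * \<sigma> - 9 = 2 * r * (\<alpha> - r)\<^sup>2"
    using vol unfolding \<tau>_def \<sigma>_def by algebra
  ultimately have "r = (\<tau> * \<sigma> - 9) / (2 * (\<tau>\<^sup>2 - 3 * \<sigma>))" by simp
  moreover have "\<tau> \<in> \<rat>" "\<sigma> \<in> \<rat>" using \<open>\<tau> \<in> \<int>\<close> \<open>\<sigma> \<in> \<int>\<close> Ints_subset_Rats by auto
  ultimately have "r \<in> \<rat>" by simp
  moreover have "r * (r\<^sup>2 - \<tau> * r + \<sigma>) = 1" using vol unfolding \<tau>_def \<sigma>_def by algebra
  ultimately have "r\<^sup>2 = 1" using rational_unit_root \<open>\<tau> \<in> \<int>\<close> \<open>\<sigma> \<in> \<int>\<close> by blast
  then show False using vol assms(5) by simp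
qed

section \<open>Affine lifts of torus diffeomorphisms\<close>

lemma torus_atlas_cover:
  assumes L: "invertible L"
  shows "\<exists>c\<in>torus_atlas L. x \<in> fst c"
proof -
  define V where "V = {y. \<forall>i. \<bar>(matrix_inv L *v (y - x)) $ i\<bar> < 1/2}"
  have "open V" unfolding V_def forall_3
    by (intro open_Collect_conj open_Collect_less continuous_intros
          bounded_linear.continuous_on[OF matrix_vector_mul_bounded_linear])
  moreover have "inj_on (torus_proj L) V"
  proof (rule inj_onI)
    fix u v assume uv: "u \<in> V" "v \<in> V" "torus_proj L u = torus_proj L v"
    have "v - u = 0"
    proof (rule lattice_small_eq_0[OF L])
      show "v - u \<in> lattice L" using uv(3) by (simp add: torus_proj_eq_iff)
      fix i
      have "matrix_inv L *v (v - u) = matrix_inv L *v (v - x) - matrix_inv L *v (u - x)"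
        by (simp add: matrix_vector_mult_diff_distrib)
      moreover have "\<bar>(matrix_inv L *v (v - x)) $ i\<bar> < 1/2" "\<bar>(matrix_inv L *v (u - x)) $ i\<bar> < 1/2"
        using uv(1,2) unfolding V_def by auto
      ultimately show "\<bar>(matrix_inv L *v (v - u)) $ i\<bar> < 1" by simp
    qed
    then show "u = v" by simp
  qed
  ultimately have "(V, torus_proj L) \<in> torus_atlas L" by (auto simp: torus_atlas_def quotient_atlas_def)
  moreover have "x \<in> V" by (simp add: V_def)
  ultimately show ?thesis by (intro bexI[of _ "(V, torus_proj L)"]) auto
qed

text \<open>In charts \<open>\<rho>\<close> differs from \<open>A\<close> by a local constant,
  determined only modulo the lattice. The coset \<open>q\<close> of all such constants is locally
  constant in the point, hence constant since the covering space is connected.\<close>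

lemma constant_differential_lift:
  assumes L: "invertible L"
    and smooth: "smooth_map (torus_atlas L) (torus_atlas L) \<rho>"
    and A: "bounded_linear A"
    and diff: "\<And>c d x. c \<in> torus_atlas L \<Longrightarrow> d \<in> torus_atlas L \<Longrightarrow> x \<in> local_dom c d \<rho> \<Longrightarrow> differential c d \<rho> x = A"
  obtains v where "\<And>x. \<rho> (torus_proj L x) = torus_proj L (A x + v)"
proof -
  define q where "q y = {v. \<rho> (torus_proj L y) = torus_proj L (A y + v)}" for y
  have local: "\<exists>r>0. \<exists>v. \<forall>y\<in>ball x r. q y = {w. w - v \<in> lattice L}" for x
  proof -
    obtain c where c: "c \<in> torus_atlas L" "x \<in> fst c" using torus_atlas_cover[OF L] by blast
    with smooth obtain d X where d: "d \<in> torus_atlas L" "open X" "x \<in> X" "X \<subseteq> local_dom c d \<rho>"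
      "smooth_on X (local_map c d \<rho>)" unfolding smooth_map_def by blast
    obtain r where r: "r > 0" "ball x r \<subseteq> X" using d(2,3) openE by blast
    have pr: "snd c = torus_proj L" "snd d = torus_proj L" "inj_on (torus_proj L) (fst d)"
      using c(1) d(1) by (auto simp: torus_atlas_def quotient_atlas_def)
    have "((\<lambda>y. local_map c d \<rho> y - A y) has_derivative (\<lambda>h. 0)) (at y within ball x r)" if "y \<in> ball x r" for y
    proof -
      have y: "y \<in> X" "y \<in> local_dom c d \<rho>" using that r(2) d(4) by auto
      have "frechet_derivative (local_map c d \<rho>) (at y) = A"
        using diff[OF c(1) d(1) y(2)] by (simp add: differential_def)
      then have "(local_map c d \<rho> has_derivative A) (at y)"
        using smooth_on_imp_differentiable[OF d(2,5) y(1)] by (simp add: frechet_derivative_works)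
      from has_derivative_diff[OF this bounded_linear_imp_has_derivative[OF A]] show ?thesis
        by (simp add: has_derivative_at_withinI)
    qed
    then obtain v where v: "\<And>y. y \<in> ball x r \<Longrightarrow> local_map c d \<rho> y - A y = v"
      using has_derivative_zero_constant[OF convex_ball, of x r "\<lambda>y. local_map c d \<rho> y - A y"] by blast
    have "\<rho> (torus_proj L y) = torus_proj L (A y + v)" if "y \<in> ball x r" for y
    proof -
      have "\<rho> (torus_proj L y) \<in> torus_proj L ` fst d"
        using that r(2) d(4) pr by (auto simp: local_dom_def)
      then have "torus_proj L (local_map c d \<rho> y) = \<rho> (torus_proj L y)"
        using f_the_inv_into_f[OF pr(3)] by (simp add: local_map_def coords_def pr)
      moreover have "local_map c d \<rho> y = A y + v" using v[OF that] by (simp add: algebra_simps)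
      ultimately show ?thesis by simp
    qed
    then have "q y = {w. w - v \<in> lattice L}" if "y \<in> ball x r" for y
      using that by (simp add: q_def torus_proj_eq_iff)
    then show ?thesis using r(1) by blast
  qed
  have "\<forall>x\<in>UNIV. eventually (\<lambda>y. q x = q y) (at x within UNIV)"
  proof
    fix x
    obtain r v where r: "r > 0" "\<forall>y\<in>ball x r. q y = {w. w - v \<in> lattice L}" using local by blast
    then have "\<forall>y\<in>ball x r. q x = q y" by simp
    then show "eventually (\<lambda>y. q x = q y) (at x within UNIV)"
      using r(1) unfolding eventually_at by (intro exI[of _ r]) (simp add: dist_commute)
  qed
  then have const: "q x = q 0" for x
    using connected_local_const[OF connected_UNIV, of x 0 q] by blast
  obtain r v where "r > 0" "\<forall>y\<in>ball 0 r. q y = {w. w - v \<in> lattice L}" using local[of 0] by blast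
  then have "v \<in> q 0" by simp
  then have "v \<in> q x" for x using const by blast
  then show ?thesis using that unfolding q_def by blast
qed

text \<open>A vector is sent into the lattice exactly when \<open>\<rho>\<close> identifies the
  classes of 0 and of the vector, so injectivity of \<open>\<rho>\<close> reflects membership; the
  inverse dilation then shows that every lattice vector is reached.\<close>

lemma lattice_image_of_lift:
  assumes bij: "bij_betw \<rho> (torus L) (torus L)"
    and lift: "\<And>x. \<rho> (torus_proj L x) = torus_proj L (dil \<alpha> \<beta> x + v)" and nz: "\<alpha> \<noteq> 0" "\<beta> \<noteq> 0"
  shows "dil \<alpha> \<beta> ` lattice L = lattice L"
proof -
  have iff: "dil \<alpha> \<beta> x \<in> lattice L \<longleftrightarrow> x \<in> lattice L" for x
  proof -
    have "dil \<alpha> \<beta> x \<in> lattice L \<longleftrightarrow> \<rho> (torus_proj L 0) = \<rho> (torus_proj L x)"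
      by (simp add: lift torus_proj_eq_iff)
    also have "\<dots> \<longleftrightarrow> torus_proj L 0 = torus_proj L x"
      using bij by (auto simp: bij_betw_def torus_def inj_on_def)
    finally show ?thesis by (simp add: torus_proj_eq_iff)
  qed
  have inv: "dil \<alpha> \<beta> (dil (inverse \<alpha>) (inverse \<beta>) x) = x" for x using nz by simp
  have "dil (inverse \<alpha>) (inverse \<beta>) x \<in> lattice L" if "x \<in> lattice L" for x
    using iff[of "dil (inverse \<alpha>) (inverse \<beta>) x"] that unfolding inv by simp
  then show ?thesis using iff inv by (metis image_eqI image_subsetI subset_antisym subsetI)
qed

section \<open>The induced coframe\<close>

lemma coframe_1: "coframe a1 b2 b3 1 t u = u $ 1 / a1 t"
  by (simp add: coframe_def)

text \<open>In complex notation the second and third forms combine to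
  \<open>e^2 + i e^3 = dz / b\<close>.\<close>

lemma coframe_23:
  assumes "Complex (b2 t) (b3 t) \<noteq> 0"
  shows "coframe a1 b2 b3 2 t u = Re (zc u / Complex (b2 t) (b3 t))"
    and "coframe a1 b2 b3 3 t u = Im (zc u / Complex (b2 t) (b3 t))"
  using assms by (simp_all add: coframe_def lfun_def Re_divide Im_divide complex_eq_iff
      add_divide_distrib diff_divide_distrib mult.commute)

lemma frame_components:
  "frame a1 b2 b3 1 t $ 1 = a1 t" "zc (frame a1 b2 b3 1 t) = 0"
  "frame a1 b2 b3 2 t $ 1 = 0" "zc (frame a1 b2 b3 2 t) = Complex (b2 t) (b3 t)"
  "frame a1 b2 b3 3 t $ 1 = 0" "zc (frame a1 b2 b3 3 t) = \<i> * Complex (b2 t) (b3 t)"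
  by (simp_all add: frame_def complex_eq_iff)

lemma lfun_eq: "lfun b2 b3 t = (cmod (Complex (b2 t) (b3 t)))\<^sup>2"
  by (simp add: lfun_def cmod_power2)

lemma admissible_nonzero:
  assumes "admissible a1 b2 b3" "t \<in> {0..1}"
  shows "a1 t \<noteq> 0" "Complex (b2 t) (b3 t) \<noteq> 0"
proof -
  have "independent (range (\<lambda>i. frame a1 b2 b3 i t))"
    using assms unfolding admissible_def by simp
  then have "frame a1 b2 b3 i t \<noteq> 0" for i
    using dependent_zero[of "range (\<lambda>i. frame a1 b2 b3 i t)"] by (auto dest: range_eqI[OF sym])
  from this[of 1] this[of 2] show "a1 t \<noteq> 0" "Complex (b2 t) (b3 t) \<noteq> 0"
    by (auto simp: vec3_eq_iff frame_components)
qed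

section \<open>Quasiperiodic extension from the unit interval\<close>

definition extend :: "'a::{real_normed_field} \<Rightarrow> (real \<Rightarrow> 'a) \<Rightarrow> real \<Rightarrow> 'a" where
  "extend c f t = c powi \<lfloor>t\<rfloor> * f (frac t)"

lemma extend_shift: "c \<noteq> 0 \<Longrightarrow> extend c f (t + 1) = c * extend c f t"
  by (simp add: extend_def frac_1_eq power_int_add)

text \<open>At \<open>t = 1\<close> the floor is 1 and the fractional part 0, so the extension takes
  the value \<open>c * f 0\<close>; the multiplier must therefore match the end values.\<close>

lemma extend_eq:
  assumes "f 1 = c * f 0" "t \<in> {0..1}"
  shows "extend c f t = f t"
proof (cases "t = 1")
  case True
  then show ?thesis using assms(1) by (simp add: extend_def)
next
  case False
  then have "\<lfloor>t\<rfloor> = 0" using assms(2) by (simp add: floor_eq_iff)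
  then show ?thesis by (simp add: extend_def frac_def)
qed

lemma has_real_derivative_glue:
  assumes "(f has_real_derivative D) (at t within {t - 1..t})" "(f has_real_derivative D) (at t within {t..t + 1})"
  shows "(f has_real_derivative D) (at t)"
proof -
  have "(f has_real_derivative D) (at t within {t - 1..t} \<union> {t..t + 1})"
    using assms by (simp add: has_field_derivative_iff Lim_Un)
  moreover have "{t - 1..t} \<union> {t..t + 1} = {t - 1..t + 1}" by auto
  ultimately show ?thesis by (simp add: at_within_Icc_at)
qed

text \<open>Integral translations carry the derivative on the unit interval to every interval
  between consecutive integers. At an integer both one-sided derivatives equal \<open>g t\<close>,
  because \<open>f\<close> and \<open>g\<close> share the multiplier.\<close>

lemma quasiperiodic_derivative:
  fixes f g :: "real \<Rightarrow> real"
  assumes c: "c \<noteq> 0" and f: "\<And>t n. f (t + of_int n) = c powi n * f t" and g: "\<And>t n. g (t + of_int n) = c powi n * g t"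
    and d: "\<And>t. t \<in> {0..1} \<Longrightarrow> (f has_real_derivative g t) (at t within {0..1})"
  shows "(f has_real_derivative g t) (at t)"
proof -
  have *: "(f has_real_derivative g t) (at t within {of_int n..of_int n + 1})" if t: "t \<in> {of_int n..of_int n + 1}" for t n
  proof -
    have "((\<lambda>s. c powi n * f (s - of_int n)) has_real_derivative c powi n * g (t - of_int n)) (at t within {of_int n..of_int n + 1})"
    proof (rule DERIV_cmult)
      have "(\<lambda>s. s - of_int n) ` {of_int n..of_int n + 1} = {0..1::real}"
        by (auto simp: image_iff intro!: bexI[of _ "_ + of_int n"])
      then have "(f has_real_derivative g (t - of_int n)) (at (t - of_int n) within (\<lambda>s. s - of_int n) ` {of_int n..of_int n + 1})"
        using d[of "t - of_int n"] t by simp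
      moreover have "((\<lambda>s. s - of_int n) has_real_derivative 1) (at t within {of_int n..of_int n + 1})"
        by (auto intro!: derivative_eq_intros)
      ultimately show "((\<lambda>s. f (s - of_int n)) has_real_derivative g (t - of_int n)) (at t within {of_int n..of_int n + 1})"
        using DERIV_image_chain by (fastforce simp: o_def)
    qed
    moreover have "(\<lambda>s. c powi n * f (s - of_int n)) = f" using f[of _ n, symmetric] by simp
    moreover have "c powi n * g (t - of_int n) = g t" using g[of "t - of_int n" n, symmetric] by simp
    ultimately show ?thesis by simp
  qed
  show ?thesis
  proof (cases "t = of_int \<lfloor>t\<rfloor>")
    case True
    then show ?thesis
      using *[of t "\<lfloor>t\<rfloor>"] *[of t "\<lfloor>t\<rfloor> - 1"] by (intro has_real_derivative_glue) simp_all
  next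
    case False
    then have "of_int \<lfloor>t\<rfloor> < t" "t < of_int \<lfloor>t\<rfloor> + 1" by linarith+
    then show ?thesis using *[of t "\<lfloor>t\<rfloor>"] by (simp add: at_within_Icc_at)
  qed
qed

context inoue_warped
begin

text \<open>The extended coefficients define forms and fields on the whole cover, and their
  multipliers offset the linear parts of the deck transformations, so that they descend. The induced
  structure is then the warped one.\<close>

lemma induced_structure:
  fixes b2 b3 a1 :: "real \<Rightarrow> real" and b :: "real \<Rightarrow> complex"
  assumes b_nonzero: "\<And>t. b t \<noteq> 0" and b_shift: "\<And>t n. b (t + of_int n) = \<beta> powi n * b t"
    and m_b: "\<And>t. m t = 1 / (cmod (b t))\<^sup>2"
    and agree: "\<And>t. t \<in> {0..1} \<Longrightarrow> a t = a1 t \<and> b t = Complex (b2 t) (b3 t)"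
  shows "\<exists>e E. induced_coframe L \<rho> a1 b2 b3 e \<and> induced_frame L \<rho> a1 b2 b3 E \<and>
      biholomorphic_to_Inoue_SM (mapping_torus L \<rho>) (mapping_torus_atlas L \<rho>) (mt_J 1 e E) \<and>
      biholomorphic_to_Inoue_SM (mapping_torus L \<rho>) (mapping_torus_atlas L \<rho>) (mt_J (-1) e E) \<and>
      ((\<forall>i. smooth_one_form (mapping_torus_atlas L \<rho>) (e i)) \<longrightarrow>
         split_generalized_Kaehler (mapping_torus L \<rho>) (mapping_torus_atlas L \<rho>)
           (mt_metric e) (mt_J 1 e E) (mt_J (-1) e E))"
proof -
  let ?A = "mapping_torus_atlas L \<rho>"
  let ?b2 = "\<lambda>t. Re (b t)" and ?b3 = "\<lambda>t. Im (b t)"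
  define e :: "3 \<Rightarrow> ((real^3) \<times> real, (torus_point \<times> real) set, (real^3) \<times> real \<Rightarrow> real) field"
    where "e i c y u = coframe a ?b2 ?b3 i (snd y) (fst u)" for i c y u
  define E :: "3 \<Rightarrow> ((real^3) \<times> real, (torus_point \<times> real) set, (real^3) \<times> real) field"
    where "E i c y = (frame a ?b2 ?b3 i (snd y), 0)" for i c y
  have e1: "e 1 c y u = fst u $ 1 / a (snd y)"
    and e2: "e 2 c y u = Re (zc (fst u) / b (snd y))"
    and e3: "e 3 c y u = Im (zc (fst u) / b (snd y))" for c y u
    using b_nonzero coframe_23[of ?b2 "snd y" ?b3 a "fst u"] by (simp_all add: e_def coframe_1)
  have three: "P i" if "P 1" "P 2" "P 3" for P and i :: 3
    using that exhaust_3[of i] by auto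
  have E_components: "fst (E 1 c y) $ 1 = a (snd y)" "zc (fst (E 1 c y)) = 0" "fst (E 2 c y) $ 1 = 0"
    "zc (fst (E 2 c y)) = b (snd y)" "fst (E 3 c y) $ 1 = 0" "zc (fst (E 3 c y)) = \<i> * b (snd y)"
    "snd (E i c y) = 0" for c y i
    by (simp_all add: E_def frame_components)
  have e_deck: "e i d (deck n l y) (dilp n (fst u), snd u) = e i c y u" for i c d n l y u
    by (rule three[of "\<lambda>i. e i d (deck n l y) (dilp n (fst u), snd u) = e i c y u"])
      (use \<alpha>_pos \<beta>_nonzero in \<open>simp_all add: e1 e2 e3 deck_def b_shift shift_int[of a, OF a_shift]\<close>)
  have E_deck: "(dilp n (fst (E i c y)), snd (E i c y)) = E i d (deck n l y)" for i c d n l y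
    by (rule three[of "\<lambda>i. (dilp n (fst (E i c y)), snd (E i c y)) = E i d (deck n l y)"])
      (simp_all add: R31_eq_iff_zc E_components deck_def b_shift shift_int[of a, OF a_shift])
  have "induced_coframe L \<rho> a1 b2 b3 e"
    unfolding induced_coframe_def one_form_def
  proof (intro allI conjI ballI impI)
    fix i c y u
    show "linear (e i c y)"
      by (rule three[of "\<lambda>i. linear (e i c y)"])
        (simp_all add: linear_iff e1 e2 e3 add_divide_distrib Re_divide Im_divide algebra_simps)
    show "e i c y u = coframe a1 b2 b3 i (snd y) (fst u)" if "snd y \<in> {0..1}"
      using agree[OF that] by (simp add: e_def coframe_def lfun_def)
  next
    fix i c d y u assume "c \<in> ?A" "d \<in> ?A" "y \<in> local_dom c d id"
    then obtain n l where "l \<in> lattice L" "local_map c d id y = deck n l y"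
      "differential c d id y = (\<lambda>u. (dilp n (fst u), snd u))"
      by (rule mapping_torus_transition)
    then show "e i d (local_map c d id y) (differential c d id y u) = e i c y u"
      by (simp add: e_deck)
  qed
  moreover have "induced_frame L \<rho> a1 b2 b3 E"
    unfolding induced_frame_def vector_field_def
  proof (intro allI conjI ballI impI)
    fix i c y
    show "E i c y = (frame a1 b2 b3 i (snd y), 0)" if "snd y \<in> {0..1}"
      using agree[OF that] by (simp add: E_def frame_def)
  next
    fix i c d y assume "c \<in> ?A" "d \<in> ?A" "y \<in> local_dom c d id"
    then obtain n l where "l \<in> lattice L" "local_map c d id y = deck n l y"
      "differential c d id y = (\<lambda>u. (dilp n (fst u), snd u))"
      by (rule mapping_torus_transition)
    then show "differential c d id y (E i c y) = E i d (local_map c d id y)"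
      by (simp add: E_deck)
  qed
  moreover have J: "mt_J \<epsilon> e E = (\<lambda>c. warped_J \<epsilon> a)" for \<epsilon>
  proof (intro ext)
    fix c and y u :: "(real^3) \<times> real"
    \<comment> \<open>With \<open>w = z / b\<close> the combination of the second and third frame
      vectors in \<open>mt_J\<close> becomes multiplication of \<open>z\<close> by \<open>i\<close>,
      whatever \<open>b\<close> is.\<close>
    have "Re w *\<^sub>R (\<i> * z) - Im w *\<^sub>R z = \<i> * (w * z)" for w z by (simp add: complex_eq_iff)
    from this[of "zc (fst u) / b (snd y)" "b (snd y)"]
    have "Re (zc (fst u) / b (snd y)) *\<^sub>R (\<i> * b (snd y)) - Im (zc (fst u) / b (snd y)) *\<^sub>R b (snd y)
        = \<i> * zc (fst u)" using b_nonzero by simp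
    moreover have "\<epsilon> *\<^sub>R (\<i> * zc (fst u)) = of_real \<epsilon> * \<i> * zc (fst u)"
      by (simp add: scaleR_conv_of_real)
    ultimately show "mt_J \<epsilon> e E c y u = warped_J \<epsilon> a y u"
      by (simp add: mt_J_def R31_eq_iff_zc E_components e1 e2 e3)
  qed
  moreover have g: "mt_metric e = (\<lambda>c. warped_metric a m)"
  proof (intro ext)
    fix c and y u v :: "(real^3) \<times> real"
    have "Re (z / w) * Re (z' / w) + Im (z / w) * Im (z' / w) = 1 / (cmod w)\<^sup>2 * Re (z * cnj z')" if "w \<noteq> 0" for z z' w
    proof -
      have "Re x * Re x' + Im x * Im x' = Re (x * cnj x')" for x x' by simp
      then have "Re (z / w) * Re (z' / w) + Im (z / w) * Im (z' / w) = Re ((z / w) * cnj (z' / w))" .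
      also have "(z / w) * cnj (z' / w) = of_real (1 / (cmod w)\<^sup>2) * (z * cnj z')"
        using that by (simp add: complex_norm_square del: of_real_power)
      also have "Re (of_real r * x) = r * Re x" for r x by simp
      finally show ?thesis .
    qed
    then show "mt_metric e c y u v = warped_metric a m y u v"
      using b_nonzero[of "snd y"]
      by (simp add: mt_metric_def warped_metric_zc sum_3 e1 e2 e3 m_b del: times_complex.sel)
  qed
  moreover have "split_generalized_Kaehler (mapping_torus L \<rho>) ?A
      (mt_metric e) (mt_J 1 e E) (mt_J (-1) e E)" if smooth: "\<forall>i. smooth_one_form ?A (e i)"
    unfolding J g
  proof (rule split_generalized_Kaehler_warped)
    fix c assume c: "c \<in> ?A"
    have op: "open (fst c)" using c by (auto simp: mapping_torus_atlas_def quotient_atlas_def)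
    have sm: "smooth_on (fst c) (\<lambda>y. e i c y u)" for i u
      using smooth c unfolding smooth_one_form_def by blast
    have "e 1 c y (axis 1 1, 0) = 1 / a (snd y)" for y by (simp add: e1)
    then show "smooth_on (fst c) (\<lambda>y. 1 / a (snd y))" using sm[of 1 "(axis 1 1, 0)"] by simp
    have zc1: "zc (axis 2 1) = 1" by (simp add: complex_eq_iff axis_def)
    \<comment> \<open>The second and third forms take the real and imaginary part of
      \<open>1 / b\<close> on this vector, and the squares add up to \<open>m\<close>; thus
      \<open>m\<close> inherits smoothness from the coframe.\<close>
    have "e 2 c y (axis 2 1, 0) * e 2 c y (axis 2 1, 0) + e 3 c y (axis 2 1, 0) * e 3 c y (axis 2 1, 0)
        = m (snd y)" for y
    proof -
      have "Re w * Re w + Im w * Im w = (cmod w)\<^sup>2" for w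
        unfolding cmod_power2 by (simp add: power2_eq_square)
      then show ?thesis by (simp add: e2 e3 zc1 m_b norm_divide power_divide)
    qed
    then show "smooth_on (fst c) (\<lambda>y. m (snd y))"
      using smooth_on_add[OF op smooth_on_mult[OF op sm sm] smooth_on_mult[OF op sm sm],
          of 2 "(axis 2 1, 0)" 2 "(axis 2 1, 0)" 3 "(axis 2 1, 0)" 3 "(axis 2 1, 0)"] by simp
  qed
  ultimately show ?thesis using biholomorphic_to_Inoue_warped[of 1] biholomorphic_to_Inoue_warped[of "-1"]
    by (intro exI[of _ e] exI[of _ E]) simp
qed

end

lemma split_generalized_Kaehler_mapping_torus:
  assumes "torus_bundle L \<alpha> \<beta> p \<rho>" "\<alpha> * (cmod \<beta>)\<^sup>2 = 1" "\<alpha> \<noteq> 1" "Im \<beta> \<noteq> 0"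
  shows "\<exists>g Jp Jm.
            split_generalized_Kaehler (mapping_torus L \<rho>) (mapping_torus_atlas L \<rho>) g Jp Jm \<and>
            biholomorphic_to_Inoue_SM (mapping_torus L \<rho>) (mapping_torus_atlas L \<rho>) Jp \<and>
            biholomorphic_to_Inoue_SM (mapping_torus L \<rho>) (mapping_torus_atlas L \<rho>) Jm"
proof -
  interpret torus_bundle L \<alpha> \<beta> p \<rho> by fact
  \<comment> \<open>One function serves as both coefficients: its multiplier is
    \<open>\<alpha>\<close>, and its derivative is \<open>ln \<alpha>\<close> times itself, with
    \<open>ln \<alpha>\<close> nonzero because \<open>\<alpha> \<noteq> 1\<close>.\<close>
  let ?f = "\<lambda>t. exp (ln \<alpha> * t)"
  interpret inoue_warped L \<alpha> \<beta> p \<rho> ?f ?f "ln \<alpha>"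
    by unfold_locales
      (use assms \<alpha>_pos in \<open>auto intro!: derivative_eq_intros simp: ring_distribs exp_add\<close>)
  have "smooth_on V (\<lambda>y. 1 / ?f (snd y))" if "open V" for V :: "((real^3) \<times> real) set"
    using smooth_on_exp_snd[OF that, of "- ln \<alpha>"] by (simp add: exp_minus inverse_eq_divide)
  then have "split_generalized_Kaehler (mapping_torus L \<rho>) (mapping_torus_atlas L \<rho>)
      (\<lambda>c. warped_metric ?f ?f) (\<lambda>c. warped_J 1 ?f) (\<lambda>c. warped_J (-1) ?f)"
    by (intro split_generalized_Kaehler_warped)
      (auto simp: mapping_torus_atlas_def quotient_atlas_def smooth_on_exp_snd)
  then show ?thesis using biholomorphic_to_Inoue_warped[of 1] biholomorphic_to_Inoue_warped[of "-1"] by auto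
qed

text \<open>The equation \<open>p - dil \<alpha> \<beta> p = v\<close> is solved separately on the
  axis and on the plane, where 1 is not a multiplier.\<close>

lemma dil_fixed_point:
  assumes "\<alpha> \<noteq> 1" "\<beta> \<noteq> 1"
  shows "\<exists>p. \<forall>x. dil \<alpha> \<beta> x + v = dil \<alpha> \<beta> (x - p) + p"
proof -
  define p :: "real^3" where
    "p = vector [v $ 1 / (1 - \<alpha>), Re (zc v / (1 - \<beta>)), Im (zc v / (1 - \<beta>))]"
  have "p $ 1 = v $ 1 / (1 - \<alpha>)" "zc p = zc v / (1 - \<beta>)"
    unfolding p_def by (simp_all only: complex_eq_iff vector_3 Re_zc Im_zc)
  then have "p $ 1 - \<alpha> * p $ 1 = v $ 1" "zc p - \<beta> * zc p = zc v"
    using assms by (simp_all add: field_simps)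
  then have "dil \<alpha> \<beta> x + v = dil \<alpha> \<beta> (x - p) + p" for x
    by (simp add: vec3_eq_iff algebra_simps)
  then show ?thesis by blast
qed

theorem lemma3p2:
  fixes L :: "real^3^3" and a1 b2 b3 :: "real \<Rightarrow> real" and \<rho> :: "torus_point \<Rightarrow> torus_point"
  assumes lattice: "invertible L"
    and adm: "admissible a1 b2 b3"
    and diffeo: "diffeomorphism (torus L) (torus_atlas L) (torus L) (torus_atlas L) \<rho>"
    and pullback: "\<And>i. pullback_is (torus_atlas L) (torus_atlas L) \<rho>
                         (\<lambda>c x. coframe a1 b2 b3 i 1) (\<lambda>c x. coframe a1 b2 b3 i 0)"
    and const: "\<exists>k. k \<noteq> 0 \<and> (\<forall>t\<in>{0..1}. deriv01 (\<lambda>s. 1 / lfun b2 b3 s) t * (1 / a1 t) = k)"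
  shows "(\<exists>g Jp Jm.
            split_generalized_Kaehler (mapping_torus L \<rho>) (mapping_torus_atlas L \<rho>) g Jp Jm \<and>
            biholomorphic_to_Inoue_SM (mapping_torus L \<rho>) (mapping_torus_atlas L \<rho>) Jp \<and>
            biholomorphic_to_Inoue_SM (mapping_torus L \<rho>) (mapping_torus_atlas L \<rho>) Jm) \<and>
         (\<exists>e E.
            induced_coframe L \<rho> a1 b2 b3 e \<and> induced_frame L \<rho> a1 b2 b3 E \<and>
            biholomorphic_to_Inoue_SM (mapping_torus L \<rho>) (mapping_torus_atlas L \<rho>) (mt_J 1 e E) \<and>
            biholomorphic_to_Inoue_SM (mapping_torus L \<rho>) (mapping_torus_atlas L \<rho>) (mt_J (-1) e E) \<and>
            ((\<forall>i. smooth_one_form (mapping_torus_atlas L \<rho>) (e i)) \<longrightarrow>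
               split_generalized_Kaehler (mapping_torus L \<rho>) (mapping_torus_atlas L \<rho>)
                 (mt_metric e) (mt_J 1 e E) (mt_J (-1) e E)))"
proof -
  define b where "b t = Complex (b2 t) (b3 t)" for t
  define M where "M t = 1 / (cmod (b t))\<^sup>2" for t
  \<comment> \<open>The ratios of end values are the multipliers for the extension of the
    coefficients and, by the pullback condition, also give the linear part of the monodromy.\<close>
  define \<alpha> \<beta> where "\<alpha> = a1 1 / a1 0" and "\<beta> = b 1 / b 0"
  have a0: "a1 t \<noteq> 0" and b0: "b t \<noteq> 0" if "t \<in> {0..1}" for t
    using admissible_nonzero[OF adm that] by (auto simp: b_def)
  have ab1: "a1 1 = \<alpha> * a1 0" "b 1 = \<beta> * b 0" using a0[of 0] b0[of 0] by (auto simp: \<alpha>_def \<beta>_def)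
  have \<beta>0: "\<beta> \<noteq> 0" using b0[of 0] b0[of 1] by (simp add: \<beta>_def)
  have diff: "f differentiable (at t within {0..1})" if "smooth_on {0..1} f" "t \<in> {0..1}" for f :: "real \<Rightarrow> real" and t
  proof -
    have "Ck_on (Suc 0) {0..1} f" using that(1) unfolding smooth_on_def by blast
    then show ?thesis using that(2) by (simp add: differentiable_on_def)
  qed
  obtain k where k: "k \<noteq> 0" "\<And>t. t \<in> {0..1} \<Longrightarrow> deriv01 (\<lambda>s. 1 / lfun b2 b3 s) t * (1 / a1 t) = k"
    using const by blast
  have M_lfun: "M = (\<lambda>s. 1 / lfun b2 b3 s)" by (simp add: M_def lfun_eq b_def fun_eq_iff)
  have M_deriv: "(M has_real_derivative k * a1 t) (at t within {0..1})" if t: "t \<in> {0..1}" for t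
  proof -
    have "lfun b2 b3 t \<noteq> 0" using b0[OF t] by (simp add: lfun_eq b_def)
    moreover have "b2 differentiable (at t within {0..1})" "b3 differentiable (at t within {0..1})"
      using diff t adm unfolding admissible_def by blast+
    ultimately have "M differentiable (at t within {0..1})"
      unfolding M_lfun lfun_def by (intro derivative_intros) auto
    then have "(M has_vector_derivative deriv01 M t) (at t within {0..1})"
      by (simp add: deriv01_def vector_derivative_works)
    moreover have "deriv01 M t = k * a1 t" using k(2)[OF t] a0[OF t] by (simp add: M_lfun field_simps)
    ultimately show ?thesis by (simp add: has_real_derivative_iff_has_vector_derivative)
  qed
  \<comment> \<open>\<open>a1\<close> is continuous without zeros on the interval, so its end values
    have the same sign.\<close>
  have "\<alpha> > 0"
  proof -
    have "continuous_on {0..1} a1"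
      using adm diff unfolding admissible_def by (intro differentiable_imp_continuous_on) (auto simp: differentiable_on_def)
    then have "connected (a1 ` {0..1})" by (rule connected_continuous_image) simp
    moreover have "0 \<notin> a1 ` {0..1}" using a0 by auto
    moreover have "a1 0 \<in> a1 ` {0..1}" "a1 1 \<in> a1 ` {0..1}" by auto
    ultimately have "\<not> (a1 0 \<le> 0 \<and> 0 \<le> a1 1)" "\<not> (a1 1 \<le> 0 \<and> 0 \<le> a1 0)"
      using connectedD_interval by blast+
    then show ?thesis by (auto simp: \<alpha>_def zero_less_divide_iff)
  qed
  have bij: "bij_betw \<rho> (torus L) (torus L)" and smooth: "smooth_map (torus_atlas L) (torus_atlas L) \<rho>"
    using diffeo by (auto simp: diffeomorphism_def)
  have differential: "differential c d \<rho> x = dil \<alpha> \<beta>"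
    if "c \<in> torus_atlas L" "d \<in> torus_atlas L" "x \<in> local_dom c d \<rho>" for c d x
  proof
    fix u
    \<comment> \<open>The three pullback equations, with the last two combined into one for
      \<open>dz / b\<close>, determine the differential as the same linear map in all
      charts.\<close>
    have "coframe a1 b2 b3 i 1 (differential c d \<rho> x u) = coframe a1 b2 b3 i 0 u" for i
      using pullback[of i] that unfolding pullback_is_def by blast
    from this[of 1] this[of 2] this[of 3]
    have "differential c d \<rho> x u $ 1 / a1 1 = u $ 1 / a1 0" "zc (differential c d \<rho> x u) / b 1 = zc u / b 0"
      using b0[of 0] b0[of 1] by (simp_all add: coframe_1 coframe_23 complex_eq_iff[of "_ / _"] b_def)
    then show "differential c d \<rho> x u = dil \<alpha> \<beta> u"
      using a0[of 0] a0[of 1] b0[of 0] b0[of 1] by (simp add: vec3_eq_iff \<alpha>_def \<beta>_def field_simps)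
  qed
  obtain v where v: "\<And>x. \<rho> (torus_proj L x) = torus_proj L (dil \<alpha> \<beta> x + v)"
    using constant_differential_lift[OF lattice smooth bounded_linear_dil differential] by blast
  have image: "dil \<alpha> \<beta> ` lattice L = lattice L"
    using lattice_image_of_lift[OF bij v] \<open>\<alpha> > 0\<close> \<beta>0 by simp
  have volume: "\<alpha> * (cmod \<beta>)\<^sup>2 = 1" by (rule dil_lattice_volume(1)[OF lattice image \<open>\<alpha> > 0\<close> \<beta>0])
  \<comment> \<open>The end values of \<open>M\<close> have ratio
    \<open>1 / (cmod \<beta>)^2\<close>, which the volume relation identifies with
    \<open>\<alpha>\<close>.\<close>
  have M1: "M 1 = \<alpha> * M 0"
    using volume \<beta>0 b0[of 0] by (simp add: M_def ab1 norm_mult power_mult_distrib field_simps)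
  \<comment> \<open>Otherwise \<open>M\<close> would have equal end values, and the mean value
    theorem would give a zero of its derivative \<open>k * a1\<close>.\<close>
  have "\<alpha> \<noteq> 1"
  proof
    assume "\<alpha> = 1"
    have "continuous_on {0..1} M"
      using M_deriv by (meson DERIV_continuous continuous_on_eq_continuous_within)
    moreover have "(M has_derivative (*) (k * a1 t)) (at t)" if "0 < t" "t < 1" for t
      using M_deriv[of t] that by (simp add: at_within_Icc_at has_field_derivative_def)
    ultimately obtain t where "0 < t" "t < 1" "M 1 - M 0 = (k * a1 t) * (1 - 0)"
      using mvt[of 0 1 M "\<lambda>t. (*) (k * a1 t)"] by auto
    then show False using M1 \<open>\<alpha> = 1\<close> k(1) a0[of t] by simp
  qed
  have nonreal: "Im \<beta> \<noteq> 0" by (rule dil_lattice_nonreal[OF lattice image \<open>\<alpha> > 0\<close> \<beta>0 \<open>\<alpha> \<noteq> 1\<close>])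
  then have "\<beta> \<noteq> 1" by auto
  obtain p where p: "\<And>x. dil \<alpha> \<beta> x + v = dil \<alpha> \<beta> (x - p) + p"
    using dil_fixed_point[OF \<open>\<alpha> \<noteq> 1\<close> \<open>\<beta> \<noteq> 1\<close>] by blast
  have torus_bundle: "torus_bundle L \<alpha> \<beta> p \<rho>"
    by unfold_locales (use lattice \<open>\<alpha> > 0\<close> \<beta>0 image v p in auto)
  then interpret torus_bundle L \<alpha> \<beta> p \<rho> .
  define a m B where "a = extend \<alpha> a1" and "m = extend \<alpha> M" and "B = extend \<beta> b"
  have shifts: "a (t + 1) = \<alpha> * a t" "m (t + 1) = \<alpha> * m t" "B (t + 1) = \<beta> * B t" for t
    using \<open>\<alpha> > 0\<close> \<beta>0 by (simp_all add: a_def m_def B_def extend_shift)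
  have agree: "a t = a1 t" "m t = M t" "B t = b t" if "t \<in> {0..1}" for t
    using extend_eq[of a1 \<alpha> t] extend_eq[of M \<alpha> t] extend_eq[of b \<beta> t] ab1 M1 that
    by (simp_all add: a_def m_def B_def)
  have frac01: "frac t \<in> {0..1}" for t :: real by (simp add: frac_ge_0 frac_lt_1 less_imp_le)
  have B0: "B t \<noteq> 0" for t using b0[OF frac01] \<beta>0 by (simp add: B_def extend_def)
  \<comment> \<open>The relation between \<open>M\<close> and \<open>b\<close> persists on the whole
    line because the volume relation matches the multipliers of both sides.\<close>
  have m_B: "m t = 1 / (cmod (B t))\<^sup>2" for t
  proof -
    have "\<alpha> powi n = 1 / (cmod (\<beta> powi n))\<^sup>2" for n
      using power_int_volume[OF volume, of n] \<beta>0 by (simp add: field_simps)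
    then show ?thesis by (simp add: m_def B_def extend_def M_def norm_mult power_mult_distrib)
  qed
  interpret inoue_warped L \<alpha> \<beta> p \<rho> a m k
  proof
    show "a t \<noteq> 0" for t using a0[OF frac01] \<open>\<alpha> > 0\<close> by (simp add: a_def extend_def)
    show "m t > 0" for t using B0[of t] by (simp add: m_B)
    show "(m has_real_derivative k * a t) (at t)" for t
    proof (rule quasiperiodic_derivative[where c = \<alpha>])
      fix t :: real assume t: "t \<in> {0..1}"
      show "(m has_real_derivative k * a t) (at t within {0..1})"
        using has_derivative_transform[OF t agree(2) M_deriv[OF t, unfolded has_field_derivative_def]]
          agree(1)[OF t] by (simp add: has_field_derivative_def)
    qed (use \<open>\<alpha> > 0\<close> quasiperiodic_int[of m, OF shifts(2)] quasiperiodic_int[of a, OF shifts(1)] in simp_all)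
  qed (use k(1) volume shifts \<open>\<alpha> \<noteq> 1\<close> nonreal in auto)
  have "\<exists>e E. induced_coframe L \<rho> a1 b2 b3 e \<and> induced_frame L \<rho> a1 b2 b3 E \<and>
      biholomorphic_to_Inoue_SM (mapping_torus L \<rho>) (mapping_torus_atlas L \<rho>) (mt_J 1 e E) \<and>
      biholomorphic_to_Inoue_SM (mapping_torus L \<rho>) (mapping_torus_atlas L \<rho>) (mt_J (-1) e E) \<and>
      ((\<forall>i. smooth_one_form (mapping_torus_atlas L \<rho>) (e i)) \<longrightarrow>
         split_generalized_Kaehler (mapping_torus L \<rho>) (mapping_torus_atlas L \<rho>)
           (mt_metric e) (mt_J 1 e E) (mt_J (-1) e E))"
    by (rule induced_structure[of B])
      (use B0 quasiperiodic_int[of B, OF shifts(3) \<beta>0] m_B agree b_def in auto)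
  then show ?thesis
    using split_generalized_Kaehler_mapping_torus[OF torus_bundle volume \<open>\<alpha> \<noteq> 1\<close> nonreal] by blast
qed

end
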